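(* $\Sigma_{n,2d}^{D_n}=\mathcal{P}_{n,2d}^{D_n}$ if and only if $(n,2d)\in\{(n,2),(n,4),(3,8)\}$, that is, if and only if $2d=2$, or $2d=4$, or $(n,2d)=(3,8)$.
   Context: Here $n$ is the number of variables and $2d$ is the (even) degree of the forms. $D_n$ is the reflection group acting on $\mathbb{R}^n$ generated by the reflections at the hyperplanes $\{X_i=\pm X_j\}$, $1\leq i<j\leq n$; it is the index-2 subgroup of the hyperoctahedral group $B_n$ (which acts by coordinate permutations and sign changes) consisting of coordinate permutations combined with an even number of sign changes. $\mathcal{P}_{n,2d}^{D_n}$ is the cone of $D_n$-invariant real forms (homogeneous polynomials) of degree $2d$ in $n$ variables that are non-negative on $\mathbb{R}^n$, and $\Sigma_{n,2d}^{D_n}$ is the cone of those $D_n$-invariant real forms of degree $2d$ in $n$ variables that are sums of squares of real forms.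
   Formalization: The formal theorem assumes n ≥ 3 and 2d ≥ 2; for n ≤ 2 every non-negative form is a sum of squares in every degree, and in degree 0 the two cones coincide, so the "only if" part fails there. *)

theory Defs
  imports
    "HOL-Analysis.Analysis"
    "HOL-Library.Poly_Mapping"
    "HOL-Algebra.Bij"
    "HOL-Algebra.Generated_Groups"
begin

text \<open>
  Real polynomials in the variables \<open>X\<^sub>i\<close> (\<open>i :: 'n\<close>) are finitely supported maps from exponent
  vectors to coefficients, with the ring structure of \<^theory>\<open>HOL-Library.Poly_Mapping\<close>.
  The number of variables is \<open>CARD('n)\<close>.
\<close>

type_synonym 'n real_mpoly = "('n \<Rightarrow>\<^sub>0 nat) \<Rightarrow>\<^sub>0 real"

definition mpoly_eval :: "'n::finite real_mpoly \<Rightarrow> real ^ 'n \<Rightarrow> real" where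
  "mpoly_eval p x =
     (\<Sum>m\<in>Poly_Mapping.keys p. Poly_Mapping.lookup p m * (\<Prod>i\<in>UNIV. (x $ i) ^ Poly_Mapping.lookup m i))"

text \<open>As usual, the zero polynomial counts as a form of every degree.\<close>

definition is_form :: "nat \<Rightarrow> 'n::finite real_mpoly \<Rightarrow> bool" where
  "is_form k p \<longleftrightarrow> (\<forall>m\<in>Poly_Mapping.keys p. (\<Sum>i\<in>UNIV. Poly_Mapping.lookup m i) = k)"

text \<open>The orthogonal reflection at the hyperplane with normal vector \<open>v \<noteq> 0\<close>.\<close>

definition reflection :: "'a::real_inner \<Rightarrow> 'a \<Rightarrow> 'a" where
  "reflection v x = x - (2 * (x \<bullet> v) / (v \<bullet> v)) *\<^sub>R v"

text \<open>
  The hyperplanes \<open>X\<^sub>i = X\<^sub>j\<close> and \<open>X\<^sub>i = - X\<^sub>j\<close> have the normal vectors \<open>e\<^sub>i - e\<^sub>j\<close> and \<open>e\<^sub>i + e\<^sub>j\<close>.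
  The index type carries no order; since the hyperplanes are symmetric in \<open>i\<close> and \<open>j\<close>, ranging over
  \<open>i \<noteq> j\<close> yields the same reflections as ranging over \<open>i < j\<close>.
\<close>

definition D_reflections :: "(real ^ 'n \<Rightarrow> real ^ 'n) set" where
  "D_reflections =
     {reflection (axis i 1 - axis j 1) | i j. i \<noteq> j} \<union>
     {reflection (axis i 1 + axis j 1) | i j. i \<noteq> j}"

definition D_group :: "(real ^ 'n \<Rightarrow> real ^ 'n) set" where
  "D_group = generate (BijGroup UNIV) D_reflections"

text \<open>
  The group acts by \<open>(g \<cdot> p)(x) = p(g\<inverse> x)\<close>. Invariance of a polynomial is expressed through its
  polynomial function, which determines it because the ground field is infinite.
\<close>

definition D_invariant :: "'n::finite real_mpoly \<Rightarrow> bool" where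
  "D_invariant p \<longleftrightarrow> (\<forall>g\<in>D_group. \<forall>x. mpoly_eval p (g x) = mpoly_eval p x)"

definition psd_D_forms :: "nat \<Rightarrow> 'n::finite real_mpoly set" where
  "psd_D_forms k = {p. is_form k p \<and> D_invariant p \<and> (\<forall>x. mpoly_eval p x \<ge> 0)}"

text \<open>The summands need not be squares of invariant forms.\<close>

definition sos_D_forms :: "nat \<Rightarrow> 'n::finite real_mpoly set" where
  "sos_D_forms k = {p. is_form k p \<and> D_invariant p \<and>
     (\<exists>qs. (\<forall>q\<in>set qs. \<exists>l. is_form l q) \<and> p = (\<Sum>q\<leftarrow>qs. q ^ 2))}"

end

(*
  Non-negative forms that are not sums of squares come from Schur's inequality, extended to n
  variables and evaluated at the squares x_i^2: S_k = sum_i x_i^(2k) w_i, of degree 2k + 4.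
  If k is odd and S_k (for n = 3) is a sum of squares, parity and the order of contact along the planes
  x_i = +-x_j force every summand to vanish at (1,0,0), where S_k = 1. So S_(d-2) settles odd d >= 3,
  and e_3(x_1^2, ..., x_n^2) S_(d-5) settles even d >= 6, as (xyz)^2 can be divided out.
  For d = 4 and n >= 4 take (sum_i x_i^2) S_1: a quartic that vanishes at all vectors over {0, 1, -1} with
  two or three nonzero entries also vanishes at the unit vectors.

  In the remaining cases the invariant forms span a space of dimension at most four. Quadratic and quartic
  ones are decomposed directly. Ternary octics are symmetric quartics f(a, b, c) at a = x^2, b = y^2, c = z^2;
  subtracting a multiple of (a + b + c) abc creates a double zero on the plane a = b, and the
  symmetric quartics with this zero are a combination of two sums of squares.
*)

theory Submission
  imports Defs
begin

section \<open>Polynomials and their polynomial functions\<close>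

text \<open>The oddness of k cannot simply be dropped: for n = 3 the octic S_2 is non-negative,
  hence a sum of squares by the second half. Where y = +-x, S_k reduces to the square of z^k (z^2 -
  x^2), so a polynomial whose square lies below S_k restricts to a multiple of z^k (z^2 - x^2), and
  odd k makes this odd in z. That argument uses only the pointwise bound q^2 <= p and no degrees,
  and it survives restriction to three coordinates, so one ternary computation serves all n. Degree
  8 is the exception: equality holds for n = 3, so a counterexample must involve four variables at
  once, and there the summands have to be known to be quartic. For octics the obstacle is that
  subtracting a multiple of (a + b + c) abc may destroy non-negativity inside the orthant. What
  follows tests the difference only at points (1, 1, s) and on c = 0, where the subtracted term
  vanishes; so the largest multiple that keeps the values at (1, 1, s) non-negative is a safe
  choice.\<close>

definition mono_eval :: "('n::finite \<Rightarrow>\<^sub>0 nat) \<Rightarrow> real ^ 'n \<Rightarrow> real" where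
  "mono_eval m x = (\<Prod>i\<in>UNIV. (x $ i) ^ Poly_Mapping.lookup m i)"

lemma mpoly_eval_superset:
  assumes "finite K" "Poly_Mapping.keys p \<subseteq> K"
  shows "mpoly_eval p x = (\<Sum>m\<in>K. Poly_Mapping.lookup p m * mono_eval m x)"
  unfolding mpoly_eval_def mono_eval_def
  by (rule sum.mono_neutral_left) (use assms in \<open>auto simp: in_keys_iff\<close>)

lemma mpoly_eval_keys:
  "mpoly_eval p x = (\<Sum>m\<in>Poly_Mapping.keys p. Poly_Mapping.lookup p m * mono_eval m x)"
  by (rule mpoly_eval_superset) auto

lemma mono_eval_add: "mono_eval (a + b) x = mono_eval a x * mono_eval b x"
  by (simp add: mono_eval_def lookup_add power_add prod.distrib)

lemma mono_eval_single [simp]: "mono_eval (Poly_Mapping.single i k) x = (x $ i) ^ k"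
proof -
  have "mono_eval (Poly_Mapping.single i k) x = (\<Prod>j\<in>UNIV. if j = i then (x $ i) ^ k else 1)"
    unfolding mono_eval_def by (rule prod.cong) (auto simp: lookup_single when_def)
  then show ?thesis by simp
qed

lemma mono_eval_zero [simp]: "mono_eval 0 x = 1"
  by (simp add: mono_eval_def)

lemma mono_eval_scale:
  "mono_eval m (t *\<^sub>R x) = t ^ (\<Sum>i\<in>UNIV. Poly_Mapping.lookup m i) * mono_eval m x"
  by (simp add: mono_eval_def power_mult_distrib prod.distrib power_sum)

lemma mpoly_eval_zero [simp]: "mpoly_eval 0 x = 0"
  by (simp add: mpoly_eval_def)

lemma mpoly_eval_single [simp]: "mpoly_eval (Poly_Mapping.single m c) x = c * mono_eval m x"
  by (cases "c = 0") (simp_all add: mpoly_eval_def mono_eval_def)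

lemma mpoly_eval_one [simp]: "mpoly_eval 1 x = 1"
  by (simp add: single_one[symmetric] del: single_one)

lemma mpoly_eval_add [simp]: "mpoly_eval (p + q) x = mpoly_eval p x + mpoly_eval q x"
proof -
  let ?K = "Poly_Mapping.keys p \<union> Poly_Mapping.keys q"
  have "Poly_Mapping.keys (p + q) \<subseteq> ?K" by (rule keys_add)
  then show ?thesis
    by (simp add: mpoly_eval_superset[of ?K] lookup_add sum.distrib ring_distribs)
qed

lemma mpoly_eval_sum [simp]: "mpoly_eval (sum f A) x = (\<Sum>a\<in>A. mpoly_eval (f a) x)"
  by (induction A rule: infinite_finite_induct) auto

lemma mpoly_eval_sum_list [simp]: "mpoly_eval (\<Sum>q\<leftarrow>qs. f q) x = (\<Sum>q\<leftarrow>qs. mpoly_eval (f q) x)"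
  by (induction qs) auto

lemma sum_single_lookup:
  "(\<Sum>m\<in>Poly_Mapping.keys p. Poly_Mapping.single m (Poly_Mapping.lookup p m)) = p"
proof (rule poly_mapping_eqI)
  fix k
  show "Poly_Mapping.lookup (\<Sum>m\<in>Poly_Mapping.keys p. Poly_Mapping.single m (Poly_Mapping.lookup p m)) k
      = Poly_Mapping.lookup p k"
    by (cases "k \<in> Poly_Mapping.keys p")
       (auto simp: lookup_sum lookup_single when_def sum.delta in_keys_iff)
qed

lemma mpoly_eval_mult [simp]: "mpoly_eval (p * q) x = mpoly_eval p x * mpoly_eval q x"
proof -
  have "p * q = (\<Sum>a\<in>Poly_Mapping.keys p. \<Sum>b\<in>Poly_Mapping.keys q.
           Poly_Mapping.single (a + b) (Poly_Mapping.lookup p a * Poly_Mapping.lookup q b))"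
    unfolding mult_single[symmetric] sum_product[symmetric] sum_single_lookup ..
  then show ?thesis
    by (simp add: mpoly_eval_keys[of p] mpoly_eval_keys[of q] sum_product mono_eval_add algebra_simps)
qed

lemma mpoly_eval_power [simp]: "mpoly_eval (p ^ k) x = mpoly_eval p x ^ k"
  by (induction k) auto

text \<open>The variables are eliminated one at a time: for fixed other coordinates the sum is a
  polynomial in \<open>x i\<close> that vanishes identically, so each coefficient
  \<open>e j x\<close> does. Exponents are functions and \<open>I\<close> is a set because the type
  of variables cannot shrink during the induction.\<close>

lemma monomials_independent:
  fixes c :: "('n \<Rightarrow> nat) \<Rightarrow> real"
  assumes "finite I" "finite K"
    and "\<And>m i. m \<in> K \<Longrightarrow> i \<notin> I \<Longrightarrow> m i = 0"
    and "\<And>x. (\<Sum>m\<in>K. c m * (\<Prod>i\<in>I. x i ^ m i)) = 0"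
    and "m \<in> K"
  shows "c m = 0"
  using assms
proof (induction I arbitrary: K c m rule: finite_induct)
  case empty
  then have "m' = (\<lambda>_. 0)" if "m' \<in> K" for m' using that by auto
  then have "K = {\<lambda>_. 0}" using empty.prems(4) by auto
  then show ?case using empty.prems(3)[of undefined] empty.prems(4) by auto
next
  case (insert i I)
  define N where "N = Max ((\<lambda>m. m i) ` K)"
  have N: "m i \<le> N" if "m \<in> K" for m
    unfolding N_def using that insert.prems(1) by auto
  define e where "e j x = (\<Sum>m\<in>{m\<in>K. m i = j}. c m * (\<Prod>l\<in>I. x l ^ m l))" for j x
  have ze: "e j x = 0" for j x
  proof (cases "j \<le> N")
    case True
    have "(\<Sum>j\<le>N. e j x * t ^ j) = 0" for t
    proof -
      have "(\<Sum>j\<le>N. e j x * t ^ j) =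
            (\<Sum>j\<le>N. \<Sum>m\<in>{m\<in>K. m i = j}. c m * (\<Prod>l\<in>insert i I. (x(i := t)) l ^ m l))"
      proof (rule sum.cong)
        fix j
        show "e j x * t ^ j = (\<Sum>m\<in>{m\<in>K. m i = j}. c m * (\<Prod>l\<in>insert i I. (x(i := t)) l ^ m l))"
          unfolding e_def sum_distrib_right
        proof (rule sum.cong)
          fix m assume m: "m \<in> {m\<in>K. m i = j}"
          have "(\<Prod>l\<in>I. (x(i := t)) l ^ m l) = (\<Prod>l\<in>I. x l ^ m l)"
            by (rule prod.cong) (use insert.hyps in auto)
          then show "c m * (\<Prod>l\<in>I. x l ^ m l) * t ^ j = c m * (\<Prod>l\<in>insert i I. (x(i := t)) l ^ m l)"
            using m insert.hyps by simp
        qed simp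
      qed simp
      also have "\<dots> = (\<Sum>m\<in>K. c m * (\<Prod>l\<in>insert i I. (x(i := t)) l ^ m l))"
        using insert.prems(1) N by (intro sum.group) auto
      finally show ?thesis using insert.prems(3) by simp
    qed
    then show ?thesis using zero_polynom_imp_zero_coeffs[of "\<lambda>j. e j x" N j] True by simp
  next
    case False
    then have "{m\<in>K. m i = j} = {}" using N by auto
    then show ?thesis by (simp only: e_def sum.empty)
  qed
  \<comment> \<open>All exponents in the slice agree at \<open>i\<close>, so erasing that entry is
    injective, and writing \<open>m i\<close> back recovers the coefficient.\<close>
  define K' where "K' = (\<lambda>m. m(i := 0)) ` {m'\<in>K. m' i = m i}"
  have inj: "inj_on (\<lambda>m'. m'(i := (0::nat))) {m'\<in>K. m' i = m i}"
  proof (rule inj_onI)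
    fix f g assume fg: "f \<in> {m'\<in>K. m' i = m i}" "g \<in> {m'\<in>K. m' i = m i}" "f(i := 0) = g(i := 0)"
    show "f = g"
    proof
      fix l show "f l = g l" using fg(1,2) fun_cong[OF fg(3), of l] by (cases "l = i") simp_all
    qed
  qed
  have "c ((m(i := 0))(i := m i)) = 0"
  proof (rule insert.IH[of K' "\<lambda>m'. c (m'(i := m i))"])
    show "finite K'" unfolding K'_def using insert.prems(1) by auto
    show "m' l = 0" if "m' \<in> K'" "l \<notin> I" for m' l
      using that insert.prems(2) by (auto simp: K'_def)
    show "(\<Sum>m'\<in>K'. c (m'(i := m i)) * (\<Prod>l\<in>I. x l ^ m' l)) = 0" for x
    proof -
      have "(\<Sum>m'\<in>K'. c (m'(i := m i)) * (\<Prod>l\<in>I. x l ^ m' l)) = e (m i) x"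
        unfolding K'_def e_def sum.reindex[OF inj]
      proof (rule sum.cong)
        fix m' assume m': "m' \<in> {m'\<in>K. m' i = m i}"
        have "(\<Prod>l\<in>I. x l ^ (m'(i := 0)) l) = (\<Prod>l\<in>I. x l ^ m' l)"
          by (rule prod.cong) (use insert.hyps in auto)
        moreover have "m'(i := 0, i := m i) = m'" using m' by auto
        ultimately show "((\<lambda>m'. c (m'(i := m i)) * (\<Prod>l\<in>I. x l ^ m' l)) \<circ> (\<lambda>m. m(i := 0))) m' =
              c m' * (\<Prod>l\<in>I. x l ^ m' l)" by simp
      qed simp
      then show ?thesis using ze by simp
    qed
    show "m(i := 0) \<in> K'" using insert.prems(4) by (auto simp: K'_def)
  qed
  then show ?case by simp
qed

lemma mpoly_eval_eq_zeroD:
  assumes "\<And>x. mpoly_eval p x = 0"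
  shows "p = 0"
proof (rule poly_mapping_eqI)
  fix m
  let ?L = "Poly_Mapping.lookup :: ('a \<Rightarrow>\<^sub>0 nat) \<Rightarrow> 'a \<Rightarrow> nat"
  let ?c = "\<lambda>f. Poly_Mapping.lookup p (Abs_poly_mapping f)"
  have inj: "inj_on ?L (Poly_Mapping.keys p)"
    by (auto intro!: inj_onI poly_mapping_eqI)
  have "?c f = 0" if "f \<in> ?L ` Poly_Mapping.keys p" for f
  proof (rule monomials_independent[of UNIV "?L ` Poly_Mapping.keys p"])
    show "(\<Sum>m\<in>?L ` Poly_Mapping.keys p. ?c m * (\<Prod>i\<in>UNIV. x i ^ m i)) = 0" for x
      using assms[of "\<chi> i. x i"]
      by (simp add: sum.reindex[OF inj] mpoly_eval_def lookup_inverse)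
  qed (use that in auto)
  from this[of "?L m"] show "Poly_Mapping.lookup p m = Poly_Mapping.lookup 0 m"
    by (cases "m \<in> Poly_Mapping.keys p") (auto simp: lookup_inverse in_keys_iff)
qed

lemma mpoly_eqI:
  fixes p q :: "'n::finite real_mpoly"
  assumes "\<And>x. mpoly_eval p x = mpoly_eval q x"
  shows "p = q"
proof -
  have "mpoly_eval (p + Poly_Mapping.single 0 (- 1) * q) x = 0" for x
    using assms by simp
  then have *: "p + Poly_Mapping.single 0 (- 1) * q = 0" by (rule mpoly_eval_eq_zeroD)
  have "Poly_Mapping.single 0 (- 1) * q = - q"
    by (metis lambda_one mult_minus_left single_one single_uminus)
  then show ?thesis using * by simp
qed

section \<open>Forms and sums of squares\<close>

lemma is_form_zero [simp]: "is_form k 0"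
  by (simp add: is_form_def)

lemma is_form_add: "is_form k p \<Longrightarrow> is_form k q \<Longrightarrow> is_form k (p + q)"
  using keys_add[of p q] by (auto simp: is_form_def)

lemma is_form_sum: "(\<And>a. a \<in> A \<Longrightarrow> is_form k (f a)) \<Longrightarrow> is_form k (sum f A)"
  by (induction A rule: infinite_finite_induct) (auto intro: is_form_add)

lemma is_form_mult: "is_form k p \<Longrightarrow> is_form l q \<Longrightarrow> is_form (k + l) (p * q)"
  using keys_mult[of p q] by (fastforce simp: is_form_def lookup_add sum.distrib)

lemma is_form_const [simp]: "is_form 0 (Poly_Mapping.single 0 c)"
  by (auto simp: is_form_def)

lemma is_form_const_mult: "is_form k p \<Longrightarrow> is_form k (Poly_Mapping.single 0 c * p)"
  using is_form_mult[of 0 "Poly_Mapping.single 0 c" k p] by simp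

lemma is_form_single:
  "(\<Sum>i\<in>UNIV. Poly_Mapping.lookup m i) = k \<Longrightarrow> is_form k (Poly_Mapping.single m c)"
  by (auto simp: is_form_def)

lemma mpoly_eval_scale:
  assumes "is_form k p"
  shows "mpoly_eval p (t *\<^sub>R x) = t ^ k * mpoly_eval p x"
  using assms unfolding mpoly_eval_keys is_form_def
  by (auto simp: mono_eval_scale sum_distrib_left algebra_simps intro!: sum.cong)

text \<open>Works with functions so that decompositions become identities between real numbers;
  \<open>sos_D_formsI\<close> returns to polynomials. As in \<open>sos_D_forms\<close>, the degrees
  of the summands are left free.\<close>

definition sos_fun :: "(real ^ 'n::finite \<Rightarrow> real) \<Rightarrow> bool" where
  "sos_fun f \<longleftrightarrow> (\<exists>qs. (\<forall>q\<in>set qs. \<exists>l. is_form l q) \<and> (\<forall>x. f x = (\<Sum>q\<leftarrow>qs. (mpoly_eval q x)\<^sup>2)))"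

lemma sos_fun_zero: "sos_fun (\<lambda>x. 0)"
  unfolding sos_fun_def by (rule exI[of _ "[]"]) simp

lemma sos_fun_add:
  assumes "sos_fun f" "sos_fun g"
  shows "sos_fun (\<lambda>x. f x + g x)"
proof -
  from assms obtain qs rs where "\<forall>q\<in>set qs. \<exists>l. is_form l q" "\<forall>x. f x = (\<Sum>q\<leftarrow>qs. (mpoly_eval q x)\<^sup>2)"
    "\<forall>q\<in>set rs. \<exists>l. is_form l q" "\<forall>x. g x = (\<Sum>q\<leftarrow>rs. (mpoly_eval q x)\<^sup>2)"
    unfolding sos_fun_def by blast
  then show ?thesis unfolding sos_fun_def by (intro exI[of _ "qs @ rs"]) auto
qed

lemma sos_fun_sum: "(\<And>a. a \<in> A \<Longrightarrow> sos_fun (f a)) \<Longrightarrow> sos_fun (\<lambda>x. \<Sum>a\<in>A. f a x)"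
  by (induction A rule: infinite_finite_induct) (auto intro: sos_fun_add sos_fun_zero)

lemma sos_fun_square: "is_form l q \<Longrightarrow> 0 \<le> c \<Longrightarrow> sos_fun (\<lambda>x. c * (mpoly_eval q x)\<^sup>2)"
  unfolding sos_fun_def
  by (rule exI[of _ "[Poly_Mapping.single 0 (sqrt c) * q]"])
     (auto intro: is_form_const_mult simp: power_mult_distrib)

lemma sos_D_formsI:
  assumes "is_form k p" "D_invariant p" "sos_fun (mpoly_eval p)"
  shows "p \<in> sos_D_forms k"
proof -
  from assms(3) obtain qs where qs: "\<forall>q\<in>set qs. \<exists>l. is_form l q"
    "\<And>x. mpoly_eval p x = (\<Sum>q\<leftarrow>qs. (mpoly_eval q x)\<^sup>2)"
    unfolding sos_fun_def by blast
  have "p = (\<Sum>q\<leftarrow>qs. q ^ 2)" by (rule mpoly_eqI) (simp add: qs(2))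
  with qs(1) assms show ?thesis unfolding sos_D_forms_def by blast
qed

lemma sos_D_forms_subset: "sos_D_forms k \<subseteq> psd_D_forms k"
  unfolding sos_D_forms_def psd_D_forms_def
  by (auto intro!: sum_list_nonneg)

section \<open>Polynomial functions bounded by squares\<close>

text \<open>Division by the linear form \<open>l\<close>, with the restriction along the projection
  as remainder. The property passes from factors to products by telescoping the difference f1 f2 -
  (f1 o \<pi>) (f2 o \<pi>).\<close>

lemma real_polynomial_function_split:
  fixes f :: "'a::real_normed_vector \<Rightarrow> real"
  assumes f: "real_polynomial_function f" and pi: "bounded_linear \<pi>" and l: "bounded_linear l"
    and dec: "\<And>x. x = \<pi> x + l x *\<^sub>R e"
  shows "\<exists>g. real_polynomial_function g \<and> (\<forall>x. f x = f (\<pi> x) + l x * g x)"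
  using f
proof (induction f rule: real_polynomial_function.induct)
  case (linear f)
  then interpret bounded_linear f .
  have "f x = f (\<pi> x) + l x * f e" for x
    using arg_cong[OF dec[of x], of f] by (simp only: add scaleR real_scaleR_def)
  then show ?case
    using real_polynomial_function.intros(2)[of "f e"] by blast
next
  case (const c)
  show ?case by (intro exI[of _ "\<lambda>_. 0"]) (auto intro: real_polynomial_function.intros(2))
next
  case (add f1 f2)
  then obtain g1 g2 where g: "real_polynomial_function g1" "\<And>x. f1 x = f1 (\<pi> x) + l x * g1 x"
    "real_polynomial_function g2" "\<And>x. f2 x = f2 (\<pi> x) + l x * g2 x" by blast
  have "f1 x + f2 x = f1 (\<pi> x) + f2 (\<pi> x) + l x * (g1 x + g2 x)" for x
    unfolding ring_distribs using g(2)[of x] g(4)[of x] by linarith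
  then show ?case
    using real_polynomial_function.intros(3)[OF g(1,3)] by blast
next
  case (mult f1 f2)
  then obtain g1 g2 where g: "real_polynomial_function g1" "\<And>x. f1 x = f1 (\<pi> x) + l x * g1 x"
    "real_polynomial_function g2" "\<And>x. f2 x = f2 (\<pi> x) + l x * g2 x" by blast
  have "real_polynomial_function (\<lambda>x. f2 (\<pi> x))"
    using real_polynomial_function_compose[OF polynomial_function_bounded_linear[OF pi] mult.hyps(2)]
    by (simp add: o_def)
  then have "real_polynomial_function (\<lambda>x. f1 x * g2 x + g1 x * f2 (\<pi> x))"
    using mult.hyps g(1,3) real_polynomial_function.intros(3,4) by blast
  moreover have "f1 x * f2 x = f1 (\<pi> x) * f2 (\<pi> x) + l x * (f1 x * g2 x + g1 x * f2 (\<pi> x))" for x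
  proof -
    have "f1 x * f2 x = f1 (\<pi> x) * f2 (\<pi> x) + (f1 x * (f2 x - f2 (\<pi> x)) + (f1 x - f1 (\<pi> x)) * f2 (\<pi> x))"
      by (simp add: algebra_simps)
    also have "f2 x - f2 (\<pi> x) = l x * g2 x" using g(4)[of x] by simp
    also have "f1 x - f1 (\<pi> x) = l x * g1 x" using g(2)[of x] by simp
    finally show ?thesis by (simp add: algebra_simps)
  qed
  ultimately show ?case by blast
qed

lemma real_polynomial_function_root:
  fixes P :: "real \<Rightarrow> real"
  assumes "real_polynomial_function P" "P a = 0"
  obtains g where "real_polynomial_function g" "\<And>z. P z = (z - a) * g z"
proof -
  have 1: "polynomial_function (\<lambda>z::real. z + a)" for a by (intro polynomial_function_add) auto
  have "real_polynomial_function (\<lambda>z. P (z + a))"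
    using real_polynomial_function_compose[OF 1 assms(1)] by (simp add: o_def)
  from real_polynomial_function_split[OF this, of "\<lambda>_. 0" "\<lambda>x. x" 1]
  obtain g where g: "real_polynomial_function g" "\<And>x. P (x + a) = P a + x * g x" by auto
  have "real_polynomial_function (\<lambda>z. g (z + - a))"
    using real_polynomial_function_compose[OF 1 g(1), of "- a"] by (simp add: o_def)
  moreover have "P z = (z - a) * g (z + - a)" for z using g(2)[of "z - a"] assms(2) by simp
  ultimately show ?thesis using that by blast
qed

text \<open>Recovers a bound or a zero at the very point where a factor has been cancelled.\<close>

lemma isCont_le_extend:
  fixes f g :: "real \<Rightarrow> real"
  assumes "isCont f a" "isCont g a" "\<And>z. z \<noteq> a \<Longrightarrow> f z \<le> g z"
  shows "f a \<le> g a"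
  by (rule tendsto_le[of "at a" g "g a" f "f a"])
     (use assms in \<open>auto simp: isCont_def eventually_at intro: exI[of _ 1]\<close>)

lemma isCont_real_polynomial_function:
  "real_polynomial_function f \<Longrightarrow> isCont f (a :: 'a :: euclidean_space)"
  using differentiable_at_real_polynomial_function differentiable_imp_continuous_within by blast

lemma bounded_real_polynomial_function:
  fixes P :: "real \<Rightarrow> real"
  assumes "real_polynomial_function P" "\<And>z. \<bar>P z\<bar> \<le> C"
  shows "\<exists>c. \<forall>z. P z = c"
proof -
  obtain c n where P: "P = (\<lambda>x. \<Sum>i\<le>n. c i * x ^ i)"
    using assms(1) unfolding real_polynomial_function_iff_sum by blast
  have "c i = 0" if "i \<in> {1..n}" for i
  proof (rule ccontr)
    assume "c i \<noteq> 0"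
    have "eventually (\<lambda>z. norm (\<Sum>i\<le>n. c i * z ^ i) \<ge> C + 1) at_infinity"
      by (rule polyfun_extremal) (use \<open>c i \<noteq> 0\<close> that in \<open>auto intro!: exI[of _ i]\<close>)
    then obtain z where "norm (\<Sum>i\<le>n. c i * z ^ i) \<ge> C + 1"
      by (auto simp: eventually_at_infinity) (metis abs_ge_self norm_of_real of_real_eq_id id_apply real_norm_def)
    with assms(2)[of z] show False by (simp add: P)
  qed
  then have "P z = (\<Sum>i\<in>{0}. c i * z ^ i)" for z
    unfolding P by (intro sum.mono_neutral_right) auto
  then show ?thesis by auto
qed

text \<open>The roots are divided out one by one, multiplicities being repetitions in the list. Each
  division preserves the bound away from the root, hence everywhere by continuity; at the end a
  bounded polynomial remains, which is constant.\<close>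

lemma real_polynomial_function_dominated:
  fixes P :: "real \<Rightarrow> real"
  assumes "real_polynomial_function P" "\<And>z. \<bar>P z\<bar> \<le> (\<Prod>a\<leftarrow>as. \<bar>z - a\<bar>)"
  shows "\<exists>c. \<forall>z. P z = c * (\<Prod>a\<leftarrow>as. z - a)"
  using assms
proof (induction as arbitrary: P)
  case Nil
  then show ?case using bounded_real_polynomial_function[of P 1] by simp
next
  case (Cons a as)
  have "P a = 0" using Cons.prems(2)[of a] by simp
  then obtain g where g: "real_polynomial_function g" "\<And>z. P z = (z - a) * g z"
    using real_polynomial_function_root[OF Cons.prems(1)] by blast
  have le: "\<bar>g z\<bar> \<le> (\<Prod>a\<leftarrow>as. \<bar>z - a\<bar>)" if "z \<noteq> a" for z
    using Cons.prems(2)[of z] that by (simp add: g(2) abs_mult)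
  have "isCont (\<lambda>z. \<Prod>a\<leftarrow>as. \<bar>z - a\<bar>) a"
    by (induction as) (auto intro!: continuous_intros)
  then have "\<bar>g a\<bar> \<le> (\<Prod>a'\<leftarrow>as. \<bar>a - a'\<bar>)"
    using isCont_real_polynomial_function[OF g(1), of a] le
    by (intro isCont_le_extend[of a "\<lambda>z. \<bar>g z\<bar>" "\<lambda>z. \<Prod>a\<leftarrow>as. \<bar>z - a\<bar>"]) (auto intro!: continuous_intros)
  then have "\<bar>g z\<bar> \<le> (\<Prod>a\<leftarrow>as. \<bar>z - a\<bar>)" for z using le by (cases "z = a") auto
  from Cons.IH[OF g(1) this] show ?case by (auto simp: g(2))
qed

lemma real_polynomial_function_dominated_power:
  fixes P :: "real \<Rightarrow> real"
  assumes P: "real_polynomial_function P" "\<And>z. (P z)\<^sup>2 \<le> z ^ (2 * k) * (z\<^sup>2 - s\<^sup>2)\<^sup>2"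
  shows "\<exists>c. \<forall>z. P z = c * (z ^ k * (z\<^sup>2 - s\<^sup>2))"
proof -
  \<comment> \<open>The roots of z^k (z^2 - s^2) with multiplicity; repeated entries also cover s =
    0.\<close>
  let ?as = "s # (- s) # replicate k 0"
  have rep: "(\<Prod>a\<leftarrow>replicate k 0. f (z - a)) = f z ^ k" for z :: real and f :: "real \<Rightarrow> real"
    by (induction k) auto
  have eq: "z ^ (2 * k) * (z\<^sup>2 - s\<^sup>2)\<^sup>2 = (z ^ k * (z\<^sup>2 - s\<^sup>2))\<^sup>2" for z
    by (simp add: power_mult_distrib power_even_eq)
  have "\<bar>P z\<bar> \<le> (\<Prod>a\<leftarrow>?as. \<bar>z - a\<bar>)" for z
  proof -
    have "\<bar>P z\<bar> \<le> \<bar>z ^ k * (z\<^sup>2 - s\<^sup>2)\<bar>"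
      using P(2)[of z] unfolding eq by (simp add: abs_le_square_iff)
    also have "\<dots> = (\<Prod>a\<leftarrow>?as. \<bar>z - a\<bar>)"
      using rep[of abs z] by (simp add: abs_mult[symmetric] power_abs[symmetric] power2_eq_square algebra_simps)
    finally show ?thesis .
  qed
  from real_polynomial_function_dominated[OF P(1) this]
  obtain c where "\<And>z. P z = c * (\<Prod>a\<leftarrow>?as. z - a)" by blast
  then have "P z = c * (z ^ k * (z\<^sup>2 - s\<^sup>2))" for z
    using rep[of "\<lambda>x. x" z] by (simp add: power2_eq_square algebra_simps)
  then show ?thesis by blast
qed

section \<open>Schur's forms in three variables\<close>

text \<open>On y^2 = x^2 the first two terms vanish and the third becomes a perfect square; the same
  happens for the other pairs of variables.\<close>

definition schur3 :: "nat \<Rightarrow> real \<Rightarrow> real \<Rightarrow> real \<Rightarrow> real" where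
  "schur3 k x y z = x ^ (2 * k) * (x\<^sup>2 - y\<^sup>2) * (x\<^sup>2 - z\<^sup>2) + y ^ (2 * k) * (y\<^sup>2 - x\<^sup>2) * (y\<^sup>2 - z\<^sup>2)
     + z ^ (2 * k) * (z\<^sup>2 - x\<^sup>2) * (z\<^sup>2 - y\<^sup>2)"

lemma polynomial_function_triple:
  fixes f g h :: "'a::real_normed_vector \<Rightarrow> real"
  assumes "real_polynomial_function f" "real_polynomial_function g" "real_polynomial_function h"
  shows "polynomial_function (\<lambda>t. (f t, g t, h t))"
  unfolding polynomial_function_def
proof (intro allI impI)
  fix l :: "real \<times> real \<times> real \<Rightarrow> real"
  assume "bounded_linear l"
  then interpret bounded_linear l .
  have L: "l (a, b, c) = a * l (1, 0, 0) + b * l (0, 1, 0) + c * l (0, 0, 1)" for a b c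
  proof -
    have "(a, b, c) = a *\<^sub>R (1, 0, 0) + b *\<^sub>R (0, 1, 0) + c *\<^sub>R (0, 0, 1)" by simp
    then show ?thesis by (simp only: add scaleR real_scaleR_def)
  qed
  have "l \<circ> (\<lambda>t. (f t, g t, h t)) = (\<lambda>t. f t * l (1, 0, 0) + g t * l (0, 1, 0) + h t * l (0, 0, 1))"
    unfolding o_def by (intro ext L)
  then show "real_polynomial_function (l \<circ> (\<lambda>t. (f t, g t, h t)))"
    using assms by (auto intro!: real_polynomial_function.intros(2-))
qed

lemma real_polynomial_function_affine3:
  fixes r :: "real \<times> real \<times> real \<Rightarrow> real"
  assumes "real_polynomial_function r"
  shows "real_polynomial_function (\<lambda>t. r (a + t * a', b + t * b', c + t * c'))"
proof -
  have "real_polynomial_function (\<lambda>t::real. a + t * a')" for a a'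
    by (intro real_polynomial_function.intros(3) real_polynomial_function.intros(2))
       (auto intro: real_polynomial_function.intros(1) bounded_linear_mult_left)
  then have "polynomial_function (\<lambda>t. (a + t * a', b + t * b', c + t * c'))"
    by (intro polynomial_function_triple)
  from real_polynomial_function_compose[OF this assms] show ?thesis by (simp add: o_def)
qed

text \<open>
  On each plane \<open>y = \<plusminus>x\<close> or \<open>z = \<plusminus>x\<close> the bound makes \<open>r\<close> odd in the remaining variable, so the part
  \<open>g\<close> of \<open>r\<close> that is even in \<open>y\<close> and \<open>z\<close> vanishes on the planes \<open>y = x\<close> and \<open>z = x\<close>. Hence the gradient
  of \<open>g\<close> vanishes on the diagonal, which leaves only \<open>0\<close> among the multiples \<open>x ^ k * (x\<^sup>2 - s\<^sup>2)\<close>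
  allowed for \<open>g (x, s, s)\<close>.
\<close>

lemma polynomial_below_schur3_at_axis:
  assumes r: "real_polynomial_function r" and le: "\<And>x y z. (r (x, y, z))\<^sup>2 \<le> schur3 k x y z"
    and "odd k"
  shows "r (1, 0, 0) = 0"
proof -
  have F1: "r (x, y, - z) = - r (x, y, z)" if "y\<^sup>2 = x\<^sup>2" for x y z
  proof -
    have "(r (x, y, z))\<^sup>2 \<le> z ^ (2 * k) * (z\<^sup>2 - x\<^sup>2)\<^sup>2" for z
      using le[of x y z] that by (simp add: schur3_def power2_eq_square)
    then obtain c where "\<And>z. r (x, y, z) = c * (z ^ k * (z\<^sup>2 - x\<^sup>2))"
      using real_polynomial_function_dominated_power[of "\<lambda>z. r (x, y, z)" k x]
        real_polynomial_function_affine3[OF r, of x 0 y 0 0 1] by auto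
    then show ?thesis using \<open>odd k\<close> by simp
  qed
  have F2: "r (x, - y, z) = - r (x, y, z)" if "z\<^sup>2 = x\<^sup>2" for x y z
  proof -
    have "(r (x, y, z))\<^sup>2 \<le> y ^ (2 * k) * (y\<^sup>2 - x\<^sup>2)\<^sup>2" for y
      using le[of x y z] that by (simp add: schur3_def power2_eq_square)
    then obtain c where "\<And>y. r (x, y, z) = c * (y ^ k * (y\<^sup>2 - x\<^sup>2))"
      using real_polynomial_function_dominated_power[of "\<lambda>y. r (x, y, z)" k x]
        real_polynomial_function_affine3[OF r, of x 0 0 1 z 0] by auto
    then show ?thesis using \<open>odd k\<close> by simp
  qed
  have F3: "\<exists>c. \<forall>x. r (x, y, z) = c * (x ^ k * (x\<^sup>2 - s\<^sup>2))" if "y\<^sup>2 = s\<^sup>2" "z\<^sup>2 = s\<^sup>2" for y z s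
  proof -
    have "(r (x, y, z))\<^sup>2 \<le> x ^ (2 * k) * (x\<^sup>2 - s\<^sup>2)\<^sup>2" for x
      using le[of x y z] that by (simp add: schur3_def power2_eq_square)
    then show ?thesis
      using real_polynomial_function_dominated_power[of "\<lambda>x. r (x, y, z)" k s]
        real_polynomial_function_affine3[OF r, of 0 1 y 0 z 0] by auto
  qed
  define g where "g = (\<lambda>(x, y, z). r (x, y, z) + r (x, - y, z) + r (x, y, - z) + r (x, - y, - z))"
  \<comment> \<open>On each plane the four sign variants cancel in pairs, by the oddness just
    shown.\<close>
  have g1: "g (t, t, z) = 0" and g2: "g (t, z, t) = 0" for t z
    using F1[of t t z] F1[of "- t" t z] F2[of t t z] F2[of "- t" t z] by (simp_all add: g_def)
  have diff: "g differentiable at p" for p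
  proof -
    have "real_polynomial_function (\<lambda>p::real \<times> real \<times> real. r (fst p, a * fst (snd p), b * snd (snd p)))" for a b
    proof -
      have "polynomial_function (\<lambda>p::real \<times> real \<times> real. (fst p, a * fst (snd p), b * snd (snd p)))"
        by (intro polynomial_function_triple real_polynomial_function.intros(1) bounded_linear_intros)
      from real_polynomial_function_compose[OF this r] show ?thesis by (simp add: o_def)
    qed
    from this[of 1 1] this[of 1 "-1"] this[of "-1" 1] this[of "-1" "-1"]
    have "real_polynomial_function g"
      unfolding g_def case_prod_beta by (simp add: real_polynomial_function.intros(3))
    then show ?thesis by (rule differentiable_at_real_polynomial_function)
  qed
  have zero: "g (1, s, s) = 0" if "s \<noteq> 0" for s
  proof -
    obtain c1 c2 c3 c4 where c: "\<And>x. r (x, s, s) = c1 * (x ^ k * (x\<^sup>2 - s\<^sup>2))"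
      "\<And>x. r (x, - s, s) = c2 * (x ^ k * (x\<^sup>2 - s\<^sup>2))" "\<And>x. r (x, s, - s) = c3 * (x ^ k * (x\<^sup>2 - s\<^sup>2))"
      "\<And>x. r (x, - s, - s) = c4 * (x ^ k * (x\<^sup>2 - s\<^sup>2))"
      using F3[of s s s] F3[of "- s" s s] F3[of s s "- s"] F3[of "- s" s "- s"] by auto
    have gc: "g (x, s, s) = (c1 + c2 + c3 + c4) * (x ^ k * (x\<^sup>2 - s\<^sup>2))" for x
      by (simp only: g_def prod.case c ring_distribs)
    obtain D where D: "(g has_derivative D) (at (s, s, s))"
      using diff unfolding differentiable_def by blast
    then interpret bounded_linear D by (rule has_derivative_bounded_linear)
    have chain: "((\<lambda>t. g (a + t * a', b + t * b', c + t * c')) has_real_derivative D (a', b', c')) (at s)"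
      if "a + s * a' = s" "b + s * b' = s" "c + s * c' = s" for a a' b b' c c'
    proof -
      have "((\<lambda>t. (a + t * a', b + t * b', c + t * c')) has_derivative (\<lambda>h. (h * a', h * b', h * c'))) (at s)"
        by (auto intro!: derivative_eq_intros)
      from has_derivative_compose[OF this, of g D] D that
      have "((\<lambda>t. g (a + t * a', b + t * b', c + t * c')) has_derivative (\<lambda>h. D (h * a', h * b', h * c'))) (at s)"
        by simp
      moreover have "D (h * a', h * b', h * c') = D (a', b', c') * h" for h
        using scaleR[of h "(a', b', c')"] by (simp add: mult.commute)
      ultimately show ?thesis by (simp add: has_field_derivative_def)
    qed
    \<comment> \<open>(1, 1, 0) is tangent to the plane x = y and (0, 1, 0) to the plane x = z;
      \<open>g\<close> vanishes on both. The difference of these directions is the x-direction, in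
      which \<open>g (x, s, s)\<close> is known explicitly.\<close>
    have "D (1, 1, 0) = 0" using chain[of 0 1 0 1 s 0] by (simp add: g1 DERIV_unique[OF _ DERIV_const])
    moreover have "D (0, 1, 0) = 0" using chain[of s 0 0 1 s 0] by (simp add: g2 DERIV_unique[OF _ DERIV_const])
    moreover have "D (1, 1, 0) = D (1, 0, 0) + D (0, 1, 0)" by (simp flip: add)
    ultimately have "((\<lambda>x. (c1 + c2 + c3 + c4) * (x ^ k * (x\<^sup>2 - s\<^sup>2))) has_real_derivative 0) (at s)"
      using chain[of 0 1 s 0 s 0] by (simp add: gc)
    moreover have "((\<lambda>x. (c1 + c2 + c3 + c4) * (x ^ k * (x\<^sup>2 - s\<^sup>2))) has_real_derivative
        (c1 + c2 + c3 + c4) * (s ^ k * (2 * s))) (at s)"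
      by (auto intro!: derivative_eq_intros simp: power2_eq_square)
    ultimately have "(c1 + c2 + c3 + c4) * (s ^ k * (2 * s)) = 0"
      using DERIV_unique by blast
    with that have "c1 + c2 + c3 + c4 = 0" by simp
    then show ?thesis by (simp add: gc)
  qed
  \<comment> \<open>For s = 0 the derivative s^k * 2s gives no information, so this point is reached
    as a limit. There all four terms of \<open>g\<close> coincide.\<close>
  have "isCont (\<lambda>s. g (1, s, s)) 0"
    using isCont_o2[of 0 "\<lambda>s::real. (1::real, s, s)" g] differentiable_imp_continuous_within[OF diff[of "(1,0,0)"]]
    by (auto intro!: continuous_intros)
  then have "g (1, 0, 0) = 0"
    using isCont_le_extend[of 0 "\<lambda>s. g (1, s, s)" "\<lambda>_. 0"] isCont_le_extend[of 0 "\<lambda>_. 0" "\<lambda>s. g (1, s, s)"] zero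
    by force
  then show ?thesis by (simp add: g_def)
qed

lemma sum_of_squares_not_schur3:
  assumes "\<And>r. r \<in> set rs \<Longrightarrow> real_polynomial_function r" "odd k"
    and eq: "\<And>x y z. (\<Sum>r\<leftarrow>rs. (r (x, y, z))\<^sup>2) = schur3 k x y z"
  shows False
proof -
  have "(r (x, y, z))\<^sup>2 \<le> schur3 k x y z" if "r \<in> set rs" for r x y z
    unfolding eq[symmetric] using that by (intro member_le_sum_list) auto
  then have "r (1, 0, 0) = 0" if "r \<in> set rs" for r
    using polynomial_below_schur3_at_axis[of r k] that assms by auto
  then have "(\<Sum>r\<leftarrow>rs. (r (1, 0, 0))\<^sup>2) = (\<Sum>r\<leftarrow>rs. 0)"
    by (intro arg_cong[of _ _ sum_list] map_cong) auto
  then have "schur3 k 1 0 0 = 0" by (simp add: eq[symmetric])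
  moreover have "schur3 k 1 0 0 = 1" using \<open>odd k\<close> by (cases k) (auto simp: schur3_def)
  ultimately show False by simp
qed

text \<open>One coordinate is split off at a time. After cancelling x, the quotient is known to
  vanish on yz = 0 only where x is nonzero; continuity supplies the rest before the next
  division.\<close>

lemma divide_by_coordinates:
  assumes q: "real_polynomial_function q" and z: "\<And>x y z. x * y * z = 0 \<Longrightarrow> q (x, y, z) = 0"
  obtains r where "real_polynomial_function r" "\<And>x y z. q (x, y, z) = x * y * z * r (x, y, z :: real)"
proof -
  have ext: "f 0 = 0" if "isCont f 0" "\<And>t. t \<noteq> 0 \<Longrightarrow> f t = 0" for f :: "real \<Rightarrow> real"
    using isCont_le_extend[of 0 f "\<lambda>_. 0"] isCont_le_extend[of 0 "\<lambda>_. 0" f] that by force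
  have "\<exists>g. real_polynomial_function g \<and> (\<forall>p. q p = q (0, snd p) + fst p * g p)"
    by (rule real_polynomial_function_split[OF q, of _ "\<lambda>p. fst p" "(1, 0, 0)"])
       (auto intro!: bounded_linear_intros)
  then obtain r1 where r1: "real_polynomial_function r1" "\<And>p. q p = q (0, snd p) + fst p * r1 p"
    by blast
  have q1: "q (x, y, z) = x * r1 (x, y, z)" for x y z using r1(2)[of "(x, y, z)"] z[of 0 y z] by simp
  have r1z: "r1 (x, y, z) = 0" if "y * z = 0" for x y z
  proof (cases "x = 0")
    case True
    have "isCont (\<lambda>t. r1 (t, y, z)) 0"
      using isCont_real_polynomial_function[OF real_polynomial_function_affine3[OF r1(1), of 0 1 y 0 z 0]] by simp
    then have "r1 (0, y, z) = 0"
    proof (rule ext)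
      fix t :: real
      assume "t \<noteq> 0"
      then show "r1 (t, y, z) = 0" using q1[of t y z] z[of t y z] that by simp
    qed
    with True show ?thesis by simp
  qed (use q1[of x y z] z[of x y z] that in auto)
  have "\<exists>g. real_polynomial_function g \<and> (\<forall>p. r1 p = r1 (fst p, 0, snd (snd p)) + fst (snd p) * g p)"
    by (rule real_polynomial_function_split[OF r1(1), of _ "\<lambda>p. fst (snd p)" "(0, 1, 0)"])
       (auto intro!: bounded_linear_intros)
  then obtain r2 where r2: "real_polynomial_function r2" "\<And>p. r1 p = r1 (fst p, 0, snd (snd p)) + fst (snd p) * r2 p"
    by blast
  have q2: "r1 (x, y, z) = y * r2 (x, y, z)" for x y z using r2(2)[of "(x, y, z)"] r1z[of 0 z x] by simp
  have r2z: "r2 (x, y, 0) = 0" for x y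
  proof (cases "y = 0")
    case True
    have "isCont (\<lambda>t. r2 (x, t, 0)) 0"
      using isCont_real_polynomial_function[OF real_polynomial_function_affine3[OF r2(1), of x 0 0 1 0 0]] by simp
    then have "r2 (x, 0, 0) = 0"
    proof (rule ext)
      fix t :: real
      assume "t \<noteq> 0"
      then show "r2 (x, t, 0) = 0" using q2[of x t 0] r1z[of t 0 x] by simp
    qed
    with True show ?thesis by simp
  qed (use q2[of x y 0] r1z[of y 0 x] in auto)
  have "\<exists>g. real_polynomial_function g \<and> (\<forall>p. r2 p = r2 (fst p, fst (snd p), 0) + snd (snd p) * g p)"
    by (rule real_polynomial_function_split[OF r2(1), of _ "\<lambda>p. snd (snd p)" "(0, 0, 1)"])
       (auto intro!: bounded_linear_intros)
  then obtain r3 where r3: "real_polynomial_function r3" "\<And>p. r2 p = r2 (fst p, fst (snd p), 0) + snd (snd p) * r3 p"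
    by blast
  have "r2 (x, y, z) = z * r3 (x, y, z)" for x y z using r3(2)[of "(x, y, z)"] r2z by simp
  then have "q (x, y, z) = x * y * z * r3 (x, y, z)" for x y z
    by (simp only: q1 q2 mult.assoc)
  with r3(1) show ?thesis by (rule that)
qed

lemma sum_of_squares_not_product_schur3:
  assumes q: "\<And>r. r \<in> set qs \<Longrightarrow> real_polynomial_function r" and "odd k"
    and eq: "\<And>x y z. (\<Sum>r\<leftarrow>qs. (r (x, y, z))\<^sup>2) = (x * y * z)\<^sup>2 * schur3 k x y z"
  shows False
proof -
  have "\<exists>r. real_polynomial_function r \<and> (\<forall>x y z. q (x, y, z) = x * y * z * r (x, y, z))"
    if "q \<in> set qs" for q
  proof -
    have "q (x, y, z) = 0" if "x * y * z = 0" for x y z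
    proof -
      have "(q (x, y, z))\<^sup>2 \<le> (\<Sum>r\<leftarrow>qs. (r (x, y, z))\<^sup>2)"
        using \<open>q \<in> set qs\<close> by (intro member_le_sum_list) auto
      then show ?thesis by (simp add: eq that)
    qed
    with divide_by_coordinates q[OF that] show ?thesis by metis
  qed
  then obtain R where R: "\<And>q. q \<in> set qs \<Longrightarrow> real_polynomial_function (R q)"
    "\<And>q x y z. q \<in> set qs \<Longrightarrow> q (x, y, z) = x * y * z * R q (x, y, z)" by metis
  define rs where "rs = map R qs"
  have rs: "real_polynomial_function r" if "r \<in> set rs" for r using that R by (auto simp: rs_def)
  have gen: "(\<Sum>r\<leftarrow>rs. (r (x, y, z))\<^sup>2) = schur3 k x y z" if "x * y * z \<noteq> 0" for x y z
  proof -
    have "(q (x, y, z))\<^sup>2 = (x * y * z)\<^sup>2 * (R q (x, y, z))\<^sup>2" if "q \<in> set qs" for q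
      by (simp add: R(2)[OF that, of x y z] power_mult_distrib)
    then have "(\<Sum>r\<leftarrow>qs. (r (x, y, z))\<^sup>2) = (\<Sum>q\<leftarrow>qs. (x * y * z)\<^sup>2 * (R q (x, y, z))\<^sup>2)"
      by (intro arg_cong[of _ _ sum_list] map_cong) simp_all
    also have "\<dots> = (x * y * z)\<^sup>2 * (\<Sum>r\<leftarrow>rs. (r (x, y, z))\<^sup>2)"
      by (simp add: rs_def sum_list_const_mult o_def)
    finally show ?thesis using eq[of x y z] that by simp
  qed
  have "(\<Sum>r\<leftarrow>rs. (r (x, y, z))\<^sup>2) = schur3 k x y z" for x y z
  proof -
    \<comment> \<open>The identity was divided by (xyz)^2, so it is so far known only off the
      coordinate planes. Moving along (1, 1, 1) meets them at the finitely many parameters in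
      \<open>N\<close>, and letting t tend to 0 gives the identity everywhere.\<close>
    define N where "N = {t. t = - x \<or> t = - y \<or> t = - z}"
    have "(\<Sum>r\<leftarrow>rs. (r (x + t, y + t, z + t))\<^sup>2) = schur3 k (x + t) (y + t) (z + t)" if "t \<notin> N" for t
      using that by (intro gen) (auto simp: N_def add_eq_0_iff2)
    moreover have "\<forall>\<^sub>F t in at 0. t \<notin> N"
    proof -
      have "finite N" by (simp add: N_def)
      then have "\<not> 0 islimpt N" by (rule islimpt_finite)
      then show ?thesis by (simp add: islimpt_iff_eventually)
    qed
    ultimately have ev: "\<forall>\<^sub>F t in at 0. (\<Sum>r\<leftarrow>rs. (r (x + t, y + t, z + t))\<^sup>2) = schur3 k (x + t) (y + t) (z + t)"
      by (auto elim: eventually_mono)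
    have c1: "isCont (\<lambda>t. \<Sum>r\<leftarrow>rs'. (r (x + t, y + t, z + t))\<^sup>2) 0" if "set rs' \<subseteq> set rs" for rs'
      using that
    proof (induction rs')
      case (Cons r rs')
      have "isCont (\<lambda>t. r (x + t, y + t, z + t)) 0"
        using isCont_real_polynomial_function[OF real_polynomial_function_affine3[OF rs, of r x 1 y 1 z 1]] Cons by simp
      with Cons show ?case by (auto intro!: continuous_intros)
    qed simp
    have c2: "isCont (\<lambda>t. schur3 k (x + t) (y + t) (z + t)) 0"
      unfolding schur3_def by (intro continuous_intros)
    have L1: "((\<lambda>t. \<Sum>r\<leftarrow>rs. (r (x + t, y + t, z + t))\<^sup>2) \<longlongrightarrow> schur3 k x y z) (at 0)"
      using c2 ev unfolding isCont_def by (simp add: tendsto_cong)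
    have L2: "((\<lambda>t. \<Sum>r\<leftarrow>rs. (r (x + t, y + t, z + t))\<^sup>2) \<longlongrightarrow> (\<Sum>r\<leftarrow>rs. (r (x, y, z))\<^sup>2)) (at 0)"
      using c1[of rs] unfolding isCont_def by simp
    show ?thesis by (rule tendsto_unique[OF at_neq_bot L2 L1])
  qed
  with rs \<open>odd k\<close> show False by (rule sum_of_squares_not_schur3)
qed

section \<open>The reflection group\<close>

lemma reflection_minus_nth:
  "i \<noteq> j \<Longrightarrow> reflection (axis i 1 - axis j 1) (x :: real ^ 'n) $ l = x $ Transposition.transpose i j (l :: 'n::finite)"
proof -
  assume "i \<noteq> j"
  then have "(axis i 1 - axis j 1 :: real ^ 'n) \<bullet> (axis i 1 - axis j 1) = 2"
    by (simp add: inner_diff_left inner_diff_right inner_axis_axis)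
  moreover have "x \<bullet> (axis i 1 - axis j 1) = x $ i - x $ j"
    by (simp add: inner_diff_right inner_axis)
  ultimately show ?thesis
    using \<open>i \<noteq> j\<close> by (auto simp: reflection_def Transposition.transpose_def axis_def field_simps)
qed

lemma reflection_plus_nth:
  "i \<noteq> j \<Longrightarrow> reflection (axis i 1 + axis j 1) (x :: real ^ 'n) $ l =
     (if l = i \<or> l = j then - 1 else 1) * x $ Transposition.transpose i j (l :: 'n::finite)"
proof -
  assume "i \<noteq> j"
  then have "(axis i 1 + axis j 1 :: real ^ 'n) \<bullet> (axis i 1 + axis j 1) = 2"
    by (simp add: inner_add_left inner_add_right inner_axis_axis)
  moreover have "x \<bullet> (axis i 1 + axis j 1) = x $ i + x $ j"
    by (simp add: inner_add_right inner_axis)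
  ultimately show ?thesis
    using \<open>i \<noteq> j\<close> by (auto simp: reflection_def Transposition.transpose_def axis_def field_simps)
qed

lemma reflection_reflection: "reflection v (reflection v x) = x"
proof (cases "v = 0")
  case False
  then show ?thesis
    by (simp add: reflection_def inner_diff_left algebra_simps flip: scaleR_add_left)
qed (simp add: reflection_def)

lemma bij_reflection: "bij (reflection v)"
  by (rule o_bij[of "reflection v"]) (auto simp: reflection_reflection)

text \<open>Invariance passes to products and inverses. The induction carries membership in
  \<open>Bij UNIV\<close> along, since only there do the operations of \<open>BijGroup\<close>
  reduce to composition and inversion of functions.\<close>

lemma D_invariant_iff:
  "D_invariant p \<longleftrightarrow> (\<forall>g\<in>D_reflections. \<forall>x. mpoly_eval p (g x) = mpoly_eval p x)" (is "?L \<longleftrightarrow> ?R")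
proof
  assume ?L
  then show ?R unfolding D_invariant_def D_group_def by (blast intro: generate.incl)
next
  assume R: ?R
  have refl: "g \<in> Bij UNIV" if "g \<in> D_reflections" for g :: "real ^ 'a \<Rightarrow> real ^ 'a"
    using that bij_reflection by (auto simp: D_reflections_def Bij_def)
  have "g \<in> Bij UNIV \<and> (\<forall>x. mpoly_eval p (g x) = mpoly_eval p x)"
    if "g \<in> generate (BijGroup UNIV) D_reflections" for g
    using that
  proof (induction rule: generate.induct)
    case one
    then show ?case by (simp add: BijGroup_def Bij_def bij_id[unfolded id_def])
  next
    case (incl h)
    then show ?case using R refl by blast
  next
    case (inv h)
    have b: "bij h" using refl[OF inv] by (simp add: Bij_def)
    have "inv\<^bsub>BijGroup UNIV\<^esub> h = inv_into UNIV h"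
      using refl[OF inv] by (simp add: inv_BijGroup restrict_def)
    moreover have "mpoly_eval p (inv_into UNIV h x) = mpoly_eval p x" for x
      using R inv b by (metis bij_inv_eq_iff)
    ultimately show ?case using b bij_imp_bij_inv[OF b] by (auto simp: Bij_def)
  next
    case (eng h1 h2)
    then have b: "bij h1" "bij h2" by (simp_all add: Bij_def)
    with eng have "h1 \<otimes>\<^bsub>BijGroup UNIV\<^esub> h2 = h1 \<circ> h2"
      by (simp add: BijGroup_def compose_def restrict_def o_def)
    moreover have "bij (h1 \<circ> h2)" using b by (rule bij_comp[rotated])
    ultimately show ?case using eng by (simp add: Bij_def o_def)
  qed
  then show ?L unfolding D_invariant_def D_group_def by blast
qed

section \<open>Power sums and Schur's forms\<close>

text \<open>All counterexamples are written in power sums of the squares, which makes their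
  invariance and their degree immediate.\<close>

definition psum :: "nat \<Rightarrow> real ^ 'n::finite \<Rightarrow> real" where
  "psum k x = (\<Sum>i\<in>UNIV. (x $ i) ^ (2 * k))"

definition psum_poly :: "nat \<Rightarrow> 'n::finite real_mpoly" where
  "psum_poly k = (\<Sum>i\<in>UNIV. Poly_Mapping.single (Poly_Mapping.single i (2 * k)) 1)"

lemma mpoly_eval_psum_poly [simp]: "mpoly_eval (psum_poly k) x = psum k x"
  by (simp add: psum_poly_def psum_def)

lemma sum_lookup_single: "(\<Sum>j\<in>UNIV. Poly_Mapping.lookup (Poly_Mapping.single (i::'n::finite) k) j) = k"
  by (simp add: lookup_single when_def)

lemma is_form_psum_poly: "is_form (2 * k) (psum_poly k)"
  unfolding psum_poly_def by (intro is_form_sum is_form_single sum_lookup_single)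

lemma psum_reflection:
  assumes "g \<in> D_reflections"
  shows "psum k (g x) = psum k x"
proof -
  from assms obtain i j where ij: "i \<noteq> j"
    "g = reflection (axis i 1 - axis j 1) \<or> g = reflection (axis i 1 + axis j 1)"
    unfolding D_reflections_def by blast
  then have "psum k (g x) = (\<Sum>l\<in>UNIV. (x $ Transposition.transpose i j l) ^ (2 * k))"
    unfolding psum_def
    by (intro sum.cong) (auto simp: reflection_minus_nth reflection_plus_nth)
  also have "\<dots> = psum k x"
    unfolding psum_def by (rule sum.reindex_bij_betw) simp
  finally show ?thesis .
qed

text \<open>
  With \<open>a\<^sub>i = x\<^sub>i\<^sup>2\<close> this is \<open>\<Sum>\<^sub>i a\<^sub>i ^ k * w\<^sub>i\<close> where \<open>w\<^sub>i\<close> is the analogue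
  \<open>a\<^sub>i\<^sup>2 - a\<^sub>i e\<^sub>1(a\<^sub>j : j \<noteq> i) + e\<^sub>2(a\<^sub>j : j \<noteq> i) = 3 a\<^sub>i\<^sup>2 - 2 p\<^sub>1 a\<^sub>i + (p\<^sub>1\<^sup>2 - p\<^sub>2) / 2\<close> of Schur's
  weight \<open>(a - b) (a - c)\<close>.
\<close>

definition schur_poly :: "nat \<Rightarrow> 'n::finite real_mpoly" where
  "schur_poly k = Poly_Mapping.single 0 3 * psum_poly (k + 2)
     + Poly_Mapping.single 0 (- 2) * (psum_poly 1 * psum_poly (k + 1))
     + Poly_Mapping.single 0 (1 / 2) *
         ((psum_poly 1 * psum_poly 1 + Poly_Mapping.single 0 (- 1) * psum_poly 2) * psum_poly k)"

text \<open>Newton's identity 6 e_3 = p_1^3 - 3 p_1 p_2 + 2 p_3, applied to the squares of the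
  variables.\<close>

definition esym3_poly :: "'n::finite real_mpoly" where
  "esym3_poly = Poly_Mapping.single 0 (1 / 6) * (psum_poly 1 * (psum_poly 1 * psum_poly 1)
     + Poly_Mapping.single 0 (- 3) * (psum_poly 1 * psum_poly 2) + Poly_Mapping.single 0 2 * psum_poly 3)"

lemma mpoly_eval_numeral [simp]: "mpoly_eval (numeral w) x = numeral w"
  by (simp flip: single_numeral)

lemma mpoly_eval_schur_poly:
  "mpoly_eval (schur_poly k) x = 3 * psum (k + 2) x - 2 * psum 1 x * psum (k + 1) x
     + ((psum 1 x)\<^sup>2 - psum 2 x) / 2 * psum k x"
  by (simp add: schur_poly_def power2_eq_square field_simps)

lemma mpoly_eval_esym3_poly:
  "mpoly_eval esym3_poly x = (psum 1 x ^ 3 - 3 * psum 1 x * psum 2 x + 2 * psum 3 x) / 6"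
  by (simp add: esym3_poly_def power3_eq_cube algebra_simps)

lemma is_form_schur_poly: "is_form (2 * k + 4) (schur_poly k)"
proof -
  have "is_form (2 * k + 4) (psum_poly (k + 2))" 
  proof -
    have "2 * (k + 2) = 2 * k + 4" by simp
    then show ?thesis using is_form_psum_poly[of "k + 2"] by metis
  qed
  moreover have "is_form (2 * k + 4) (psum_poly 1 * psum_poly (k + 1))"
  proof -
    have "2 * 1 + 2 * (k + 1) = 2 * k + 4" by simp
    then show ?thesis using is_form_mult[OF is_form_psum_poly[of 1] is_form_psum_poly[of "k + 1"]] by metis
  qed
  moreover have "is_form 4 (psum_poly 1 * psum_poly 1 + Poly_Mapping.single 0 (- 1) * psum_poly 2)"
    using is_form_mult[OF is_form_psum_poly[of 1] is_form_psum_poly[of 1]] is_form_psum_poly[of 2]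
    by (intro is_form_add is_form_const_mult) simp_all
  then have "is_form (2 * k + 4) ((psum_poly 1 * psum_poly 1 + Poly_Mapping.single 0 (- 1) * psum_poly 2) * psum_poly k)"
    using is_form_mult[OF _ is_form_psum_poly[of k]] by (fastforce simp: add.commute)
  ultimately show ?thesis
    unfolding schur_poly_def by (intro is_form_add is_form_const_mult)
qed

lemma is_form_esym3_poly: "is_form 6 esym3_poly"
proof -
  have "is_form 6 (psum_poly 1 * (psum_poly 1 * psum_poly 1))"
    using is_form_mult[OF is_form_psum_poly[of 1] is_form_mult[OF is_form_psum_poly[of 1] is_form_psum_poly[of 1]]]
    by simp
  moreover have "is_form 6 (psum_poly 1 * psum_poly 2)"
    using is_form_mult[OF is_form_psum_poly[of 1] is_form_psum_poly[of 2]] by simp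
  moreover have "is_form 6 (psum_poly 3)"
    using is_form_psum_poly[of 3] by simp
  ultimately show ?thesis
    unfolding esym3_poly_def by (intro is_form_add is_form_const_mult)
qed

section \<open>Non-negativity of Schur's forms in n variables and of e_3\<close>

lemma sum_power2_le_power2_sum:
  fixes a :: "'a \<Rightarrow> real"
  assumes "finite T" "\<And>i. i \<in> T \<Longrightarrow> 0 \<le> a i"
  shows "(\<Sum>i\<in>T. (a i)\<^sup>2) \<le> (\<Sum>i\<in>T. a i)\<^sup>2"
proof -
  have "(\<Sum>i\<in>T. (a i)\<^sup>2) \<le> (\<Sum>i\<in>T. a i * (\<Sum>i\<in>T. a i))"
    using assms by (intro sum_mono) (auto simp: power2_eq_square intro!: mult_left_mono member_le_sum)
  then show ?thesis by (simp add: sum_distrib_right power2_eq_square)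
qed

text \<open>
  The two largest entries \<open>A \<ge> B\<close> carry the only weights of unknown sign; with \<open>D = A - B\<close> and
  \<open>t = r - B\<close> their contribution is at least \<open>A ^ k * (D\<^sup>2 - t * D + t\<^sup>2 / 2)\<close> when \<open>t \<ge> 0\<close>.
\<close>

lemma schur_two_largest:
  fixes A B r E :: real
  assumes "0 \<le> B" "B \<le> A" "0 \<le> r" "0 \<le> E" "r * (r - B) \<le> 2 * E"
  shows "0 \<le> A ^ k * ((A - B) * (A - r) + E) + B ^ k * ((B - A) * (B - r) + E)"
proof -
  have pw: "0 \<le> B ^ k" "B ^ k \<le> A ^ k" using assms by (auto intro: power_mono)
  have eq: "A ^ k * ((A - B) * (A - r) + E) + B ^ k * ((B - A) * (B - r) + E) =
      (A - B) * (A ^ k * (A - r) - B ^ k * (B - r)) + E * (A ^ k + B ^ k)"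
    by (simp add: algebra_simps)
  show ?thesis
  proof (cases "r \<le> B")
    case True
    have "B ^ k * (B - r) \<le> A ^ k * (A - r)"
      using pw True assms by (intro mult_mono) auto
    then show ?thesis unfolding eq using assms pw by (intro add_nonneg_nonneg mult_nonneg_nonneg) auto
  next
    case False
    define t where "t = r - B"
    have t: "0 \<le> t" "t\<^sup>2 / 2 \<le> E"
    proof -
      have "t * t \<le> r * t" using False assms by (intro mult_right_mono) (auto simp: t_def)
      then show "t\<^sup>2 / 2 \<le> E" using assms(5) by (simp add: t_def power2_eq_square)
    qed (use False in \<open>simp add: t_def\<close>)
    \<comment> \<open>With D = A - B, half of this sum is D^2 - t D + t^2 / 2.\<close>
    have "0 \<le> (t - (A - B))\<^sup>2 + (A - B)\<^sup>2" by simp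
    then have "0 \<le> A ^ k * ((A - B)\<^sup>2 - t * (A - B) + t\<^sup>2 / 2)"
      using pw by (intro mult_nonneg_nonneg) (auto simp: power2_eq_square algebra_simps)
    also have "\<dots> = (A - B) * (A ^ k * (A - r) - B ^ k * (B - r)) - (A - B) * t * B ^ k + t\<^sup>2 / 2 * A ^ k"
      by (simp add: t_def power2_eq_square algebra_simps)
    also have "\<dots> \<le> (A - B) * (A ^ k * (A - r) - B ^ k * (B - r)) + E * (A ^ k + B ^ k)"
    proof -
      have "0 \<le> (A - B) * t * B ^ k" using assms t pw by simp
      moreover have "t\<^sup>2 / 2 * A ^ k \<le> E * (A ^ k + B ^ k)"
        using t pw assms by (intro mult_mono) auto
      ultimately show ?thesis by simp
    qed
    finally show ?thesis unfolding eq .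
  qed
qed

text \<open>Every weight outside the two largest entries \<open>a u\<close> and \<open>a v\<close>
  is non-negative on its own. Those two are treated together by \<open>schur_two_largest\<close>,
  with r the sum and E = (r^2 - q) / 2 the second elementary symmetric polynomial of the remaining
  entries; its last hypothesis says q <= a_v r, true because no remaining entry exceeds
  \<open>a v\<close>.\<close>

lemma schur_nonneg:
  fixes a :: "'n::finite \<Rightarrow> real"
  assumes "\<And>i. 0 \<le> a i" "2 \<le> CARD('n)"
  defines "p \<equiv> \<lambda>k. \<Sum>i\<in>UNIV. a i ^ k"
  shows "0 \<le> 3 * p (k + 2) - 2 * p 1 * p (k + 1) + ((p 1)\<^sup>2 - p 2) / 2 * p k"
proof -
  define w where "w i = 3 * (a i)\<^sup>2 - 2 * p 1 * a i + ((p 1)\<^sup>2 - p 2) / 2" for i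
  have argmax: "\<exists>i\<in>S. \<forall>j\<in>S. a j \<le> a i" if "S \<noteq> {}" for S :: "'n set"
  proof -
    have "Max (a ` S) \<in> a ` S" using that by (intro Max_in) auto
    then show ?thesis using Max_ge[of "a ` S"] by force
  qed
  obtain u where u: "\<And>j. a j \<le> a u" using argmax[of UNIV] by auto
  have "UNIV - {u} \<noteq> {}"
  proof
    assume "UNIV - {u} = {}"
    then have "(UNIV :: 'n set) = {u}" by auto
    then have "CARD('n) = 1" by (metis card_1_singleton_iff One_nat_def)
    with assms(2) show False by simp
  qed
  then obtain v where v: "v \<noteq> u" "\<And>j. j \<noteq> u \<Longrightarrow> a j \<le> a v" using argmax[of "UNIV - {u}"] by auto
  define T where "T = UNIV - {u, v}"
  have split: "(\<Sum>i\<in>UNIV. f i) = f u + f v + (\<Sum>i\<in>T. f i)" for f :: "'n \<Rightarrow> real"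
  proof -
    have "UNIV = insert u (insert v T)" "u \<notin> insert v T" "v \<notin> T" "finite T"
      using v(1) by (auto simp: T_def)
    then show ?thesis by (metis (no_types, lifting) add.assoc finite_insert sum.insert)
  qed
  define r where "r = (\<Sum>i\<in>T. a i)"
  define q where "q = (\<Sum>i\<in>T. (a i)\<^sup>2)"
  have p1: "p 1 = a u + a v + r" and p2: "p 2 = (a u)\<^sup>2 + (a v)\<^sup>2 + q"
    by (simp_all add: p_def split r_def q_def)
  have r0: "0 \<le> r" unfolding r_def using assms(1) by (intro sum_nonneg)
  have qr: "q \<le> r\<^sup>2"
    unfolding q_def r_def using assms(1) by (intro sum_power2_le_power2_sum) auto
  have "q \<le> (\<Sum>i\<in>T. a v * a i)"
    unfolding q_def power2_eq_square using v(2) assms(1)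
    by (intro sum_mono mult_right_mono) (auto simp: T_def)
  then have qv: "q \<le> a v * r" by (simp add: r_def sum_distrib_left)
  have "w i \<ge> 0" if "i \<in> T" for i
  proof -
    define R where "R = p 1 - a u"
    have R: "R = a v + r" and ri: "a i \<le> r"
      using that assms(1) unfolding R_def p1 by (auto simp: r_def T_def intro!: member_le_sum)
    have iv: "a i \<le> a v" using that v(2) by (auto simp: T_def)
    have "(a i)\<^sup>2 + (\<Sum>j\<in>T - {i}. (a j)\<^sup>2) = q" "a i + (\<Sum>j\<in>T - {i}. a j) = r"
      using that by (auto simp: q_def r_def T_def intro!: sum.remove[symmetric])
    moreover have "(\<Sum>j\<in>insert v (T - {i}). (a j)\<^sup>2) \<le> (\<Sum>j\<in>insert v (T - {i}). a j)\<^sup>2"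
      using assms(1) by (intro sum_power2_le_power2_sum) auto
    moreover have "v \<notin> T - {i}" by (simp add: T_def)
    ultimately have e: "(a v)\<^sup>2 + (q - (a i)\<^sup>2) \<le> (a v + (r - a i))\<^sup>2" by auto
    \<comment> \<open>Both a_v and r are at least a_i, so R = a_v + r >= 2 a_i. The rest of the
      weight is e_2 of the entries other than u and i, non-negative by the bound
      \<open>e\<close>.\<close>
    have "0 \<le> (a u - a i) * (R - 2 * a i)"
      using u iv ri R by (intro mult_nonneg_nonneg) auto
    moreover have "w i = (a u - a i) * (R - 2 * a i) + ((R - a i)\<^sup>2 - ((a v)\<^sup>2 + (q - (a i)\<^sup>2))) / 2"
      unfolding w_def R p1 p2 by (simp add: power2_eq_square field_simps)
    moreover have "R - a i = a v + (r - a i)" by (simp add: R)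
    ultimately show ?thesis using e by simp
  qed
  then have "0 \<le> (\<Sum>i\<in>T. a i ^ k * w i)" using assms(1) by (intro sum_nonneg) auto
  moreover have "0 \<le> a u ^ k * ((a u - a v) * (a u - r) + (r\<^sup>2 - q) / 2)
      + a v ^ k * ((a v - a u) * (a v - r) + (r\<^sup>2 - q) / 2)"
    using assms(1) u r0 qr qv
    by (intro schur_two_largest) (auto simp: power2_eq_square algebra_simps)
  moreover have "w u = (a u - a v) * (a u - r) + (r\<^sup>2 - q) / 2"
    "w v = (a v - a u) * (a v - r) + (r\<^sup>2 - q) / 2"
    unfolding w_def p1 p2 by (simp_all add: power2_eq_square field_simps)
  ultimately have "0 \<le> (\<Sum>i\<in>UNIV. a i ^ k * w i)"
    by (simp add: split)
  also have "\<dots> = (\<Sum>i\<in>UNIV. 3 * a i ^ (k + 2) - 2 * p 1 * a i ^ (k + 1) + ((p 1)\<^sup>2 - p 2) / 2 * a i ^ k)"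
    by (rule sum.cong) (auto simp: w_def power2_eq_square algebra_simps)
  also have "\<dots> = 3 * p (k + 2) - 2 * p 1 * p (k + 1) + ((p 1)\<^sup>2 - p 2) / 2 * p k"
    by (simp add: p_def sum.distrib sum_subtractf sum_distrib_left)
  finally show ?thesis .
qed

lemma psum_alt: "psum k x = (\<Sum>i\<in>UNIV. ((x $ i)\<^sup>2) ^ k)"
  by (simp add: psum_def power_mult)

lemma schur_poly_nonneg:
  "2 \<le> CARD('n::finite) \<Longrightarrow> 0 \<le> mpoly_eval (schur_poly k) (x :: real ^ 'n)"
  using schur_nonneg[of "\<lambda>i. (x $ i)\<^sup>2" k] by (simp add: mpoly_eval_schur_poly psum_alt)

lemma esym3_poly_nonneg: "0 \<le> mpoly_eval esym3_poly x"
proof -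
  define a where "a i = (x $ i)\<^sup>2" for i
  define p where "p k = (\<Sum>i\<in>UNIV. a i ^ k)" for k
  \<comment> \<open>This is twice e_2 of the squares other than a_i; multiplying by a_i and summing
    counts each triple product six times.\<close>
  have "0 \<le> (p 1 - a i)\<^sup>2 - (p 2 - (a i)\<^sup>2)" for i
  proof -
    have "(\<Sum>j\<in>UNIV - {i}. (a j)\<^sup>2) \<le> (\<Sum>j\<in>UNIV - {i}. a j)\<^sup>2"
      by (intro sum_power2_le_power2_sum) (auto simp: a_def)
    then show ?thesis by (simp add: p_def sum_diff1)
  qed
  then have "0 \<le> (\<Sum>i\<in>UNIV. a i * ((p 1 - a i)\<^sup>2 - (p 2 - (a i)\<^sup>2)))"
    by (intro sum_nonneg mult_nonneg_nonneg) (auto simp: a_def)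
  also have "\<dots> = (\<Sum>i\<in>UNIV. ((p 1)\<^sup>2 - p 2) * a i - 2 * p 1 * a i ^ 2 + 2 * a i ^ 3)"
    by (rule sum.cong) (auto simp: power2_eq_square power3_eq_cube algebra_simps)
  also have "\<dots> = ((p 1)\<^sup>2 - p 2) * p 1 - 2 * p 1 * p 2 + 2 * p 3"
    by (simp add: p_def sum.distrib sum_subtractf sum_distrib_left)
  also have "\<dots> = p 1 ^ 3 - 3 * p 1 * p 2 + 2 * p 3"
    by (simp add: power2_eq_square power3_eq_cube algebra_simps)
  finally have "0 \<le> p 1 ^ 3 - 3 * p 1 * p 2 + 2 * p 3" .
  moreover have "psum k x = p k" for k by (simp only: psum_alt p_def a_def)
  ultimately show ?thesis by (simp add: mpoly_eval_esym3_poly)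
qed

lemma D_invariant_schur_poly: "D_invariant (schur_poly k)"
  by (simp add: D_invariant_iff mpoly_eval_schur_poly psum_reflection)

lemma D_invariant_esym3_poly: "D_invariant esym3_poly"
  by (simp add: D_invariant_iff mpoly_eval_esym3_poly psum_reflection)

lemma D_invariant_psum_poly: "D_invariant (psum_poly k)"
  by (simp add: D_invariant_iff psum_reflection)

lemma psd_D_forms_mult:
  "p \<in> psd_D_forms k \<Longrightarrow> q \<in> psd_D_forms l \<Longrightarrow> p * q \<in> psd_D_forms (k + l)"
  by (auto simp: psd_D_forms_def D_invariant_def is_form_mult)

lemma schur_poly_psd: "2 \<le> CARD('n::finite) \<Longrightarrow> (schur_poly k :: 'n real_mpoly) \<in> psd_D_forms (2 * k + 4)"
  by (simp add: psd_D_forms_def is_form_schur_poly D_invariant_schur_poly schur_poly_nonneg)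

lemma esym3_poly_psd: "esym3_poly \<in> psd_D_forms 6"
  by (simp add: psd_D_forms_def is_form_esym3_poly D_invariant_esym3_poly esym3_poly_nonneg)

lemma psum_poly_psd: "psum_poly k \<in> psd_D_forms (2 * k)"
  by (simp add: psd_D_forms_def is_form_psum_poly D_invariant_psum_poly psum_alt sum_nonneg)

section \<open>Non-negative forms that are not sums of squares\<close>

text \<open>Restriction to a coordinate 3-space preserves sums of squares and turns S_k into
  \<open>schur3 k\<close> and e_3 into (xyz)^2.\<close>

definition emb3 :: "'n \<Rightarrow> 'n \<Rightarrow> 'n \<Rightarrow> real \<times> real \<times> real \<Rightarrow> real ^ 'n::finite" where
  "emb3 u v w p = fst p *\<^sub>R axis u 1 + fst (snd p) *\<^sub>R axis v 1 + snd (snd p) *\<^sub>R axis w 1"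

lemma polynomial_mpoly_eval: "real_polynomial_function (mpoly_eval q)"
  unfolding mpoly_eval_def[abs_def]
  by (intro real_polynomial_function_sum real_polynomial_function_prod real_polynomial_function_power
      real_polynomial_function.intros(4,2) real_polynomial_function.intros(1) bounded_linear_vec_nth) auto

lemma polynomial_mpoly_eval_emb3: "real_polynomial_function (\<lambda>p. mpoly_eval q (emb3 u v w p))"
proof -
  have "bounded_linear (emb3 u v w)" unfolding emb3_def[abs_def] by (intro bounded_linear_intros)
  then show ?thesis
    using real_polynomial_function_compose[OF polynomial_function_bounded_linear polynomial_mpoly_eval]
    by (fastforce simp: o_def)
qed

text \<open>For k = 0 every coordinate outside u, v, w would contribute 0^0 = 1, hence the
  restriction to positive k.\<close>

lemma psum_emb3:
  assumes "u \<noteq> v" "u \<noteq> w" "v \<noteq> w" "0 < k"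
  shows "psum k (emb3 u v w (x, y, z)) = x ^ (2 * k) + y ^ (2 * k) + z ^ (2 * k)"
proof -
  have "psum k (emb3 u v w (x, y, z)) = (\<Sum>i\<in>{u, v, w}. (emb3 u v w (x, y, z) $ i) ^ (2 * k))"
    unfolding psum_def using assms by (intro sum.mono_neutral_right) (auto simp: emb3_def axis_def)
  also have "\<dots> = x ^ (2 * k) + y ^ (2 * k) + z ^ (2 * k)"
    using assms by (simp add: emb3_def axis_def)
  finally show ?thesis .
qed

lemma schur_poly_emb3:
  assumes "u \<noteq> v" "u \<noteq> w" "v \<noteq> w" "0 < k"
  shows "mpoly_eval (schur_poly k) (emb3 u v w (x, y, z)) = schur3 k x y z"
proof -
  have p: "t ^ (2 * (k + 2)) = t ^ (2 * k) * t ^ 4" "t ^ (2 * (k + 1)) = t ^ (2 * k) * t\<^sup>2" for t :: real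
  proof -
    have "2 * (k + 2) = 2 * k + 4" "2 * (k + 1) = 2 * k + 2" by simp_all
    then show "t ^ (2 * (k + 2)) = t ^ (2 * k) * t ^ 4" "t ^ (2 * (k + 1)) = t ^ (2 * k) * t\<^sup>2"
      by (simp_all only: power_add)
  qed
  note e = psum_emb3[OF assms(1-3)]
  show ?thesis
    unfolding mpoly_eval_schur_poly schur3_def e[OF assms(4)] e[of 1, OF zero_less_one] e[of 2, OF pos2]
      e[of "k + 1", OF add_pos_pos[OF assms(4) zero_less_one]] e[of "k + 2", OF add_pos_pos[OF assms(4) pos2]] p
    by (simp add: power2_eq_square power4_eq_xxxx field_simps)
qed

lemma esym3_poly_emb3:
  assumes "u \<noteq> v" "u \<noteq> w" "v \<noteq> w"
  shows "mpoly_eval esym3_poly (emb3 u v w (x, y, z)) = (x * y * z)\<^sup>2"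
  unfolding mpoly_eval_esym3_poly using assms
  by (simp add: psum_emb3) (simp add: power_def field_simps numeral_eq_Suc)

lemma obtain_three:
  assumes "3 \<le> CARD('n::finite)"
  obtains u v w :: "'n::finite" where "u \<noteq> v" "u \<noteq> w" "v \<noteq> w"
proof -
  obtain T :: "'n set" where "card T = 3"
    using assms obtain_subset_with_card_n by metis
  then show ?thesis using that by (auto simp: card_3_iff)
qed

lemma schur_poly_not_sos:
  assumes "3 \<le> CARD('n::finite)" "odd k"
  shows "(schur_poly k :: 'n real_mpoly) \<notin> sos_D_forms m"
proof
  assume "(schur_poly k :: 'n real_mpoly) \<in> sos_D_forms m"
  then obtain qs where qs: "(schur_poly k :: 'n real_mpoly) = (\<Sum>q\<leftarrow>qs. q ^ 2)"
    unfolding sos_D_forms_def by blast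
  obtain u v w :: 'n where n: "u \<noteq> v" "u \<noteq> w" "v \<noteq> w" using obtain_three assms(1) by metis
  have "0 < k" using assms(2) by (cases k) auto
  let ?rs = "map (\<lambda>q p. mpoly_eval q (emb3 u v w p)) qs"
  have "(\<Sum>r\<leftarrow>?rs. (r (x, y, z))\<^sup>2) = schur3 k x y z" for x y z
    using schur_poly_emb3[OF n \<open>0 < k\<close>, of x y z] unfolding qs by (simp add: o_def)
  then show False
    by (rule sum_of_squares_not_schur3[rotated 2]) (use assms polynomial_mpoly_eval_emb3 in auto)
qed

lemma esym3_poly_mult_schur_poly_not_sos:
  assumes "3 \<le> CARD('n::finite)" "odd k"
  shows "(esym3_poly * schur_poly k :: 'n real_mpoly) \<notin> sos_D_forms m"
proof
  assume "(esym3_poly * schur_poly k :: 'n real_mpoly) \<in> sos_D_forms m"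
  then obtain qs where qs: "(esym3_poly * schur_poly k :: 'n real_mpoly) = (\<Sum>q\<leftarrow>qs. q ^ 2)"
    unfolding sos_D_forms_def by blast
  obtain u v w :: 'n where n: "u \<noteq> v" "u \<noteq> w" "v \<noteq> w" using obtain_three assms(1) by metis
  have "0 < k" using assms(2) by (cases k) auto
  let ?rs = "map (\<lambda>q p. mpoly_eval q (emb3 u v w p)) qs"
  have "(\<Sum>r\<leftarrow>?rs. (r (x, y, z))\<^sup>2) = (x * y * z)\<^sup>2 * schur3 k x y z" for x y z
  proof -
    have "mpoly_eval (esym3_poly * schur_poly k) (emb3 u v w (x, y, z)) = (x * y * z)\<^sup>2 * schur3 k x y z"
      by (simp add: schur_poly_emb3[OF n \<open>0 < k\<close>] esym3_poly_emb3[OF n])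
    then show ?thesis unfolding qs by (simp add: o_def)
  qed
  then show False
    by (rule sum_of_squares_not_product_schur3[rotated 2]) (use assms polynomial_mpoly_eval_emb3 in auto)
qed

section \<open>Degree eight in at least four variables\<close>

text \<open>Averaging over all sign changes keeps exactly the monomials that are even in every variable.\<close>

definition sign_vectors :: "('n \<Rightarrow> real) set" where
  "sign_vectors = (\<Pi>\<^sub>E i\<in>UNIV. {1, - 1})"

text \<open>Signs outside \<open>S\<close> are discarded, so each vector with entries +-1 on
  \<open>S\<close> and 0 elsewhere is counted 2^(n - |S|) times. The total weight is then 2^n for
  every \<open>S\<close>, which makes different supports comparable.\<close>

definition sign_sum :: "'n::finite set \<Rightarrow> 'n real_mpoly \<Rightarrow> real" where
  "sign_sum S q = (\<Sum>s\<in>sign_vectors. mpoly_eval q (\<chi> i. if i \<in> S then s i else 0))"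

definition even_supported :: "'n set \<Rightarrow> ('n \<Rightarrow>\<^sub>0 nat) \<Rightarrow> bool" where
  "even_supported S m \<longleftrightarrow> (\<forall>i. even (Poly_Mapping.lookup m i)) \<and> Poly_Mapping.keys m \<subseteq> S"

text \<open>The sum over signs factors over the coordinates. Coordinate i contributes 2 if its
  exponent is even and, for i outside \<open>S\<close>, zero; otherwise it contributes 0. Absent
  variables rely on 0^0 = 1.\<close>

lemma sign_sum_eq:
  "sign_sum S (q :: 'n::finite real_mpoly) =
     (\<Sum>m\<in>Poly_Mapping.keys q. Poly_Mapping.lookup q m * (2 ^ CARD('n) * of_bool (even_supported S m)))"
proof -
  have "(\<Sum>s\<in>sign_vectors. mono_eval m (\<chi> i. if i \<in> S then s i else 0)) =
        2 ^ CARD('n) * of_bool (even_supported S m)" for m :: "'n \<Rightarrow>\<^sub>0 nat"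
  proof -
    let ?f = "\<lambda>i y. (if i \<in> S then y else 0) ^ Poly_Mapping.lookup m i :: real"
    have "(\<Sum>s\<in>sign_vectors. mono_eval m (\<chi> i. if i \<in> S then s i else 0)) = (\<Prod>i\<in>UNIV. \<Sum>y\<in>{1, - 1}. ?f i y)"
      unfolding sign_vectors_def mono_eval_def by (subst prod_sum_PiE) auto
    also have "\<dots> = (\<Prod>i\<in>UNIV. 2 * of_bool (even (Poly_Mapping.lookup m i) \<and> (i \<in> Poly_Mapping.keys m \<longrightarrow> i \<in> S)))"
      by (rule prod.cong) (auto simp: in_keys_iff odd_pos)
    also have "\<dots> = 2 ^ CARD('n) * of_bool (even_supported S m)"
    proof -
      have "(\<Prod>i\<in>UNIV. of_bool (P i)) = (of_bool (\<forall>i. P i) :: real)" for P :: "'n \<Rightarrow> bool"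
        by (cases "\<forall>i. P i") auto
      then show ?thesis by (auto simp: prod.distrib even_supported_def)
    qed
    finally show ?thesis .
  qed
  then show ?thesis
    unfolding sign_sum_def mpoly_eval_keys by (subst sum.swap) (simp flip: sum_distrib_left)
qed

lemma sum_lookup_keys:
  "(\<Sum>i\<in>UNIV. Poly_Mapping.lookup m i) = (\<Sum>i\<in>Poly_Mapping.keys m. Poly_Mapping.lookup m (i::'n::finite))"
  by (rule sum.mono_neutral_right) (auto simp: in_keys_iff)

text \<open>Inclusion-exclusion: an even quartic monomial involves only one or two variables. A
  mixed one inside {i, j, k} lies in exactly one pair, a pure fourth power in two pairs and one
  singleton.\<close>

lemma even_supported_quartic:
  fixes m :: "'n::finite \<Rightarrow>\<^sub>0 nat"
  assumes "(\<Sum>i\<in>UNIV. Poly_Mapping.lookup m i) = 4" and "i \<noteq> j" "i \<noteq> k" "j \<noteq> k"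
  shows "(of_bool (even_supported {i, j, k} m) :: real) =
    of_bool (even_supported {i, j} m) + of_bool (even_supported {i, k} m) + of_bool (even_supported {j, k} m)
    - of_bool (even_supported {i} m) - of_bool (even_supported {j} m) - of_bool (even_supported {k} m)"
proof (cases "\<forall>i. even (Poly_Mapping.lookup m i)")
  case True
  have "2 * card (Poly_Mapping.keys m) = (\<Sum>i\<in>Poly_Mapping.keys m. 2)" by simp
  also have "\<dots> \<le> (\<Sum>i\<in>Poly_Mapping.keys m. Poly_Mapping.lookup m i)"
  proof (rule sum_mono)
    fix i assume "i \<in> Poly_Mapping.keys m"
    then have "Poly_Mapping.lookup m i \<noteq> 0" by (simp add: in_keys_iff)
    moreover have "even (Poly_Mapping.lookup m i)" using True by blast
    ultimately show "2 \<le> Poly_Mapping.lookup m i" by (auto elim!: evenE)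
  qed
  finally have "card (Poly_Mapping.keys m) \<le> 2" using assms(1) by (simp add: sum_lookup_keys)
  moreover have "card (Poly_Mapping.keys m) \<noteq> 0" using assms(1) by (auto simp: sum_lookup_keys)
  ultimately have "card (Poly_Mapping.keys m) = 1 \<or> card (Poly_Mapping.keys m) = 2" by linarith
  then obtain a b where "Poly_Mapping.keys m = {a, b}" by (auto simp: card_1_singleton_iff card_2_iff)
  then show ?thesis using assms True by (auto simp: even_supported_def)
qed (auto simp: even_supported_def)

text \<open>Zero sign sums on pairs and triples leave q(e_i) + q(e_j) + q(e_k) = 0 for all distinct
  i, j, k. Four indices give four such equations, whose only solution is zero; three indices would
  give just one.\<close>

lemma quartic_form_at_axis:
  fixes q :: "'n::finite real_mpoly"
  assumes q: "is_form 4 q" and card: "4 \<le> CARD('n)"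
    and z: "\<And>S s. card S \<in> {2, 3} \<Longrightarrow> s \<in> sign_vectors \<Longrightarrow> mpoly_eval q (\<chi> i. if i \<in> S then s i else 0) = 0"
  shows "mpoly_eval q (axis i 1) = 0"
proof -
  have zs: "sign_sum S q = 0" if "card S \<in> {2, 3}" for S
    unfolding sign_sum_def using z[OF that] by simp
  have single: "sign_sum {i} q = 2 ^ CARD('n) * mpoly_eval q (axis i 1)" for i
  proof -
    have "mpoly_eval q (\<chi> j. if j \<in> {i} then s j else 0) = mpoly_eval q (axis i 1)" if "s \<in> sign_vectors" for s
    proof -
      have "(\<chi> j. if j \<in> {i} then s j else 0) = s i *\<^sub>R axis i 1" by (simp add: vec_eq_iff axis_def)
      moreover have "s i = 1 \<or> s i = - 1" using that by (auto simp: sign_vectors_def PiE_def Pi_def)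
      then have "s i ^ 4 = 1" by auto
      ultimately show ?thesis using mpoly_eval_scale[OF q] by simp
    qed
    moreover have "card (sign_vectors :: ('n \<Rightarrow> real) set) = 2 ^ CARD('n)"
      by (simp add: sign_vectors_def card_PiE numeral_2_eq_2)
    ultimately show ?thesis by (simp add: sign_sum_def)
  qed
  have tri: "mpoly_eval q (axis i 1) + mpoly_eval q (axis j 1) + mpoly_eval q (axis k 1) = 0"
    if "i \<noteq> j" "i \<noteq> k" "j \<noteq> k" for i j k
  proof -
    have "sign_sum {i, j, k} q = sign_sum {i, j} q + sign_sum {i, k} q + sign_sum {j, k} q
            - sign_sum {i} q - sign_sum {j} q - sign_sum {k} q"
      unfolding sign_sum_eq sum.distrib[symmetric] sum_subtractf[symmetric]
    proof (rule sum.cong)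
      fix m assume "m \<in> Poly_Mapping.keys q"
      then have "(\<Sum>i\<in>UNIV. Poly_Mapping.lookup m i) = 4" using q by (simp add: is_form_def)
      from even_supported_quartic[OF this that]
      show "Poly_Mapping.lookup q m * (2 ^ CARD('n) * of_bool (even_supported {i, j, k} m)) =
        Poly_Mapping.lookup q m * (2 ^ CARD('n) * of_bool (even_supported {i, j} m)) +
        Poly_Mapping.lookup q m * (2 ^ CARD('n) * of_bool (even_supported {i, k} m)) +
        Poly_Mapping.lookup q m * (2 ^ CARD('n) * of_bool (even_supported {j, k} m)) -
        Poly_Mapping.lookup q m * (2 ^ CARD('n) * of_bool (even_supported {i} m)) -
        Poly_Mapping.lookup q m * (2 ^ CARD('n) * of_bool (even_supported {j} m)) -
        Poly_Mapping.lookup q m * (2 ^ CARD('n) * of_bool (even_supported {k} m))"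
        by (simp only: right_diff_distrib distrib_left)
    qed simp
    moreover have "card {i, j, k} = 3" "card {i, j} = 2" "card {i, k} = 2" "card {j, k} = 2"
      using that by auto
    ultimately have "2 ^ CARD('n) * (mpoly_eval q (axis i 1) + mpoly_eval q (axis j 1) + mpoly_eval q (axis k 1)) = 0"
      by (simp add: zs single distrib_left)
    then show ?thesis by simp
  qed
  have "3 \<le> card (UNIV - {i})" using card by simp
  then obtain T where T: "T \<subseteq> UNIV - {i}" "card T = 3" using obtain_subset_with_card_n by metis
  then obtain a b c where "T = {a, b, c}" "a \<noteq> b" "a \<noteq> c" "b \<noteq> c" by (auto simp: card_3_iff)
  with T tri[of i a b] tri[of i a c] tri[of i b c] tri[of a b c] show ?thesis by auto
qed

text \<open>Along the ray through x the bound compares t^(2l) with t^(2k): l < k fails for small t,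
  l > k for large t. This is needed because summands in \<open>sos_D_forms\<close> may have any
  degree.\<close>

lemma form_degree_of_square_le:
  assumes q: "is_form l q" and p: "is_form (2 * k) p" and le: "\<And>x. (mpoly_eval q x)\<^sup>2 \<le> mpoly_eval p x"
    and x: "mpoly_eval q x \<noteq> 0"
  shows "l = k"
proof -
  define c P where "c = (mpoly_eval q x)\<^sup>2" and "P = mpoly_eval p x"
  have c: "0 < c" "c \<le> P" using x le by (auto simp: c_def P_def)
  have *: "t ^ (2 * l) * c \<le> t ^ (2 * k) * P" for t
    using le[of "t *\<^sub>R x"] mpoly_eval_scale[OF q, of t x] mpoly_eval_scale[OF p, of t x]
    by (simp add: c_def P_def power_mult_distrib power_mult mult.commute)
  show ?thesis
  proof (rule ccontr)
    assume "l \<noteq> k"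
    then consider "l < k" | "k < l" by linarith
    then show False
    proof cases
      case 1
      \<comment> \<open>Makes t P = c / 2, already below c; higher powers of t < 1 only
        help.\<close>
      define t where "t = c / (2 * P)"
      have t: "0 < t" "t < 1" using c by (simp_all add: t_def field_simps)
      have "t ^ (2 * k) = t ^ (2 * l) * t ^ (2 * k - 2 * l)" using 1 by (simp flip: power_add)
      then have "c \<le> t ^ (2 * k - 2 * l) * P" using *[of t] t by simp
      also have "\<dots> \<le> t ^ 1 * P"
        using 1 t c by (intro mult_right_mono power_decreasing) auto
      also have "\<dots> = c / 2" using c by (simp add: t_def)
      finally show False using c by simp
    next
      case 2
      \<comment> \<open>Makes t c = P + c, which exceeds P.\<close>
      define t where "t = P / c + 1"
      have t: "1 \<le> t" using c by (simp add: t_def)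
      have "t ^ (2 * l) = t ^ (2 * k) * t ^ (2 * l - 2 * k)" using 2 by (simp flip: power_add)
      then have "t ^ (2 * l - 2 * k) * c \<le> P" using *[of t] t by simp
      moreover have "t ^ 1 * c \<le> t ^ (2 * l - 2 * k) * c"
        using 2 t c by (intro mult_right_mono power_increasing) auto
      moreover have "t ^ 1 * c = P + c" using c by (simp add: t_def field_simps)
      ultimately show False using c by simp
    qed
  qed
qed

lemma psum_poly_mult_schur_poly_not_sos:
  assumes "4 \<le> CARD('n::finite)"
  shows "(psum_poly 1 * schur_poly 1 :: 'n real_mpoly) \<notin> sos_D_forms 8"
proof
  let ?p = "psum_poly 1 * schur_poly 1 :: 'n real_mpoly"
  assume "?p \<in> sos_D_forms 8"
  then obtain qs where qs: "?p = (\<Sum>q\<leftarrow>qs. q ^ 2)" "\<And>q. q \<in> set qs \<Longrightarrow> \<exists>l. is_form l q"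
    and form: "is_form (2 * 4) ?p"
    unfolding sos_D_forms_def by auto
  have le: "(mpoly_eval q x)\<^sup>2 \<le> mpoly_eval ?p x" if "q \<in> set qs" for q x
    unfolding qs(1) using that by (auto intro!: member_le_sum_list)
  \<comment> \<open>With m nonzero entries all power sums of positive order equal m, and S_1 takes
    the value m (m - 2) (m - 3) / 2: zero for m = 2 and 3, but 1 at a unit vector.\<close>
  have p0: "mpoly_eval ?p (\<chi> i. if i \<in> S then s i else 0) = 0"
    if S: "card S \<in> {2, 3}" and s: "s \<in> sign_vectors" for S s
  proof -
    have "psum k (\<chi> i. if i \<in> S then s i else 0) = card S" if "0 < k" for k
    proof -
      have "psum k (\<chi> i. if i \<in> S then s i else 0) = (\<Sum>i\<in>UNIV. if i \<in> S then 1 else 0)"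
        unfolding psum_def
      proof (rule sum.cong)
        fix i
        have "s i = 1 \<or> s i = - 1" using s by (auto simp: sign_vectors_def PiE_def Pi_def)
        then show "((\<chi> i. if i \<in> S then s i else 0) $ i) ^ (2 * k) = (if i \<in> S then 1 else 0)"
          using that by auto
      qed simp
      then show ?thesis by (simp add: sum.If_cases)
    qed
    then show ?thesis using S by (auto simp: mpoly_eval_schur_poly)
  qed
  have "mpoly_eval q (axis i 1) = 0" if "q \<in> set qs" for q i
  proof (rule ccontr)
    assume nz: "mpoly_eval q (axis i 1) \<noteq> 0"
    obtain l where l: "is_form l q" using qs(2) \<open>q \<in> set qs\<close> by blast
    from form_degree_of_square_le[OF l form le[OF \<open>q \<in> set qs\<close>] nz] l have "is_form 4 q" by simp
    moreover have "mpoly_eval q (\<chi> i. if i \<in> S then s i else 0) = 0"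
      if "card S \<in> {2, 3}" "s \<in> sign_vectors" for S s
      using le[OF \<open>q \<in> set qs\<close>, of "\<chi> i. if i \<in> S then s i else 0"]
      unfolding p0[OF that] by simp
    ultimately show False using quartic_form_at_axis[of q i] assms nz by blast
  qed
  then have "mpoly_eval ?p (axis i 1) = (\<Sum>q\<leftarrow>qs. 0)" for i
    unfolding qs(1) mpoly_eval_sum_list by (intro arg_cong[of _ _ sum_list] map_cong) auto
  then have "mpoly_eval ?p (axis i 1) = 0" for i by simp
  moreover have "psum k (axis i 1) = 1" if "0 < k" for k and i :: 'n
  proof -
    have "psum k (axis i 1) = (\<Sum>j\<in>UNIV. if j = i then 1 else 0)"
      unfolding psum_def using that by (intro sum.cong) (auto simp: axis_def)
    then show ?thesis by simp
  qed
  then have "mpoly_eval ?p (axis i 1) = 1" for i by (simp add: mpoly_eval_schur_poly)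
  ultimately show False by (metis zero_neq_one)
qed

lemma ex_psd_not_sos:
  assumes "3 \<le> CARD('n::finite)" "3 \<le> d" "d \<noteq> 4 \<or> CARD('n) \<noteq> 3"
  shows "(sos_D_forms (2 * d) :: 'n real_mpoly set) \<noteq> psd_D_forms (2 * d)"
proof -
  have "\<exists>p :: 'n real_mpoly. p \<in> psd_D_forms (2 * d) \<and> p \<notin> sos_D_forms (2 * d)"
  proof (cases "odd d")
    case True
    have "2 * (d - 2) + 4 = 2 * d" "odd (d - 2)" using assms(2) True by simp_all
    with schur_poly_psd[of "d - 2", where 'n = 'n] schur_poly_not_sos[where 'n = 'n, OF assms(1)] assms(1)
    show ?thesis by (metis Suc_leD numeral_3_eq_3 numeral_2_eq_2)
  next
    case False
    show ?thesis
    proof (cases "d = 4")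
      case True
      have "(psum_poly 1 * schur_poly 1 :: 'n real_mpoly) \<in> psd_D_forms (2 * 1 + (2 * 1 + 4))"
        using assms(1) by (intro psd_D_forms_mult psum_poly_psd schur_poly_psd) simp
      with psum_poly_mult_schur_poly_not_sos[where 'n = 'n] assms True show ?thesis by auto
    next
      case False
      with \<open>\<not> odd d\<close> assms(2) have d: "6 \<le> d" by presburger
      then have "6 + (2 * (d - 5) + 4) = 2 * d" by simp
      moreover have "(esym3_poly * schur_poly (d - 5) :: 'n real_mpoly) \<in> psd_D_forms (6 + (2 * (d - 5) + 4))"
        using assms(1) by (intro psd_D_forms_mult esym3_poly_psd schur_poly_psd) simp
      moreover have "odd (d - 5)" using \<open>\<not> odd d\<close> d by simp
      ultimately show ?thesis using esym3_poly_mult_schur_poly_not_sos[where 'n = 'n, OF assms(1)] by metis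
    qed
  qed
  then show ?thesis by blast
qed

section \<open>Coefficients of invariant forms\<close>

definition swap_vars :: "'n \<Rightarrow> 'n \<Rightarrow> ('n \<Rightarrow>\<^sub>0 nat) \<Rightarrow> ('n \<Rightarrow>\<^sub>0 nat)" where
  "swap_vars i j m = Poly_Mapping.map_key (Transposition.transpose i j) m"

lemma lookup_swap_vars [simp]:
  "Poly_Mapping.lookup (swap_vars i j m) l = Poly_Mapping.lookup m (Transposition.transpose i j l)"
  by (simp add: swap_vars_def map_key.rep_eq)

lemma swap_vars_swap_vars [simp]: "swap_vars i j (swap_vars i j m) = m"
  by (rule poly_mapping_eqI) simp

lemma mono_eval_swap_vars:
  assumes "i \<noteq> j"
  shows "mono_eval m (reflection (axis i 1 - axis j 1) x) = mono_eval (swap_vars i j m) (x :: real ^ 'n::finite)"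
proof -
  have "mono_eval m (reflection (axis i 1 - axis j 1) x) =
        (\<Prod>l\<in>UNIV. (x $ Transposition.transpose i j l) ^ Poly_Mapping.lookup (swap_vars i j m) (Transposition.transpose i j l))"
    by (simp add: mono_eval_def reflection_minus_nth[OF assms])
  also have "\<dots> = mono_eval (swap_vars i j m) x"
    unfolding mono_eval_def
    by (rule prod.reindex_bij_betw[of "Transposition.transpose i j" UNIV UNIV
          "\<lambda>l. (x $ l) ^ Poly_Mapping.lookup (swap_vars i j m) l"]) simp
  finally show ?thesis .
qed

lemma D_invariant_reflection:
  assumes "D_invariant p" "i \<noteq> j"
  shows "mpoly_eval p (reflection (axis i 1 - axis j 1) x) = mpoly_eval p x"
    and "mpoly_eval p (reflection (axis i 1 + axis j 1) x) = mpoly_eval p x"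
  using assms unfolding D_invariant_iff D_reflections_def by blast+

text \<open>Invariance speaks of functions. The polynomial \<open>p'\<close> with permuted exponents
  has the same function as \<open>p\<close>, so it is \<open>p\<close>, and coefficients can be
  compared.\<close>

lemma lookup_swap_vars_invariant:
  fixes p :: "'n::finite real_mpoly"
  assumes "D_invariant p"
  shows "Poly_Mapping.lookup p (swap_vars i j m) = Poly_Mapping.lookup p m"
proof (cases "i = j")
  case True
  then have "swap_vars i j m = m" by (intro poly_mapping_eqI) simp
  then show ?thesis by simp
next
  case False
  define p' where "p' = (\<Sum>m\<in>Poly_Mapping.keys p. Poly_Mapping.single (swap_vars i j m) (Poly_Mapping.lookup p m))"
  have "mpoly_eval p' x = mpoly_eval p x" for x
  proof -
    have "mpoly_eval p' x = mpoly_eval p (reflection (axis i 1 - axis j 1) x)"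
      by (simp add: p'_def mpoly_eval_keys[of p] mono_eval_swap_vars[OF False])
    then show ?thesis using D_invariant_reflection[OF assms False] by simp
  qed
  then have "p' = p" by (rule mpoly_eqI)
  have "swap_vars i j m' = swap_vars i j m \<longleftrightarrow> m' = m" for m'
    by (metis swap_vars_swap_vars)
  then have "Poly_Mapping.lookup p' (swap_vars i j m) =
        (\<Sum>m'\<in>Poly_Mapping.keys p. if m' = m then Poly_Mapping.lookup p m else 0)"
    unfolding p'_def lookup_sum by (intro sum.cong) (auto simp: lookup_single when_def)
  also have "\<dots> = Poly_Mapping.lookup p m"
    by (simp add: in_keys_iff)
  finally show ?thesis using \<open>p' = p\<close> by simp
qed

text \<open>The two reflections belonging to i and j compose to the sign change of both x_i and x_j,
  which multiplies a monomial by the sign \<open>e m\<close>. So the exponents of a surviving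
  monomial are all even or all odd.\<close>

lemma lookup_invariant_parity:
  fixes p :: "'n::finite real_mpoly"
  assumes p: "D_invariant p" and nz: "Poly_Mapping.lookup p m \<noteq> 0"
  shows "even (Poly_Mapping.lookup m i) \<longleftrightarrow> even (Poly_Mapping.lookup m j)"
proof (cases "i = j")
  case False
  define e where "e m = (- 1 :: real) ^ (Poly_Mapping.lookup m i + Poly_Mapping.lookup m j)" for m
  define p' where "p' = (\<Sum>m\<in>Poly_Mapping.keys p. Poly_Mapping.single m (e m * Poly_Mapping.lookup p m))"
  have "mpoly_eval p' x = mpoly_eval p x" for x
  proof -
    let ?y = "reflection (axis i 1 - axis j 1) (reflection (axis i 1 + axis j 1) x)"
    have "mono_eval m ?y = e m * mono_eval m x" for m
    proof -
      have "mono_eval m ?y =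
          (\<Prod>l\<in>UNIV. (if l = i \<or> l = j then (- 1) ^ Poly_Mapping.lookup m l else 1) * (x $ l) ^ Poly_Mapping.lookup m l)"
        unfolding mono_eval_def
        by (intro prod.cong)
           (use False in \<open>auto simp: reflection_minus_nth reflection_plus_nth Transposition.transpose_def
              simp flip: power_mult_distrib\<close>)
      also have "\<dots> = (\<Prod>l\<in>{i, j}. (- 1) ^ Poly_Mapping.lookup m l) * mono_eval m x"
        unfolding prod.distrib mono_eval_def
        by (intro arg_cong2[of _ _ _ _ "(*)"] prod.mono_neutral_cong_right) auto
      finally show ?thesis using False by (simp add: e_def power_add)
    qed
    then have "mpoly_eval p' x = mpoly_eval p ?y"
      by (simp add: p'_def mpoly_eval_keys[of p] mult_ac)
    then show ?thesis using D_invariant_reflection[OF p False] by simp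
  qed
  then have "p' = p" by (rule mpoly_eqI)
  have "Poly_Mapping.lookup p' m =
        (\<Sum>m'\<in>Poly_Mapping.keys p. if m' = m then e m * Poly_Mapping.lookup p m else 0)"
    unfolding p'_def lookup_sum by (intro sum.cong) (auto simp: lookup_single when_def)
  also have "\<dots> = e m * Poly_Mapping.lookup p m"
    by (simp add: in_keys_iff)
  finally have em: "e m = 1" using \<open>p' = p\<close> nz by simp
  have "even (Poly_Mapping.lookup m i + Poly_Mapping.lookup m j)"
  proof (rule ccontr)
    assume "\<not> ?thesis"
    then have "e m = - 1" by (simp add: e_def)
    with em show False by simp
  qed
  then show ?thesis by simp
qed simp

section \<open>Quadratic and quartic forms\<close>

text \<open>i = j is allowed and gives a fourth power, so one family covers every even quartic
  monomial.\<close>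

definition square_pair :: "'n \<Rightarrow> 'n \<Rightarrow> ('n \<Rightarrow>\<^sub>0 nat)" where
  "square_pair i j = Poly_Mapping.single i 2 + Poly_Mapping.single j 2"

lemma square_pair_eq_iff: "square_pair i j = square_pair a b \<longleftrightarrow> i = a \<and> j = b \<or> i = b \<and> j = a"
proof
  assume eq: "square_pair i j = square_pair a b"
  have single: "k = l" if "Poly_Mapping.single k (2::nat) = Poly_Mapping.single l 2" for k l :: 'a
    using that by (metis lookup_single_eq lookup_single_not_eq zero_neq_numeral)
  have "Poly_Mapping.lookup (square_pair a b) i \<noteq> 0"
    unfolding eq[symmetric] by (simp add: square_pair_def lookup_add)
  then have "i = a \<or> i = b"
    by (cases "a = i"; cases "b = i") (auto simp: square_pair_def lookup_add lookup_single when_def)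
  then show "i = a \<and> j = b \<or> i = b \<and> j = a"
  proof
    assume "i = a"
    with eq have "Poly_Mapping.single j (2::nat) = Poly_Mapping.single b 2" by (simp add: square_pair_def)
    with single \<open>i = a\<close> show ?thesis by blast
  next
    assume "i = b"
    with eq have "Poly_Mapping.single b (2::nat) + Poly_Mapping.single j 2 = Poly_Mapping.single b 2 + Poly_Mapping.single a 2"
      by (simp add: square_pair_def add.commute)
    then have "Poly_Mapping.single j (2::nat) = Poly_Mapping.single a 2" by (rule add_left_imp_eq)
    with single \<open>i = b\<close> show ?thesis by blast
  qed
qed (auto simp: square_pair_def add.commute)

lemma swap_vars_square_pair:
  "swap_vars i j (square_pair a b) = square_pair (Transposition.transpose i j a) (Transposition.transpose i j b)"
proof (rule poly_mapping_eqI)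
  fix l
  have "c = Transposition.transpose i j l \<longleftrightarrow> Transposition.transpose i j c = l" for c
    by (metis transpose_involutory)
  then show "Poly_Mapping.lookup (swap_vars i j (square_pair a b)) l =
      Poly_Mapping.lookup (square_pair (Transposition.transpose i j a) (Transposition.transpose i j b)) l"
    by (simp only: lookup_swap_vars square_pair_def lookup_add lookup_single)
qed

lemma even_quartic_monomial:
  fixes m :: "'n::finite \<Rightarrow>\<^sub>0 nat"
  assumes ev: "\<And>i. even (Poly_Mapping.lookup m i)" and deg: "(\<Sum>i\<in>UNIV. Poly_Mapping.lookup m i) = 4"
  obtains i j where "m = square_pair i j"
proof -
  have sub: "\<exists>j m'. m = Poly_Mapping.single j 2 + m' \<and> (\<forall>i. even (Poly_Mapping.lookup m' i)) \<and>
       (\<Sum>i\<in>UNIV. Poly_Mapping.lookup m i) = 2 + (\<Sum>i\<in>UNIV. Poly_Mapping.lookup m' i)"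
    if ev: "\<And>i. even (Poly_Mapping.lookup m i)" and nz: "(\<Sum>i\<in>UNIV. Poly_Mapping.lookup m i) \<noteq> 0" for m :: "'n \<Rightarrow>\<^sub>0 nat"
  proof -
    obtain j where "Poly_Mapping.lookup m j \<noteq> 0" using nz by auto
    then have ge: "2 \<le> Poly_Mapping.lookup m j" using ev[of j] by (auto elim!: evenE)
    define m' where "m' = m - Poly_Mapping.single j 2"
    have eq: "m = Poly_Mapping.single j 2 + m'"
      by (rule poly_mapping_eqI) (use ge in \<open>auto simp: m'_def lookup_add lookup_minus lookup_single when_def\<close>)
    moreover have "even (Poly_Mapping.lookup m' i)" for i
      using ev[of i] by (auto simp: m'_def lookup_minus lookup_single when_def)
    moreover have "(\<Sum>i\<in>UNIV. Poly_Mapping.lookup m i) = 2 + (\<Sum>i\<in>UNIV. Poly_Mapping.lookup m' i)"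
      by (subst eq) (simp add: lookup_add sum.distrib sum_lookup_single)
    ultimately show ?thesis by blast
  qed
  have "(\<Sum>i\<in>UNIV. Poly_Mapping.lookup m i) \<noteq> 0" using deg by simp
  from sub[OF ev this] obtain j m' where m': "m = Poly_Mapping.single j 2 + m'"
    "\<And>i. even (Poly_Mapping.lookup m' i)"
    "(\<Sum>i\<in>UNIV. Poly_Mapping.lookup m i) = 2 + (\<Sum>i\<in>UNIV. Poly_Mapping.lookup m' i)"
    by blast
  have "(\<Sum>i\<in>UNIV. Poly_Mapping.lookup m' i) \<noteq> 0" using m'(3) deg by linarith
  from sub[OF m'(2) this] obtain k m'' where m'': "m' = Poly_Mapping.single k 2 + m''"
    "(\<Sum>i\<in>UNIV. Poly_Mapping.lookup m' i) = 2 + (\<Sum>i\<in>UNIV. Poly_Mapping.lookup m'' i)"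
    by blast
  have "(\<Sum>i\<in>UNIV. Poly_Mapping.lookup m'' i) = 0" using m'(3) m''(2) deg by linarith
  then have "m'' = 0" by (intro poly_mapping_eqI) simp
  with m'(1) m''(1) have "m = square_pair j k" by (simp add: square_pair_def)
  then show ?thesis by (rule that)
qed

lemma even_quadratic_monomial:
  fixes m :: "'n::finite \<Rightarrow>\<^sub>0 nat"
  assumes ev: "\<And>i. even (Poly_Mapping.lookup m i)" and deg: "(\<Sum>i\<in>UNIV. Poly_Mapping.lookup m i) = 2"
  obtains i where "m = Poly_Mapping.single i 2"
proof -
  obtain j where "Poly_Mapping.lookup m j \<noteq> 0" using deg by fastforce
  then have ge: "2 \<le> Poly_Mapping.lookup m j" using ev[of j] by (auto elim!: evenE)
  have "(\<Sum>i\<in>UNIV. Poly_Mapping.lookup m i) = Poly_Mapping.lookup m j + (\<Sum>i\<in>UNIV - {j}. Poly_Mapping.lookup m i)"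
    by (rule sum.remove) auto
  with deg ge have "Poly_Mapping.lookup m j = 2" "(\<Sum>i\<in>UNIV - {j}. Poly_Mapping.lookup m i) = 0" by linarith+
  then have "m = Poly_Mapping.single j 2"
    by (intro poly_mapping_eqI) (auto simp: lookup_single when_def)
  then show ?thesis by (rule that)
qed

lemma sos_fun_monomial_square: "0 \<le> c \<Longrightarrow> sos_fun (\<lambda>x. c * (mono_eval m x)\<^sup>2)"
  using sos_fun_square[OF is_form_single[OF refl], of c m 1] by simp

text \<open>All exponents odd would force degree at least n >= 3, so only squares of variables
  occur, and their coefficients are the values at the unit vectors.\<close>

lemma quadratic_psd_imp_sos:
  assumes n: "3 \<le> CARD('n::finite)" and p: "(p :: 'n real_mpoly) \<in> psd_D_forms 2"
  shows "p \<in> sos_D_forms 2"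
proof -
  from p have form: "is_form 2 p" and inv: "D_invariant p" and nn: "\<And>x. 0 \<le> mpoly_eval p x"
    by (auto simp: psd_D_forms_def)
  have keys: "Poly_Mapping.keys p \<subseteq> range (\<lambda>i. Poly_Mapping.single i 2)"
  proof
    fix m assume m: "m \<in> Poly_Mapping.keys p"
    then have deg: "(\<Sum>i\<in>UNIV. Poly_Mapping.lookup m i) = 2" using form by (simp add: is_form_def)
    have par: "even (Poly_Mapping.lookup m i) \<longleftrightarrow> even (Poly_Mapping.lookup m j)" for i j
      using lookup_invariant_parity[OF inv] m by (simp add: in_keys_iff)
    have "even (Poly_Mapping.lookup m i)" for i
    proof (rule ccontr)
      assume "odd (Poly_Mapping.lookup m i)"
      then have "odd (Poly_Mapping.lookup m j)" for j using par[of i j] by simp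
      then have "1 \<le> Poly_Mapping.lookup m j" for j by (simp add: Suc_leI odd_pos)
      then have "(\<Sum>j\<in>(UNIV :: 'n set). 1) \<le> (\<Sum>i\<in>UNIV. Poly_Mapping.lookup m i)" by (intro sum_mono)
      with n deg show False by simp
    qed
    with deg show "m \<in> range (\<lambda>i. Poly_Mapping.single i 2)" by (metis even_quadratic_monomial rangeI)
  qed
  have inj: "inj (\<lambda>i::'n. Poly_Mapping.single i (2::nat))"
    by (rule injI) (metis lookup_single_eq lookup_single_not_eq zero_neq_numeral)
  let ?c = "\<lambda>i. Poly_Mapping.lookup p (Poly_Mapping.single i 2)"
  have eval: "mpoly_eval p x = (\<Sum>i\<in>UNIV. ?c i * (x $ i)\<^sup>2)" for x
    by (simp add: mpoly_eval_superset[OF _ keys] sum.reindex[OF inj])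
  have "0 \<le> ?c i" for i
  proof -
    have "mpoly_eval p (axis i 1) = (\<Sum>j\<in>UNIV. if j = i then ?c i else 0)"
      unfolding eval by (intro sum.cong) (auto simp: axis_def)
    then show ?thesis using nn[of "axis i 1"] by simp
  qed
  then have "sos_fun (\<lambda>x. \<Sum>i\<in>UNIV. ?c i * (mono_eval (Poly_Mapping.single i 1) x)\<^sup>2)"
    by (intro sos_fun_sum sos_fun_monomial_square)
  then have "sos_fun (mpoly_eval p)" unfolding eval[abs_def] by simp
  with form inv show ?thesis by (intro sos_D_formsI)
qed

definition one_vector :: "'n::finite \<Rightarrow>\<^sub>0 nat" where
  "one_vector = (\<Sum>i\<in>UNIV. Poly_Mapping.single i 1)"

lemma lookup_one_vector [simp]: "Poly_Mapping.lookup one_vector i = 1"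
  by (simp add: one_vector_def lookup_sum lookup_single when_def)

lemma mono_eval_square_pair: "mono_eval (square_pair i j) x = (x $ i)\<^sup>2 * (x $ j)\<^sup>2"
  by (simp add: square_pair_def mono_eval_add)

lemma psum_one_square: "(psum 1 x)\<^sup>2 = (\<Sum>i\<in>UNIV. \<Sum>j\<in>UNIV. (x $ i)\<^sup>2 * (x $ j)\<^sup>2)"
proof -
  have "psum 1 x = (\<Sum>i\<in>UNIV. (x $ i)\<^sup>2)" by (simp add: psum_def)
  then show ?thesis
    by (simp only: power2_eq_square[of "\<Sum>i\<in>UNIV. (x $ i)\<^sup>2"] sum_product)
qed

text \<open>Even quartic monomials form two orbits under permutations, with coefficients \<alpha>
  and \<beta>. The only all-odd candidate is the product of all variables, which has degree 4
  exactly when n = 4.\<close>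

lemma invariant_quartic_eval:
  assumes n: "3 \<le> CARD('n::finite)" and form: "is_form 4 (p :: 'n real_mpoly)" and inv: "D_invariant p"
  obtains \<alpha> \<beta> \<gamma> where "\<And>x. mpoly_eval p x =
      \<alpha> * psum 2 x + \<beta> / 2 * ((psum 1 x)\<^sup>2 - psum 2 x) + \<gamma> * (\<Prod>i\<in>UNIV. x $ i)"
    and "\<gamma> = 0 \<or> CARD('n) = 4"
proof -
  define g where "g i j = Poly_Mapping.lookup p (square_pair i j)" for i j
  have sw: "g (Transposition.transpose i j a) (Transposition.transpose i j b) = g a b" for i j a b
    unfolding g_def swap_vars_square_pair[symmetric] by (rule lookup_swap_vars_invariant[OF inv])
  obtain a0 b0 :: 'n where ab0: "a0 \<noteq> b0"
  proof -
    obtain T :: "'n set" where "card T = 3" using n obtain_subset_with_card_n by metis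
    then show ?thesis using that by (auto simp: card_3_iff)
  qed
  define \<alpha> \<beta> \<gamma> where "\<alpha> = g a0 a0" and "\<beta> = g a0 b0" and "\<gamma> = Poly_Mapping.lookup p one_vector"
  have ga: "g a a = \<alpha>" for a using sw[of a0 a a0 a0] by (simp add: \<alpha>_def)
  have gb: "g a b = \<beta>" if "a \<noteq> b" for a b
  proof -
    \<comment> \<open>Two transpositions carry (a0, b0) to (a, b): the first places a, the second
      moves b' to b and fixes a.\<close>
    define b' where "b' = Transposition.transpose a0 a b0"
    have "b' \<noteq> a" using ab0 by (auto simp: b'_def Transposition.transpose_def split: if_splits)
    have "g a b = g a b'"
      using sw[of b' b a b'] \<open>b' \<noteq> a\<close> that by (simp add: Transposition.transpose_def)
    also have "\<dots> = \<beta>" using sw[of a0 a a0 b0] by (simp add: b'_def \<beta>_def)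
    finally show ?thesis .
  qed
  \<comment> \<open>The sum runs over ordered pairs, so each mixed monomial occurs twice and gets
    half of \<beta>.\<close>
  define p0 :: "'n real_mpoly" where "p0 = (\<Sum>(i, j)\<in>UNIV. Poly_Mapping.single (square_pair i j) (if i = j then \<alpha> else \<beta> / 2))
      + Poly_Mapping.single one_vector \<gamma>"
  have ne: "square_pair i j \<noteq> one_vector" for i j :: 'n
  proof
    assume "square_pair i j = one_vector"
    then have "Poly_Mapping.lookup (square_pair i j) i = 1" by simp
    then show False by (auto simp: square_pair_def lookup_add lookup_single when_def split: if_splits)
  qed
  have lp0: "Poly_Mapping.lookup p0 m = (\<Sum>(i, j)\<in>UNIV. if square_pair i j = m then (if i = j then \<alpha> else \<beta> / 2) else 0)
      + (if one_vector = m then \<gamma> else 0)" for m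
    by (simp only: p0_def lookup_add lookup_sum case_prod_unfold lookup_single when_def)
  have cases: "Poly_Mapping.lookup p m = 0 \<or> (\<exists>a b. m = square_pair a b) \<or> (m = one_vector \<and> CARD('n) = 4)" for m
  proof (cases "Poly_Mapping.lookup p m = 0")
    case False
    then have deg: "(\<Sum>i\<in>UNIV. Poly_Mapping.lookup m i) = 4" using form by (simp add: is_form_def in_keys_iff)
    have par: "even (Poly_Mapping.lookup m i) \<longleftrightarrow> even (Poly_Mapping.lookup m j)" for i j
      using lookup_invariant_parity[OF inv False] .
    show ?thesis
    proof (cases "\<exists>i. odd (Poly_Mapping.lookup m i)")
      case True
      then have odd: "odd (Poly_Mapping.lookup m j)" for j using par by blast
      then have ge: "1 \<le> Poly_Mapping.lookup m j" for j by (simp add: Suc_leI odd_pos)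
      then have "(\<Sum>j\<in>(UNIV :: 'n set). 1) \<le> (\<Sum>i\<in>UNIV. Poly_Mapping.lookup m i)" by (intro sum_mono)
      then have "CARD('n) \<le> 4" using deg by simp
      \<comment> \<open>A sum of n odd numbers has the parity of n; this excludes n = 3.\<close>
      moreover have "even (\<Sum>i\<in>UNIV. Poly_Mapping.lookup m i) \<longleftrightarrow> even (CARD('n))"
        using odd by (subst even_sum_iff) auto
      then have "even (CARD('n))" using deg by simp
      ultimately have c4: "CARD('n) = 4" using n by presburger
      have "(\<Sum>i\<in>UNIV. Poly_Mapping.lookup m i - 1) = (\<Sum>i\<in>UNIV. Poly_Mapping.lookup m i) - (\<Sum>i\<in>(UNIV :: 'n set). 1)"
        using ge by (intro sum_subtractf_nat)
      also have "\<dots> = 0" using deg c4 by simp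
      finally have le: "Poly_Mapping.lookup m i - 1 = 0" for i by simp
      have "Poly_Mapping.lookup m i = 1" for i using le[of i] ge[of i] by linarith
      then have "m = one_vector" by (intro poly_mapping_eqI) simp
      with c4 show ?thesis by simp
    next
      case False
      then have "even (Poly_Mapping.lookup m i)" for i by blast
      then obtain a b where "m = square_pair a b" using even_quartic_monomial[OF _ deg] by metis
      then show ?thesis by blast
    qed
  qed simp
  have "p = p0"
  proof (rule poly_mapping_eqI)
    fix m :: "'n \<Rightarrow>\<^sub>0 nat"
    consider (1) a b where "m = square_pair a b" | (2) "m = one_vector" |
      (3) "\<nexists>a b. m = square_pair a b" "m \<noteq> one_vector" by blast
    then show "Poly_Mapping.lookup p m = Poly_Mapping.lookup p0 m"
    proof cases
      case 1
      have "Poly_Mapping.lookup p0 m = (\<Sum>(i, j)\<in>UNIV. if square_pair i j = m then (if i = j then \<alpha> else \<beta> / 2) else 0)"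
        unfolding lp0 1 using ne[of a b] by simp
      also have "\<dots> = (\<Sum>(i, j)\<in>{(a, b), (b, a)}. if i = j then \<alpha> else \<beta> / 2)"
        by (intro sum.mono_neutral_cong_right) (auto simp: 1 square_pair_eq_iff split: if_splits)
      also have "\<dots> = g a b" using ga gb by (cases "a = b") auto
      finally show ?thesis using 1 by (simp add: g_def)
    next
      case 2
      show ?thesis unfolding lp0 2 by (simp add: ne \<gamma>_def case_prod_unfold)
    next
      case 3
      have z: "Poly_Mapping.lookup p m = 0" using cases[of m] 3 by blast
      from 3(1) have "square_pair i j \<noteq> m" for i j by blast
      moreover from 3(2) have "one_vector \<noteq> m" by blast
      ultimately show ?thesis unfolding lp0 z by (simp add: case_prod_unfold)
    qed
  qed
  have "mpoly_eval p x = \<alpha> * psum 2 x + \<beta> / 2 * ((psum 1 x)\<^sup>2 - psum 2 x) + \<gamma> * (\<Prod>i\<in>UNIV. x $ i)" for x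
  proof -
    have "mpoly_eval p x = (\<Sum>i\<in>UNIV. \<Sum>j\<in>UNIV. (if i = j then \<alpha> else \<beta> / 2) * ((x $ i)\<^sup>2 * (x $ j)\<^sup>2))
        + \<gamma> * mono_eval one_vector x"
      unfolding \<open>p = p0\<close> p0_def
      by (simp add: case_prod_unfold mono_eval_square_pair UNIV_Times_UNIV[symmetric] sum.cartesian_product
          del: UNIV_Times_UNIV)
    also have "(\<Sum>i\<in>UNIV. \<Sum>j\<in>UNIV. (if i = j then \<alpha> else \<beta> / 2) * ((x $ i)\<^sup>2 * (x $ j)\<^sup>2)) =
        (\<Sum>i\<in>UNIV. \<Sum>j\<in>UNIV. (if i = j then (\<alpha> - \<beta> / 2) * (x $ i) ^ 4 else 0) + \<beta> / 2 * ((x $ i)\<^sup>2 * (x $ j)\<^sup>2))"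
      by (intro sum.cong) (auto simp: power2_eq_square power4_eq_xxxx algebra_simps)
    also have "\<dots> = (\<alpha> - \<beta> / 2) * psum 2 x + \<beta> / 2 * (psum 1 x)\<^sup>2"
      unfolding psum_one_square psum_def[of 2] by (simp add: sum.distrib sum_distrib_left)
    finally show ?thesis by (simp add: mono_eval_def power2_eq_square algebra_simps)
  qed
  moreover have "\<gamma> = 0 \<or> CARD('n) = 4"
    using cases[of one_vector] ne[THEN not_sym] unfolding \<gamma>_def by blast
  ultimately show ?thesis by (rule that)
qed

text \<open>Two kinds of points suffice to read off the conditions: unit vectors give \<alpha> >= 0,
  and vectors with all entries +-1 bound \<mu> from below.\<close>

lemma quartic_psd_imp_sos:
  assumes n: "3 \<le> CARD('n::finite)" and p: "(p :: 'n real_mpoly) \<in> psd_D_forms 4"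
  shows "p \<in> sos_D_forms 4"
proof -
  from p have form: "is_form 4 p" and inv: "D_invariant p" and nn: "\<And>x. 0 \<le> mpoly_eval p x"
    by (auto simp: psd_D_forms_def)
  obtain \<alpha> \<beta> \<gamma> where eval: "\<And>x. mpoly_eval p x =
      \<alpha> * psum 2 x + \<beta> / 2 * ((psum 1 x)\<^sup>2 - psum 2 x) + \<gamma> * (\<Prod>i\<in>UNIV. x $ i)"
    and \<gamma>: "\<gamma> = 0 \<or> CARD('n) = 4"
    using invariant_quartic_eval[OF n form inv] by metis
  define N where "N = real (CARD('n))"
  have N: "3 \<le> N" using n by (simp add: N_def)
  \<comment> \<open>The sum of \<nu> (x_i^2 - x_j^2)^2 over ordered pairs has coefficient 2 (N - 1)
    \<nu> at each fourth power, matching \<alpha>, and -4 \<nu> at each mixed monomial; \<mu> is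
    what then remains of \<beta>.\<close>
  define \<nu> where "\<nu> = \<alpha> / (2 * (N - 1))"
  define \<mu> where "\<mu> = \<beta> + 4 * \<nu>"
  fix i0 :: 'n
  have "0 \<le> \<alpha>"
  proof -
    have "psum k (axis i0 1) = 1" if "0 < k" for k
    proof -
      have "psum k (axis i0 1) = (\<Sum>j\<in>UNIV. if j = i0 then 1 else 0)"
        unfolding psum_def using that by (intro sum.cong) (auto simp: axis_def)
      then show ?thesis by simp
    qed
    moreover have prod0: "(\<Prod>i\<in>UNIV. axis i0 (1::real) $ i) = 0"
    proof -
      have "UNIV \<noteq> {i0}" using n by (metis card_1_singleton_iff One_nat_def numeral_le_one_iff semiring_norm(70))
      then obtain j where "j \<noteq> i0" by auto
      then show ?thesis by (intro prod_zero) (auto simp: axis_def)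
    qed
    ultimately show ?thesis using nn[of "axis i0 1"] unfolding eval prod0 by simp
  qed
  then have "0 \<le> \<nu>" using N by (simp add: \<nu>_def)
  have \<alpha>: "\<alpha> = 2 * (N - 1) * \<nu>" using N by (simp add: \<nu>_def)
  have \<mu>\<gamma>: "0 \<le> N * (N - 1) / 2 * \<mu> + \<gamma> * s" if "s = 1 \<or> s = - 1" for s
  proof -
    \<comment> \<open>All squares equal 1, so the \<nu>-part vanishes; the single entry s fixes the
      sign of the product.\<close>
    let ?x = "\<chi> i. if i = i0 then s else 1"
    have "psum k ?x = (\<Sum>i\<in>(UNIV :: 'n set). 1)" for k
      unfolding psum_def using that by (intro sum.cong) auto
    then have "psum k ?x = N" for k by (simp add: N_def)
    moreover have "(\<Prod>i\<in>UNIV. ?x $ i) = s" by simp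
    ultimately have "0 \<le> \<alpha> * N + \<beta> / 2 * (N\<^sup>2 - N) + \<gamma> * s" using nn[of ?x] by (simp add: eval)
    also have "\<dots> = N * (N - 1) / 2 * \<mu> + \<gamma> * s"
      unfolding \<mu>_def \<alpha> by (simp add: power2_eq_square field_simps)
    finally show ?thesis .
  qed
  have base: "sos_fun (\<lambda>x :: real ^ 'n. \<nu> * (2 * N * psum 2 x - 2 * (psum 1 x)\<^sup>2) + c / 2 * ((psum 1 x)\<^sup>2 - psum 2 x))"
    if "0 \<le> c" for c
  proof -
    let ?q = "\<lambda>i j. Poly_Mapping.single (Poly_Mapping.single i 2) 1 + Poly_Mapping.single (Poly_Mapping.single j 2) (- 1) :: 'n real_mpoly"
    have "is_form 2 (?q i j)" for i j by (intro is_form_add is_form_single sum_lookup_single)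
    then have S: "sos_fun (\<lambda>x. (\<Sum>i\<in>UNIV. \<Sum>j\<in>UNIV. \<nu> * (mpoly_eval (?q i j) x)\<^sup>2)
        + (\<Sum>i\<in>UNIV. \<Sum>j\<in>UNIV - {i}. c / 2 * (mono_eval (Poly_Mapping.single i 1 + Poly_Mapping.single j 1) x)\<^sup>2))"
      using that \<open>0 \<le> \<nu>\<close> by (intro sos_fun_add sos_fun_sum sos_fun_square sos_fun_monomial_square) auto
    have E1: "(\<Sum>i\<in>UNIV. \<Sum>j\<in>UNIV. \<nu> * (mpoly_eval (?q i j) x)\<^sup>2) = \<nu> * (2 * N * psum 2 x - 2 * (psum 1 x)\<^sup>2)" for x
    proof -
      have "(\<Sum>i\<in>UNIV. \<Sum>j\<in>UNIV. \<nu> * (mpoly_eval (?q i j) x)\<^sup>2) =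
        \<nu> * (\<Sum>i\<in>UNIV. \<Sum>j\<in>UNIV. (x $ i) ^ 4 + (x $ j) ^ 4 - 2 * ((x $ i)\<^sup>2 * (x $ j)\<^sup>2))"
        unfolding sum_distrib_left by (intro sum.cong) (auto simp: power2_eq_square power4_eq_xxxx algebra_simps)
      also have "(\<Sum>i\<in>UNIV. \<Sum>j\<in>UNIV. (x $ i) ^ 4 + (x $ j) ^ 4 - 2 * ((x $ i)\<^sup>2 * (x $ j)\<^sup>2)) =
        2 * N * (\<Sum>i\<in>UNIV. (x $ i) ^ 4) - 2 * (\<Sum>i\<in>UNIV. \<Sum>j\<in>UNIV. (x $ i)\<^sup>2 * (x $ j)\<^sup>2)"
        by (simp add: sum.distrib sum_subtractf N_def flip: sum_distrib_left)
      also have "(\<Sum>i\<in>UNIV. \<Sum>j\<in>UNIV. (x $ i)\<^sup>2 * (x $ j)\<^sup>2) = (psum 1 x)\<^sup>2"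
        unfolding psum_one_square by simp
      also have "(\<Sum>i\<in>UNIV. (x $ i) ^ 4) = psum 2 x" by (simp add: psum_def)
      finally show ?thesis .
    qed
    have E2: "(\<Sum>i\<in>UNIV. \<Sum>j\<in>UNIV - {i}. c / 2 * (mono_eval (Poly_Mapping.single i 1 + Poly_Mapping.single j 1) x)\<^sup>2)
        = c / 2 * ((psum 1 x)\<^sup>2 - psum 2 x)" for x
    proof -
      have "(\<Sum>i\<in>UNIV. \<Sum>j\<in>UNIV - {i}. c / 2 * (mono_eval (Poly_Mapping.single i 1 + Poly_Mapping.single j 1) x)\<^sup>2)
        = c / 2 * (\<Sum>i\<in>UNIV. \<Sum>j\<in>UNIV - {i}. (x $ i)\<^sup>2 * (x $ j)\<^sup>2)"
        by (simp add: mono_eval_add power_mult_distrib sum_distrib_left)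
      also have "\<dots> = c / 2 * (\<Sum>i\<in>UNIV. (\<Sum>j\<in>UNIV. (x $ i)\<^sup>2 * (x $ j)\<^sup>2) - (x $ i) ^ 4)"
        by (simp add: sum_diff1 flip: power_add)
      finally show ?thesis
        unfolding psum_one_square psum_def[of 2] by (simp add: sum_subtractf)
    qed
    show ?thesis using S by (simp only: E1 E2)
  qed
  have eval': "mpoly_eval p x = \<nu> * (2 * N * psum 2 x - 2 * (psum 1 x)\<^sup>2)
      + \<mu> / 2 * ((psum 1 x)\<^sup>2 - psum 2 x) + \<gamma> * (\<Prod>i\<in>UNIV. x $ i)" for x
    unfolding eval \<mu>_def \<alpha> by (simp add: field_simps)
  have "sos_fun (mpoly_eval p)"
  proof (cases "\<gamma> = 0")
    case True
    then have "0 \<le> N * (N - 1) / 2 * \<mu>" using \<mu>\<gamma>[of 1] by simp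
    moreover have "0 < N * (N - 1) / 2" using N by simp
    ultimately have "0 \<le> \<mu>" by (simp only: zero_le_mult_iff) linarith
    then show ?thesis using base[of \<mu>] True by (simp add: eval'[abs_def])
  next
    case False
    then have c4: "CARD('n) = 4" using \<gamma> by simp
    then have "N = 4" by (simp add: N_def)
    then have \<mu>: "\<bar>\<gamma>\<bar> / 6 \<le> \<mu>" using \<mu>\<gamma>[of 1] \<mu>\<gamma>[of "- 1"] by simp
    obtain a T where aT: "UNIV = insert (a::'n) T" "a \<notin> T" "card T = 3"
      using c4 card_Suc_eq[of "UNIV :: 'n set" 3] by auto
    obtain b c d where "T = {b, c, d}" "b \<noteq> c" "b \<noteq> d" "c \<noteq> d"
      using aT(3) by (auto simp: card_3_iff)
    with aT have U: "UNIV = {a, b, c, d}" and ds: "a \<noteq> b" "a \<noteq> c" "a \<noteq> d" "b \<noteq> c" "b \<noteq> d" "c \<noteq> d" by auto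
    define \<epsilon> where "\<epsilon> = sgn \<gamma>"
    have \<epsilon>: "\<epsilon>\<^sup>2 = 1" "\<gamma> = \<bar>\<gamma>\<bar> * \<epsilon>" using False by (auto simp: \<epsilon>_def sgn_if)
    \<comment> \<open>One form for each splitting of the four variables into two pairs. The three
      squares add up to all mixed monomials plus 6 \<epsilon> times the product, so weight
      |\<gamma>| / 6 yields the \<gamma>-term and consumes |\<gamma>| / 6 of \<mu>, exactly what the
      bound on \<mu> permits.\<close>
    let ?q = "\<lambda>i j k l. Poly_Mapping.single (Poly_Mapping.single i 1 + Poly_Mapping.single j 1) 1
        + Poly_Mapping.single (Poly_Mapping.single k 1 + Poly_Mapping.single l 1) \<epsilon> :: 'n real_mpoly"
    have form_q: "is_form 2 (?q i j k l)" for i j k l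
      by (intro is_form_add is_form_single) (simp_all add: lookup_add sum.distrib sum_lookup_single)
    have "0 \<le> \<mu> - \<bar>\<gamma>\<bar> / 6" "0 \<le> \<bar>\<gamma>\<bar> / 6" using \<mu> by simp_all
    with form_q have "sos_fun (\<lambda>x. (\<nu> * (2 * N * psum 2 x - 2 * (psum 1 x)\<^sup>2)
          + (\<mu> - \<bar>\<gamma>\<bar> / 6) / 2 * ((psum 1 x)\<^sup>2 - psum 2 x))
        + (\<bar>\<gamma>\<bar> / 6 * (mpoly_eval (?q a b c d) x)\<^sup>2 + \<bar>\<gamma>\<bar> / 6 * (mpoly_eval (?q a c b d) x)\<^sup>2
          + \<bar>\<gamma>\<bar> / 6 * (mpoly_eval (?q a d b c) x)\<^sup>2))"
      by (intro sos_fun_add[OF base] sos_fun_add sos_fun_square)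
    moreover have "(\<nu> * (2 * N * psum 2 x - 2 * (psum 1 x)\<^sup>2)
          + (\<mu> - \<bar>\<gamma>\<bar> / 6) / 2 * ((psum 1 x)\<^sup>2 - psum 2 x))
        + (\<bar>\<gamma>\<bar> / 6 * (mpoly_eval (?q a b c d) x)\<^sup>2 + \<bar>\<gamma>\<bar> / 6 * (mpoly_eval (?q a c b d) x)\<^sup>2
          + \<bar>\<gamma>\<bar> / 6 * (mpoly_eval (?q a d b c) x)\<^sup>2) = mpoly_eval p x" for x
    proof -
      define A B C D where "A = x $ a" and "B = x $ b" and "C = x $ c" and "D = x $ d"
      have ps: "psum 1 x = A\<^sup>2 + B\<^sup>2 + C\<^sup>2 + D\<^sup>2" "psum 2 x = A ^ 4 + B ^ 4 + C ^ 4 + D ^ 4"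
        "(\<Prod>i\<in>UNIV. x $ i) = A * B * C * D"
        unfolding psum_def U A_def B_def C_def D_def using ds by simp_all
      have q: "mpoly_eval (?q i j k l) x = x $ i * x $ j + \<epsilon> * (x $ k * x $ l)" for i j k l
        by (simp add: mono_eval_add)
      have sq: "(X + \<epsilon> * Y)\<^sup>2 = X\<^sup>2 + Y\<^sup>2 + 2 * \<epsilon> * X * Y" for X Y
        using \<epsilon>(1) by (simp add: power2_sum power_mult_distrib)
      have K: "\<bar>\<gamma>\<bar> / 6 * (mpoly_eval (?q a b c d) x)\<^sup>2 + \<bar>\<gamma>\<bar> / 6 * (mpoly_eval (?q a c b d) x)\<^sup>2
          + \<bar>\<gamma>\<bar> / 6 * (mpoly_eval (?q a d b c) x)\<^sup>2
          = \<bar>\<gamma>\<bar> / 6 / 2 * ((psum 1 x)\<^sup>2 - psum 2 x) + \<bar>\<gamma>\<bar> * \<epsilon> * (A * B * C * D)"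
        unfolding q sq ps A_def[symmetric] B_def[symmetric] C_def[symmetric] D_def[symmetric]
        by (simp add: power2_eq_square power4_eq_xxxx algebra_simps)
      have G: "\<gamma> * (\<Prod>i\<in>UNIV. x $ i) = \<bar>\<gamma>\<bar> * \<epsilon> * (A * B * C * D)"
        using arg_cong[OF \<epsilon>(2), of "\<lambda>t. t * (A * B * C * D)"] unfolding ps(3) .
      show ?thesis unfolding K eval' G by (simp add: field_simps)
    qed
    ultimately show ?thesis by simp
  qed
  with form inv show ?thesis by (intro sos_D_formsI)
qed

section \<open>Symmetric quartics that are non-negative on the orthant\<close>

text \<open>The general symmetric quartic in the basis e_1^4, e_1^2 e_2, e_2^2, e_1 e_3. Only the
  last basis element vanishes on the faces of the orthant.\<close>

definition sym_quartic :: "real \<Rightarrow> real \<Rightarrow> real \<Rightarrow> real \<Rightarrow> real \<Rightarrow> real \<Rightarrow> real \<Rightarrow> real" where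
  "sym_quartic \<alpha> \<beta> \<gamma> \<delta> a b c = \<alpha> * (a + b + c) ^ 4 + \<beta> * ((a + b + c)\<^sup>2 * (a * b + b * c + c * a))
     + \<gamma> * (a * b + b * c + c * a)\<^sup>2 + \<delta> * ((a + b + c) * (a * b * c))"

text \<open>A certificate that becomes a sum of squares under a = x^2, b = y^2, c = z^2: the second
  and third terms are squares already, while e_1 e_3 and a b (a - b)^2 become sums of squares of
  monomials and of xy (x^2 - y^2).\<close>

definition octic_sos :: "real \<Rightarrow> real \<Rightarrow> real \<Rightarrow> real \<Rightarrow> bool" where
  "octic_sos \<alpha> \<beta> \<gamma> \<delta> \<longleftrightarrow> (\<exists>l v \<mu> \<kappa> p q. 0 \<le> l \<and> 0 \<le> v \<and> 0 \<le> \<mu> \<and> (\<forall>a b c.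
     sym_quartic \<alpha> \<beta> \<gamma> \<delta> a b c = l * ((a + b + c) * (a * b * c))
       + v * ((a + b + c)\<^sup>2 - \<kappa> * (a * b + b * c + c * a))\<^sup>2
       + ((a - b)\<^sup>2 * (p * (a + b) - q * c)\<^sup>2 + (b - c)\<^sup>2 * (p * (b + c) - q * a)\<^sup>2
          + (c - a)\<^sup>2 * (p * (c + a) - q * b)\<^sup>2)
       + \<mu> * (a * b * (a - b)\<^sup>2 + b * c * (b - c)\<^sup>2 + c * a * (c - a)\<^sup>2)))"

lemma octic_sos_add:
  assumes "octic_sos \<alpha> \<beta> \<gamma> (\<delta> - m)" "0 \<le> m"
  shows "octic_sos \<alpha> \<beta> \<gamma> \<delta>"
proof -
  from assms(1) obtain l v \<mu> \<kappa> p q where *: "0 \<le> l" "0 \<le> v" "0 \<le> \<mu>"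
    "\<And>a b c. sym_quartic \<alpha> \<beta> \<gamma> (\<delta> - m) a b c = l * ((a + b + c) * (a * b * c))
       + v * ((a + b + c)\<^sup>2 - \<kappa> * (a * b + b * c + c * a))\<^sup>2
       + ((a - b)\<^sup>2 * (p * (a + b) - q * c)\<^sup>2 + (b - c)\<^sup>2 * (p * (b + c) - q * a)\<^sup>2
          + (c - a)\<^sup>2 * (p * (c + a) - q * b)\<^sup>2)
       + \<mu> * (a * b * (a - b)\<^sup>2 + b * c * (b - c)\<^sup>2 + c * a * (c - a)\<^sup>2)"
    unfolding octic_sos_def by blast
  have "sym_quartic \<alpha> \<beta> \<gamma> \<delta> a b c = sym_quartic \<alpha> \<beta> \<gamma> (\<delta> - m) a b c + m * ((a + b + c) * (a * b * c))"
    for a b c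
    by (simp add: sym_quartic_def left_diff_distrib)
  then have "sym_quartic \<alpha> \<beta> \<gamma> \<delta> a b c = (l + m) * ((a + b + c) * (a * b * c))
       + v * ((a + b + c)\<^sup>2 - \<kappa> * (a * b + b * c + c * a))\<^sup>2
       + ((a - b)\<^sup>2 * (p * (a + b) - q * c)\<^sup>2 + (b - c)\<^sup>2 * (p * (b + c) - q * a)\<^sup>2
          + (c - a)\<^sup>2 * (p * (c + a) - q * b)\<^sup>2)
       + \<mu> * (a * b * (a - b)\<^sup>2 + b * c * (b - c)\<^sup>2 + c * a * (c - a)\<^sup>2)" for a b c
    unfolding *(4) by (simp add: distrib_right)
  moreover have "0 \<le> l + m" using * assms(2) by simp
  ultimately show ?thesis using *(2,3) unfolding octic_sos_def by blast
qed

text \<open>Evaluation at the balance point s = sqrt (C / A), where A s^2 = C. Adding e > 0 to both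
  coefficients keeps s defined and positive when A or C is zero; then e tends to 0.\<close>

lemma quadratic_nonneg_on_half_line:
  fixes A B C :: real
  assumes nn: "\<And>s. 0 < s \<Longrightarrow> 0 \<le> A * s\<^sup>2 + B * s + C" and AC: "0 \<le> A" "0 \<le> C"
  shows "0 \<le> B + 2 * sqrt (A * C)"
proof -
  have le: "0 \<le> B + 2 * sqrt ((A + e) * (C + e))" if "0 < e" for e
  proof -
    define s where "s = sqrt ((C + e) / (A + e))"
    have s: "0 < s" "s\<^sup>2 = (C + e) / (A + e)" using AC that by (auto simp: s_def)
    have r: "sqrt ((A + e) * (C + e)) = (A + e) * s"
    proof (rule real_sqrt_unique)
      show "((A + e) * s)\<^sup>2 = (A + e) * (C + e)"
        using AC that by (simp add: power_mult_distrib s(2)) (simp add: power2_eq_square)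
    qed (use AC that s in simp)
    have C: "C + e = (A + e) * s\<^sup>2" using AC that by (simp add: s(2))
    have "0 \<le> A * s\<^sup>2 + B * s + C" using s(1) by (rule nn)
    also have "\<dots> \<le> (A + e) * s\<^sup>2 + B * s + (C + e)" using that by (simp add: algebra_simps)
    also have "\<dots> = s * (B + 2 * ((A + e) * s))" unfolding C by (simp add: power2_eq_square algebra_simps)
    finally show ?thesis using s(1) unfolding r by (simp add: zero_le_mult_iff)
  qed
  have "((\<lambda>e. B + 2 * sqrt ((A + e) * (C + e))) \<longlongrightarrow> B + 2 * sqrt ((A + 0) * (C + 0))) (at_right 0)"
    by (intro tendsto_intros)
  then have "0 \<le> B + 2 * sqrt ((A + 0) * (C + 0))"
  proof (rule tendsto_lowerbound)
    show "\<forall>\<^sub>F e in at_right 0. 0 \<le> B + 2 * sqrt ((A + e) * (C + e))"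
      using le by (auto simp: eventually_at_right_field intro: exI[of _ 1])
  qed simp
  then show ?thesis by simp
qed

text \<open>
  On the plane \<open>(1, 1, s)\<close> a symmetric quartic vanishing at \<open>(1, 1, 1)\<close> is \<open>(s - 1)\<^sup>2\<close> times a
  quadratic polynomial, and it is determined by this quadratic.
\<close>

lemma octic_sos_zero_at_one:
  assumes d: "\<delta> = - 27 * \<alpha> - 9 * \<beta> - 3 * \<gamma>" and "0 \<le> \<alpha>"
    and nn: "\<And>s. 0 \<le> s \<Longrightarrow> 0 \<le> sym_quartic \<alpha> \<beta> \<gamma> \<delta> 1 1 s"
  shows "octic_sos \<alpha> \<beta> \<gamma> \<delta>"
proof -
  define B C where "B = 10 * \<alpha> + 2 * \<beta>" and "C = 16 * \<alpha> + 4 * \<beta> + \<gamma>"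
  have eq: "sym_quartic \<alpha> \<beta> \<gamma> \<delta> 1 1 s = (s - 1)\<^sup>2 * (\<alpha> * s\<^sup>2 + B * s + C)" for s
    unfolding sym_quartic_def d B_def C_def by (simp add: power2_eq_square power4_eq_xxxx algebra_simps)
  have pos: "0 \<le> \<alpha> * s\<^sup>2 + B * s + C" if "0 \<le> s" "s \<noteq> 1" for s
    using nn[OF that(1)] that unfolding eq by (simp add: zero_le_mult_iff)
  have "0 \<le> \<alpha> * 1\<^sup>2 + B * 1 + C"
  proof (rule tendsto_lowerbound)
    show "((\<lambda>s. \<alpha> * s\<^sup>2 + B * s + C) \<longlongrightarrow> \<alpha> * 1\<^sup>2 + B * 1 + C) (at_right 1)"
      by (intro tendsto_intros)
    show "\<forall>\<^sub>F s in at_right 1. 0 \<le> \<alpha> * s\<^sup>2 + B * s + C"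
      using pos by (auto simp: eventually_at_right_field intro: exI[of _ 2])
  qed simp
  with pos have "0 \<le> \<alpha> * s\<^sup>2 + B * s + C" if "0 < s" for s
    using that by (cases "s = 1") auto
  moreover have C: "0 \<le> C" using pos[of 0] by simp
  ultimately have "0 \<le> B + 2 * sqrt (\<alpha> * C)"
    using \<open>0 \<le> \<alpha>\<close> by (intro quadratic_nonneg_on_half_line)
  \<comment> \<open>At (1, 1, s) the squares with p = P, q = P + R give 2 (s - 1)^2 (P s - R)^2 and
    the \<mu>-part gives 2 \<mu> s (s - 1)^2. Comparing with \<alpha> s^2 + B s + C determines all
    three; \<mu> >= 0 is the bound on B just obtained.\<close>
  define P R \<mu> where "P = sqrt (\<alpha> / 2)" and "R = sqrt (C / 2)" and "\<mu> = (B + 4 * (P * R)) / 2"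
  have PR: "P\<^sup>2 = \<alpha> / 2" "R\<^sup>2 = C / 2" using \<open>0 \<le> \<alpha>\<close> C by (simp_all add: P_def R_def)
  have "4 * (P * R) = 2 * sqrt (\<alpha> * C)"
    unfolding P_def R_def by (simp add: real_sqrt_mult real_sqrt_divide)
  with \<open>0 \<le> B + 2 * sqrt (\<alpha> * C)\<close> have "0 \<le> \<mu>" by (simp add: \<mu>_def)
  have \<alpha>: "\<alpha> = 2 * P\<^sup>2" using PR by simp
  have \<beta>: "\<beta> = \<mu> - 2 * (P * R) - 10 * P\<^sup>2" unfolding \<mu>_def B_def \<alpha> by (simp add: field_simps)
  have \<gamma>: "\<gamma> = 2 * R\<^sup>2 - 32 * P\<^sup>2 - 4 * \<beta>" using PR(2) unfolding C_def \<alpha> by simp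
  have "sym_quartic \<alpha> \<beta> \<gamma> \<delta> a b c = 0 * ((a + b + c) * (a * b * c))
       + 0 * ((a + b + c)\<^sup>2 - 0 * (a * b + b * c + c * a))\<^sup>2
       + ((a - b)\<^sup>2 * (P * (a + b) - (P + R) * c)\<^sup>2 + (b - c)\<^sup>2 * (P * (b + c) - (P + R) * a)\<^sup>2
          + (c - a)\<^sup>2 * (P * (c + a) - (P + R) * b)\<^sup>2)
       + \<mu> * (a * b * (a - b)\<^sup>2 + b * c * (b - c)\<^sup>2 + c * a * (c - a)\<^sup>2)" for a b c
    unfolding sym_quartic_def d \<gamma> \<beta> \<alpha> by algebra
  then show ?thesis unfolding octic_sos_def using \<open>0 \<le> \<mu>\<close> by (meson order_refl)
qed

text \<open>
  The symmetric quartics with a double zero at \<open>(1, 1, s)\<close> form a plane, spanned by the square of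
  \<open>e\<^sub>1\<^sup>2 - \<kappa> e\<^sub>2\<close> and by \<open>T = \<Sum>(a - b)\<^sup>2 (a + b - t c)\<^sup>2\<close>. Evaluating at \<open>(1, 1, 1)\<close>, where \<open>T\<close> vanishes,
  and at the second zero of the square shows that both coefficients are non-negative.
\<close>

lemma octic_sos_double_zero:
  assumes s: "0 \<le> s" "s \<noteq> 1"
    and z: "sym_quartic \<alpha> \<beta> \<gamma> \<delta> 1 1 s = 0"
    and dz: "4 * \<alpha> * (2 + s) ^ 3 + \<beta> * (2 * (2 + s) * (1 + 2 * s) + 2 * (2 + s)\<^sup>2)
        + 4 * \<gamma> * (1 + 2 * s) + \<delta> * (2 + 2 * s) = 0"
    and nn: "\<And>s. 0 \<le> s \<Longrightarrow> 0 \<le> sym_quartic \<alpha> \<beta> \<gamma> \<delta> 1 1 s"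
    and nn0: "\<And>a b. 0 \<le> a \<Longrightarrow> 0 \<le> b \<Longrightarrow> 0 \<le> sym_quartic \<alpha> \<beta> \<gamma> \<delta> a b 0"
  shows "octic_sos \<alpha> \<beta> \<gamma> \<delta>"
proof -
  \<comment> \<open>Chosen to make e_1^2 - \<kappa> e_2 vanish at (1, 1, s). For T the matching
    parameter is t = 1 + s.\<close>
  define \<kappa> where "\<kappa> = (2 + s)\<^sup>2 / (1 + 2 * s)"
  have \<kappa>: "\<kappa> * (1 + 2 * s) = (2 + s)\<^sup>2" using s by (simp add: \<kappa>_def)
  have k3: "\<kappa> \<noteq> 3"
  proof
    assume "\<kappa> = 3"
    with \<kappa> have "(s - 1)\<^sup>2 = 0" by (simp add: power2_eq_square algebra_simps)
    with s show False by simp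
  qed
  \<comment> \<open>At (1, 1, 1) the square equals 9 (3 - \<kappa>)^2 and T is zero, which fixes v.
    Then u comes from the coefficient of a^4, which is 1 in the square and 2 in T.\<close>
  define v where "v = sym_quartic \<alpha> \<beta> \<gamma> \<delta> 1 1 1 / (9 * (3 - \<kappa>)\<^sup>2)"
  have "0 \<le> v" unfolding v_def using nn[of 1] by simp
  have v: "81 * \<alpha> + 27 * \<beta> + 9 * \<gamma> + 3 * \<delta> = v * (9 * (3 - \<kappa>)\<^sup>2)"
    using k3 by (simp add: v_def sym_quartic_def)
  define u where "u = (\<alpha> - v) / 2"
  \<comment> \<open>What is left of the other three coefficients. The value at (1, 1, 1), the zero
    at (1, 1, s) and its being double are three linear conditions that make them vanish.\<close>
  define b g d where "b = \<beta> - (u * (- 2 * s - 10) - 2 * \<kappa> * v)"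
    and "g = \<gamma> - (u * (2 * s\<^sup>2 + 8 * s + 8) + \<kappa>\<^sup>2 * v)" and "d = \<delta> - u * (- 6 * s\<^sup>2 - 6 * s + 12)"
  have \<alpha>: "\<alpha> = 2 * u + v" by (simp add: u_def field_simps)
  have \<beta>: "\<beta> = b + (u * (- 2 * s - 10) - 2 * \<kappa> * v)" by (simp add: b_def)
  have \<gamma>: "\<gamma> = g + (u * (2 * s\<^sup>2 + 8 * s + 8) + \<kappa>\<^sup>2 * v)" by (simp add: g_def)
  have \<delta>: "\<delta> = d + u * (- 6 * s\<^sup>2 - 6 * s + 12)" by (simp add: d_def)
  have e1: "d = - 9 * b - 3 * g"
    using v unfolding \<alpha> \<beta> \<gamma> \<delta> by (simp add: power2_eq_square algebra_simps)
  have e2: "(s - 1)\<^sup>2 * (2 * b * (s + 2) + g) = 0"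
  proof -
    have "0 = sym_quartic \<alpha> \<beta> \<gamma> \<delta> 1 1 s" using z by simp
    also have "\<dots> = v * ((2 + s)\<^sup>2 - \<kappa> * (1 + 2 * s))\<^sup>2 + (s - 1)\<^sup>2 * (2 * b * (s + 2) + g)"
      unfolding sym_quartic_def \<alpha> \<beta> \<gamma> \<delta> e1 by (simp add: power2_eq_square power4_eq_xxxx algebra_simps)
    finally show ?thesis by (simp add: \<kappa>)
  qed
  then have e2': "g = - 2 * b * (s + 2)" using s by simp
  \<comment> \<open>The hypothesis \<open>dz\<close> is the derivative with respect to s of the
    quartic at (1, 1, s).\<close>
  have "0 = 4 * \<alpha> * (2 + s) ^ 3 + \<beta> * (2 * (2 + s) * (1 + 2 * s) + 2 * (2 + s)\<^sup>2)
        + 4 * \<gamma> * (1 + 2 * s) + \<delta> * (2 + 2 * s)" using dz by simp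
  also have "\<dots> = 4 * v * ((2 + s)\<^sup>2 - \<kappa> * (1 + 2 * s)) * ((2 + s) - \<kappa>) + 2 * b * (s - 1)\<^sup>2"
    unfolding \<alpha> \<beta> \<gamma> \<delta> e1 e2' by (simp add: power2_eq_square power3_eq_cube algebra_simps)
  finally have "b = 0" using s by (simp add: \<kappa>)
  with e1 e2' have bgd: "b = 0" "g = 0" "d = 0" by simp_all
  have rep: "sym_quartic \<alpha> \<beta> \<gamma> \<delta> a b c = v * ((a + b + c)\<^sup>2 - \<kappa> * (a * b + b * c + c * a))\<^sup>2
     + u * ((a - b)\<^sup>2 * ((a + b) - (1 + s) * c)\<^sup>2 + (b - c)\<^sup>2 * ((b + c) - (1 + s) * a)\<^sup>2
        + (c - a)\<^sup>2 * ((c + a) - (1 + s) * b)\<^sup>2)" for a b c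
    unfolding sym_quartic_def \<alpha> \<beta> \<gamma> \<delta> bgd by algebra
  have "0 \<le> u"
  proof (cases "s \<le> 2 * \<kappa> - 4")
    case True
    \<comment> \<open>By Vieta the other root of (2 + x)^2 - \<kappa> (1 + 2 x), whose roots sum to
      2 \<kappa> - 4.\<close>
    define s1 where "s1 = 2 * \<kappa> - 4 - s"
    have "(2 + s1)\<^sup>2 - \<kappa> * (1 + 2 * s1) = (2 + s)\<^sup>2 - \<kappa> * (1 + 2 * s)"
      unfolding s1_def by (simp add: power2_eq_square algebra_simps)
    then have q0: "(2 + s1)\<^sup>2 - \<kappa> * (1 + 2 * s1) = 0" by (simp add: \<kappa>)
    have "s1 \<noteq> 1"
    proof
      assume "s1 = 1"
      with q0 k3 show False by simp
    qed
    moreover have "s1 \<noteq> s"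
    proof
      assume "s1 = s"
      then have "\<kappa> = s + 2" by (simp add: s1_def)
      with \<kappa> have "(s - 1) * (s + 2) = 0" by (simp add: power2_eq_square algebra_simps)
      with s show False by simp
    qed
    moreover have "0 \<le> s1" using True by (simp add: s1_def)
    then have "0 \<le> sym_quartic \<alpha> \<beta> \<gamma> \<delta> 1 1 s1" by (rule nn)
    moreover have "sym_quartic \<alpha> \<beta> \<gamma> \<delta> 1 1 s1 =
        v * ((2 + s1)\<^sup>2 - \<kappa> * (1 + 2 * s1))\<^sup>2 + u * (2 * ((s1 - 1) * (s1 - s))\<^sup>2)"
      unfolding rep by (simp add: power2_eq_square algebra_simps)
    ultimately show ?thesis by (simp add: q0 zero_le_mult_iff)
  next
    case False
    \<comment> \<open>The second root is negative here, so the product 4 - \<kappa> of the roots is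
      negative too (s = 0 would make the second root 4). The square then has a zero on the face c =
      0 instead.\<close>
    have "4 < \<kappa>"
    proof (rule ccontr)
      assume "\<not> 4 < \<kappa>"
      with \<kappa> have "(2 + s)\<^sup>2 \<le> 4 * (1 + 2 * s)" using s by (metis add_nonneg_nonneg mult_right_mono not_less zero_le_numeral zero_le_one mult_nonneg_nonneg)
      then have "s * s \<le> s * 4" by (simp add: power2_eq_square algebra_simps)
      then have "s \<le> 4" using s by (cases "s = 0") auto
      have "(1 + 2 * s) * (2 * \<kappa> - 4 - s) = 2 * (2 + s)\<^sup>2 - (4 + s) * (1 + 2 * s)"
        using \<kappa> by (simp add: algebra_simps)
      also have "\<dots> = 4 - s" by (simp add: power2_eq_square algebra_simps)
      finally have "0 \<le> (1 + 2 * s) * (2 * \<kappa> - 4 - s)" using \<open>s \<le> 4\<close> by simp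
      with s False show False by (simp add: zero_le_mult_iff)
    qed
    \<comment> \<open>Makes \<open>?a\<close> and \<open>?b\<close> the roots of X^2 - X + 1 /
      \<kappa>, so that e_1^2 = \<kappa> e_2 at (\<open>?a\<close>, \<open>?b\<close>, 0).\<close>
    define r where "r = sqrt (1 - 4 / \<kappa>)"
    have r2: "r\<^sup>2 = 1 - 4 / \<kappa>" "0 < r" using \<open>4 < \<kappa>\<close> by (simp_all add: r_def)
    have "r \<le> 1" using \<open>4 < \<kappa>\<close> by (simp add: r_def)
    let ?a = "(1 + r) / 2" and ?b = "(1 - r) / 2"
    have N: "0 \<le> sym_quartic \<alpha> \<beta> \<gamma> \<delta> ?a ?b 0" using r2 \<open>r \<le> 1\<close> by (intro nn0) auto
    have Z: "(?a + ?b + 0)\<^sup>2 - \<kappa> * (?a * ?b + ?b * 0 + 0 * ?a) = 0"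
    proof -
      have "?a * ?b = (1 - r\<^sup>2) / 4" by (simp add: power2_eq_square field_simps)
      also have "\<dots> = 1 / \<kappa>" by (simp add: r2)
      finally show ?thesis using \<open>4 < \<kappa>\<close> by (simp add: field_simps)
    qed
    have "0 \<le> u * ((?a - ?b)\<^sup>2 * ((?a + ?b) - (1 + s) * 0)\<^sup>2 + (?b - 0)\<^sup>2 * ((?b + 0) - (1 + s) * ?a)\<^sup>2
        + (0 - ?a)\<^sup>2 * ((0 + ?a) - (1 + s) * ?b)\<^sup>2)"
      using N unfolding rep Z by simp
    moreover have "0 < (?a - ?b)\<^sup>2 * ((?a + ?b) - (1 + s) * 0)\<^sup>2 + (?b - 0)\<^sup>2 * ((?b + 0) - (1 + s) * ?a)\<^sup>2
        + (0 - ?a)\<^sup>2 * ((0 + ?a) - (1 + s) * ?b)\<^sup>2"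
    proof -
      have "?a - ?b = r" "?a + ?b = 1" by (simp_all add: field_simps)
      then have "0 < (?a - ?b)\<^sup>2 * ((?a + ?b) - (1 + s) * 0)\<^sup>2" using r2(2) by simp
      then show ?thesis by (intro add_pos_nonneg) auto
    qed
    ultimately show ?thesis by (simp only: zero_le_mult_iff) linarith
  qed
  then have u: "(sqrt u)\<^sup>2 = u" by simp
  have "sym_quartic \<alpha> \<beta> \<gamma> \<delta> a b c = 0 * ((a + b + c) * (a * b * c))
       + v * ((a + b + c)\<^sup>2 - \<kappa> * (a * b + b * c + c * a))\<^sup>2
       + ((a - b)\<^sup>2 * (sqrt u * (a + b) - sqrt u * (1 + s) * c)\<^sup>2 + (b - c)\<^sup>2 * (sqrt u * (b + c) - sqrt u * (1 + s) * a)\<^sup>2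
          + (c - a)\<^sup>2 * (sqrt u * (c + a) - sqrt u * (1 + s) * b)\<^sup>2)
       + 0 * (a * b * (a - b)\<^sup>2 + b * c * (b - c)\<^sup>2 + c * a * (c - a)\<^sup>2)" for a b c
  proof -
    have e: "(sqrt u * X - sqrt u * (1 + s) * Y)\<^sup>2 = u * (X - (1 + s) * Y)\<^sup>2" for X Y
      by (subst u[symmetric]) (simp add: power_mult_distrib[symmetric] algebra_simps)
    show ?thesis unfolding rep e by (simp add: algebra_simps)
  qed
  then show ?thesis unfolding octic_sos_def using \<open>0 \<le> v\<close> by (meson order_refl)
qed

section \<open>The largest multiple of e_1 e_3 that can be subtracted\<close>

lemma coercive_attains_inf:
  fixes f g :: "real \<Rightarrow> real"
  assumes cont: "continuous_on {0<..} f"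
    and small: "\<And>K. \<exists>e>0. \<forall>s. 0 < s \<and> s < e \<longrightarrow> K \<le> f s"
    and large: "\<And>K. \<exists>M. \<forall>s>M. K \<le> f s"
  obtains s where "0 < s" "\<And>t. 0 < t \<Longrightarrow> f s \<le> f t"
proof -
  obtain e where e: "0 < e" "\<And>s. 0 < s \<Longrightarrow> s < e \<Longrightarrow> f 1 \<le> f s" using small by blast
  obtain M where M: "\<And>s. M < s \<Longrightarrow> f 1 \<le> f s" using large by blast
  define I where "I = {min e 1..max M 1}"
  have "compact I" "I \<noteq> {}" "1 \<in> I" by (auto simp: I_def)
  moreover have "continuous_on I f"
    by (rule continuous_on_subset[OF cont]) (use e in \<open>auto simp: I_def\<close>)
  ultimately obtain s where s: "s \<in> I" "\<And>t. t \<in> I \<Longrightarrow> f s \<le> f t"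
    using continuous_attains_inf[of I f] by blast
  have "f s \<le> f t" if "0 < t" for t
  proof (cases "t \<in> I")
    case False
    then have "t < min e 1 \<or> max M 1 < t" by (auto simp: I_def)
    then have "f 1 \<le> f t" using e(2)[of t] M[of t] that by auto
    then show ?thesis using s(2)[OF \<open>1 \<in> I\<close>] by simp
  qed (use s in auto)
  moreover have "0 < s" using s e by (auto simp: I_def)
  ultimately show ?thesis using that by blast
qed

lemma coercive_quartic:
  fixes a b c d e :: real
  assumes "0 < a \<or> a = 0 \<and> 0 < b"
  shows "\<exists>M. \<forall>s>M. 0 \<le> a * s ^ 4 + b * s ^ 3 + c * s\<^sup>2 + d * s + e"
proof -
  have "\<forall>\<^sub>F s in at_top. 0 < a * s ^ 4 + b * s ^ 3 + c * s\<^sup>2 + d * s + e"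
  proof (cases "0 < a")
    case True
    then show ?thesis by real_asymp
  next
    case False
    with assms have "0 < b" "a = 0" by auto
    then show ?thesis by simp real_asymp
  qed
  then obtain M where "\<And>s. M \<le> s \<Longrightarrow> 0 < a * s ^ 4 + b * s ^ 3 + c * s\<^sup>2 + d * s + e"
    by (auto simp: eventually_at_top_linorder)
  then show ?thesis by (intro exI[of _ M]) (auto intro: less_imp_le)
qed

lemma sym_quartic_11:
  "sym_quartic \<alpha> \<beta> \<gamma> \<delta> 1 1 s = \<alpha> * s ^ 4 + (8 * \<alpha> + 2 * \<beta>) * s ^ 3 + (24 * \<alpha> + 9 * \<beta> + 4 * \<gamma> + \<delta>) * s\<^sup>2
     + (32 * \<alpha> + 12 * \<beta> + 4 * \<gamma> + 2 * \<delta>) * s + (16 * \<alpha> + 4 * \<beta> + \<gamma>)"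
  unfolding sym_quartic_def by (simp add: power2_eq_square power3_eq_cube power4_eq_xxxx algebra_simps)

lemma nonneg_sym_quartic_octic_sos:
  assumes nn: "\<And>a b c. 0 \<le> a \<Longrightarrow> 0 \<le> b \<Longrightarrow> 0 \<le> c \<Longrightarrow> 0 \<le> sym_quartic \<alpha> \<beta> \<gamma> \<delta> a b c"
  shows "octic_sos \<alpha> \<beta> \<gamma> \<delta>"
proof -
  have "0 \<le> \<alpha>" using nn[of 1 0 0] by (simp add: sym_quartic_def)
  have \<beta>0: "0 \<le> \<beta>" if "\<alpha> = 0"
  proof (rule tendsto_lowerbound)
    show "((\<lambda>s. \<beta> * (1 + s)\<^sup>2 + \<gamma> * s) \<longlongrightarrow> \<beta>) (at_right 0)"
      by (rule tendsto_eq_intros refl | simp)+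
    have "0 \<le> \<beta> * (1 + s)\<^sup>2 + \<gamma> * s" if "0 < s" for s
    proof -
      have "sym_quartic \<alpha> \<beta> \<gamma> \<delta> 1 s 0 = s * (\<beta> * (1 + s)\<^sup>2 + \<gamma> * s)"
        using \<open>\<alpha> = 0\<close> by (simp add: sym_quartic_def power2_eq_square algebra_simps)
      then show ?thesis using nn[of 1 s 0] that by (simp add: zero_le_mult_iff)
    qed
    then show "\<forall>\<^sub>F s in at_right 0. 0 \<le> \<beta> * (1 + s)\<^sup>2 + \<gamma> * s"
      by (auto simp: eventually_at_right_field intro: exI[of _ 1])
  qed simp
  show ?thesis
  proof (cases "\<alpha> = 0 \<and> \<beta> = 0")
    case True
    \<comment> \<open>Here no minimum need be attained. The decomposition rests on e_2^2 - 3 e_1 e_3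
      being half the sum of c^2 (a - b)^2 over the three variables.\<close>
    have "0 \<le> \<gamma>" using nn[of 1 1 0] True by (simp add: sym_quartic_def)
    moreover have "0 \<le> 3 * \<gamma> + \<delta>" using nn[of 1 1 1] True by (simp add: sym_quartic_def)
    moreover have "sym_quartic \<alpha> \<beta> \<gamma> \<delta> a b c = (3 * \<gamma> + \<delta>) * ((a + b + c) * (a * b * c))
       + 0 * ((a + b + c)\<^sup>2 - 0 * (a * b + b * c + c * a))\<^sup>2
       + ((a - b)\<^sup>2 * (0 * (a + b) - sqrt (\<gamma> / 2) * c)\<^sup>2 + (b - c)\<^sup>2 * (0 * (b + c) - sqrt (\<gamma> / 2) * a)\<^sup>2
          + (c - a)\<^sup>2 * (0 * (c + a) - sqrt (\<gamma> / 2) * b)\<^sup>2)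
       + 0 * (a * b * (a - b)\<^sup>2 + b * c * (b - c)\<^sup>2 + c * a * (c - a)\<^sup>2)" for a b c
      using True \<open>0 \<le> \<gamma>\<close>
      by (simp add: power_mult_distrib sym_quartic_def) (simp add: power2_eq_square field_simps)
    ultimately show ?thesis unfolding octic_sos_def by (meson order_refl)
  next
    case False
    then have lead: "0 < \<alpha> \<or> \<alpha> = 0 \<and> 0 < \<beta>" using \<open>0 \<le> \<alpha>\<close> \<beta>0 by force
    let ?f = "\<lambda>s. sym_quartic \<alpha> \<beta> \<gamma> \<delta> 1 1 s"
    have f0: "0 \<le> ?f s" if "0 \<le> s" for s using nn[of 1 1 s] that by simp
    let ?e = "\<lambda>s::real. s * (s + 2)"
    have sub: "sym_quartic \<alpha> \<beta> \<gamma> (\<delta> - m) 1 1 s = ?f s - m * ?e s" for m s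
      by (simp add: sym_quartic_def algebra_simps)
    have coer: "\<exists>M. \<forall>s>M. 0 \<le> ?f s - m * ?e s" for m
      unfolding sub[symmetric] unfolding sym_quartic_11 using lead by (intro coercive_quartic) auto
    \<comment> \<open>At (1, 1, s) the value of e_1 e_3 is \<open>?e s\<close>; m is the minimum of
      \<open>?f s / ?e s\<close>, attained at s. The derivative condition is recorded for s = 0
      because a minimum at an endpoint does not imply it.\<close>
    obtain m s where ms: "0 \<le> m" "0 \<le> s" "\<And>t. 0 \<le> t \<Longrightarrow> 0 \<le> ?f t - m * ?e t" "?f s - m * ?e s = 0"
      "s = 0 \<Longrightarrow> 32 * \<alpha> + 12 * \<beta> + 4 * \<gamma> + 2 * (\<delta> - m) = 0"
    proof (cases "?f 0 = 0")
      case False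
      \<comment> \<open>The ratio tends to infinity at both ends of the half-line, so its minimum is
        attained at some s > 0.\<close>
      then have pos: "0 < ?f 0" using f0[of 0] by simp
      let ?h = "\<lambda>s. ?f s / ?e s"
      have hle: "m \<le> ?h s \<longleftrightarrow> 0 \<le> ?f s - m * ?e s" if "0 < s" for m s
        using that by (simp add: pos_le_divide_eq)
      obtain s where s: "0 < s" "\<And>t. 0 < t \<Longrightarrow> ?h s \<le> ?h t"
      proof (rule coercive_attains_inf[of ?h])
        show "continuous_on {0<..} ?h"
          unfolding sym_quartic_def by (intro continuous_intros) auto
        show "\<exists>e>0. \<forall>s. 0 < s \<and> s < e \<longrightarrow> K \<le> ?h s" for K
        proof -
          have "((\<lambda>s. ?f s - K * ?e s) \<longlongrightarrow> ?f 0 - K * ?e 0) (at_right 0)"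
            unfolding sym_quartic_def by (intro tendsto_intros)
          then have "\<forall>\<^sub>F s in at_right 0. 0 < ?f s - K * ?e s"
            using pos by (intro order_tendstoD) auto
          then obtain e where "0 < e" "\<And>s. 0 < s \<Longrightarrow> s < e \<Longrightarrow> 0 < ?f s - K * ?e s"
            by (auto simp: eventually_at_right_field)
          then show ?thesis using hle by (intro exI[of _ e]) (auto intro: less_imp_le)
        qed
        show "\<exists>M. \<forall>s>M. K \<le> ?h s" for K
        proof -
          obtain M where "\<And>s. M < s \<Longrightarrow> 0 \<le> ?f s - K * ?e s" using coer by blast
          then show ?thesis using hle by (intro exI[of _ "max M 0"]) auto
        qed
      qed (rule that)
      have m0: "0 \<le> ?h s" using f0[of s] s(1) by simp
      have "0 \<le> ?f t - ?h s * ?e t" if "0 \<le> t" for t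
      proof (cases "t = 0")
        case True
        then show ?thesis using pos by simp
      next
        case False
        then show ?thesis using s(2)[of t] hle[of t "?h s"] that by simp
      qed
      moreover have "?f s - ?h s * ?e s = 0" using s(1) by simp
      ultimately show ?thesis using s(1) m0 by (intro that[of "?h s" s]) auto
    next
      case True
      \<comment> \<open>Cancelling s extends the ratio continuously to 0. If the minimum lies there,
        then \<open>\<psi> 0 = 2 * m\<close>, which is the derivative condition.\<close>
      then have c0: "16 * \<alpha> + 4 * \<beta> + \<gamma> = 0" unfolding sym_quartic_11 by simp
      define \<psi> where "\<psi> s = \<alpha> * s ^ 3 + (8 * \<alpha> + 2 * \<beta>) * s\<^sup>2 + (24 * \<alpha> + 9 * \<beta> + 4 * \<gamma> + \<delta>) * s
          + (32 * \<alpha> + 12 * \<beta> + 4 * \<gamma> + 2 * \<delta>)" for s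
      have \<psi>: "?f s = s * \<psi> s" for s
        unfolding sym_quartic_11 c0 \<psi>_def by (simp add: power2_eq_square power3_eq_cube power4_eq_xxxx algebra_simps)
      have \<psi>pos: "0 \<le> \<psi> s" if "0 < s" for s
        using f0[of s] that unfolding \<psi> by (simp add: zero_le_mult_iff)
      have "0 \<le> \<psi> 0"
      proof (rule tendsto_lowerbound)
        show "(\<psi> \<longlongrightarrow> \<psi> 0) (at_right 0)" unfolding \<psi>_def by (intro tendsto_intros)
        show "\<forall>\<^sub>F s in at_right 0. 0 \<le> \<psi> s"
          using \<psi>pos by (auto simp: eventually_at_right_field intro: exI[of _ 1])
      qed simp
      with \<psi>pos have \<psi>nn: "0 \<le> \<psi> s" if "0 \<le> s" for s using that by (cases "s = 0") auto
      let ?h = "\<lambda>s. \<psi> s / (s + 2)"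
      obtain M where M: "\<And>s. M < s \<Longrightarrow> 0 \<le> ?f s - ?h 0 * ?e s" using coer by blast
      define I where "I = {0..max M 0}"
      have "compact I" "I \<noteq> {}" "0 \<in> I" by (auto simp: I_def)
      moreover have "continuous_on I ?h"
        unfolding \<psi>_def I_def by (intro continuous_intros) auto
      ultimately obtain s where s: "s \<in> I" "\<And>t. t \<in> I \<Longrightarrow> ?h s \<le> ?h t"
        using continuous_attains_inf[of I ?h] by blast
      have s0: "0 \<le> s" using s by (simp add: I_def)
      have min: "?h s \<le> ?h t" if "0 \<le> t" for t
      proof (cases "t \<in> I")
        case False
        then have "M < t" "0 < t" using that by (auto simp: I_def)
        have "0 \<le> t * (\<psi> t - ?h 0 * (t + 2))"
          using M[OF \<open>M < t\<close>] unfolding \<psi> by (simp add: right_diff_distrib mult_ac)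
        then have "?h 0 * (t + 2) \<le> \<psi> t" using \<open>0 < t\<close> by (simp only: zero_le_mult_iff) linarith
        then have "?h 0 \<le> ?h t" using \<open>0 < t\<close> by (simp only: pos_le_divide_eq add_pos_pos zero_less_numeral)
        then show ?thesis using s(2)[OF \<open>0 \<in> I\<close>] by linarith
      qed (use s in auto)
      show ?thesis
      proof (rule that[of "?h s" s])
        show "0 \<le> ?h s" using s0 \<psi>nn by simp
        show "0 \<le> ?f t - ?h s * ?e t" if "0 \<le> t" for t
        proof -
          have "?h s * (t + 2) \<le> \<psi> t" using min[OF that] that by (simp only: pos_le_divide_eq add_nonneg_pos zero_less_numeral)
          then have "0 \<le> t * (\<psi> t - ?h s * (t + 2))" using that by (intro mult_nonneg_nonneg) auto
          then show ?thesis unfolding \<psi> by (simp only: right_diff_distrib mult.left_commute)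
        qed
        show "?f s - ?h s * ?e s = 0" unfolding \<psi> using s0 by simp
        show "32 * \<alpha> + 12 * \<beta> + 4 * \<gamma> + 2 * (\<delta> - ?h s) = 0" if "s = 0"
          using that by (simp add: \<psi>_def field_simps)
      qed (use s0 in simp)
    qed
    let ?\<delta> = "\<delta> - m"
    have nn1: "0 \<le> sym_quartic \<alpha> \<beta> \<gamma> ?\<delta> 1 1 t" if "0 \<le> t" for t
      using ms(3)[OF that] by (simp add: sub)
    have "octic_sos \<alpha> \<beta> \<gamma> ?\<delta>"
    \<comment> \<open>By symmetry a zero at (1, 1, 1) is automatically double along (1, 1, s), so it
      imposes one linear condition instead of two and needs the larger family with the
      \<mu>-term.\<close>
    proof (cases "s = 1")
      case True
      then have "sym_quartic \<alpha> \<beta> \<gamma> ?\<delta> 1 1 1 = 0" using ms(4) by (simp add: sub)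
      then have "?\<delta> = - 27 * \<alpha> - 9 * \<beta> - 3 * \<gamma>" unfolding sym_quartic_11 by simp
      then show ?thesis using \<open>0 \<le> \<alpha>\<close> nn1 by (rule octic_sos_zero_at_one)
    next
      case False
      let ?F = "\<lambda>t. sym_quartic \<alpha> \<beta> \<gamma> ?\<delta> 1 1 t"
      let ?D = "4 * \<alpha> * (2 + s) ^ 3 + \<beta> * (2 * (2 + s) * (1 + 2 * s) + 2 * (2 + s)\<^sup>2)
        + 4 * \<gamma> * (1 + 2 * s) + ?\<delta> * (2 + 2 * s)"
      have z: "?F s = 0" using ms(4) by (simp add: sub)
      have "?D = 0"
      proof (cases "s = 0")
        case True
        then show ?thesis using ms(5) by simp
      next
        case False
        with ms(2) have "0 < s" by simp
        have "(?F has_real_derivative ?D) (at s)"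
          unfolding sym_quartic_11
          by (rule derivative_eq_intros refl)+ (simp add: power2_eq_square power3_eq_cube algebra_simps)
        then show ?thesis
        proof (rule DERIV_local_min[OF _ \<open>0 < s\<close>])
          show "\<forall>y. \<bar>s - y\<bar> < s \<longrightarrow> ?F s \<le> ?F y"
            using nn1 unfolding z by auto
        qed
      qed
      \<comment> \<open>On c = 0 the coefficient of e_1 e_3 has no influence, so non-negativity
        survives the subtraction.\<close>
      moreover have "0 \<le> sym_quartic \<alpha> \<beta> \<gamma> ?\<delta> a b 0" if "0 \<le> a" "0 \<le> b" for a b
        using nn[OF that order_refl] by (simp add: sym_quartic_def)
      ultimately show ?thesis
        using octic_sos_double_zero[OF ms(2) False z _ nn1] by blast
    qed
    then show ?thesis using ms(1) by (rule octic_sos_add)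
  qed
qed

section \<open>Ternary octics\<close>

lemma sum_simplex4:
  fixes f :: "nat \<Rightarrow> nat \<Rightarrow> 'a::comm_monoid_add"
  shows "(\<Sum>i\<le>4. \<Sum>j\<le>4 - i. f i j) = (f 0 0 + f 0 1 + f 0 2 + f 0 3 + f 0 4) + (f 1 0 + f 1 1 + f 1 2 + f 1 3)
    + (f 2 0 + f 2 1 + f 2 2) + (f 3 0 + f 3 1) + f 4 0"
  by (simp add: eval_nat_numeral)

lemma invariant_octic_eval:
  fixes p :: "'n::finite real_mpoly"
  assumes U: "(UNIV :: 'n set) = {u, v, w}" and ne: "u \<noteq> v" "u \<noteq> w" "v \<noteq> w"
    and form: "is_form 8 p" and inv: "D_invariant p"
  obtains \<alpha> \<beta> \<gamma> \<delta> where "\<And>x. mpoly_eval p x = sym_quartic \<alpha> \<beta> \<gamma> \<delta> ((x $ u)\<^sup>2) ((x $ v)\<^sup>2) ((x $ w)\<^sup>2)"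
proof -
  define mk where "mk i j k = Poly_Mapping.single u (2 * i) + Poly_Mapping.single v (2 * j) + Poly_Mapping.single w (2 * k)"
    for i j k :: nat
  have lookup_mk: "Poly_Mapping.lookup (mk i j k) u = 2 * i" "Poly_Mapping.lookup (mk i j k) v = 2 * j"
    "Poly_Mapping.lookup (mk i j k) w = 2 * k" for i j k
    using ne by (simp_all add: mk_def lookup_add lookup_single)
  have eqI: "m = m'" if "Poly_Mapping.lookup m u = Poly_Mapping.lookup m' u"
    "Poly_Mapping.lookup m v = Poly_Mapping.lookup m' v" "Poly_Mapping.lookup m w = Poly_Mapping.lookup m' w"
    for m m' :: "'n \<Rightarrow>\<^sub>0 nat"
  proof (rule poly_mapping_eqI)
    fix l
    have "l \<in> {u, v, w}" using U by blast
    with that show "Poly_Mapping.lookup m l = Poly_Mapping.lookup m' l" by auto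
  qed
  define G where "G i j k = Poly_Mapping.lookup p (mk i j k)" for i j k
  have "swap_vars u v (mk i j k) = mk j i k" "swap_vars v w (mk i j k) = mk i k j" for i j k
    using ne by (auto intro!: eqI simp: lookup_mk Transposition.transpose_def)
  then have G: "G j i k = G i j k" "G i k j = G i j k" for i j k
    unfolding G_def using lookup_swap_vars_invariant[OF inv] by metis+
  define I where "I = Sigma {..4} (\<lambda>i. {..4 - i :: nat})"
  let ?mk = "\<lambda>(i, j). mk i j (4 - i - j)"
  have keys: "Poly_Mapping.keys p \<subseteq> ?mk ` I"
  proof
    fix m assume m: "m \<in> Poly_Mapping.keys p"
    have deg: "Poly_Mapping.lookup m u + Poly_Mapping.lookup m v + Poly_Mapping.lookup m w = 8"
      using form m ne unfolding is_form_def U by auto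
    have "even (Poly_Mapping.lookup m u) \<longleftrightarrow> even (Poly_Mapping.lookup m v)"
      "even (Poly_Mapping.lookup m u) \<longleftrightarrow> even (Poly_Mapping.lookup m w)"
      using lookup_invariant_parity[OF inv] m by (simp_all add: in_keys_iff)
    \<comment> \<open>Three odd exponents cannot add up to 8.\<close>
    with deg have "even (Poly_Mapping.lookup m u)" "even (Poly_Mapping.lookup m v)" "even (Poly_Mapping.lookup m w)"
      by presburger+
    then obtain i j k where ijk: "Poly_Mapping.lookup m u = 2 * i" "Poly_Mapping.lookup m v = 2 * j"
      "Poly_Mapping.lookup m w = 2 * k"
      by (elim evenE)
    with deg have "k = 4 - i - j" "i \<le> 4" "j \<le> 4 - i" by simp_all
    moreover have "m = mk i j k" using ijk by (intro eqI) (simp_all add: lookup_mk)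
    ultimately show "m \<in> ?mk ` I" by (auto simp: I_def)
  qed
  have inj: "inj_on ?mk I"
  proof (rule inj_onI, clarify)
    fix i j i' j' assume eq: "mk i j (4 - i - j) = mk i' j' (4 - i' - j')"
    show "i = i' \<and> j = j'"
      using arg_cong[OF eq, of "\<lambda>m. Poly_Mapping.lookup m u"] arg_cong[OF eq, of "\<lambda>m. Poly_Mapping.lookup m v"]
      by (simp add: lookup_mk)
  qed
  define A B C D where "A = G 4 0 0" and "B = G 3 1 0" and "C = G 2 2 0" and "D = G 2 1 1"
  \<comment> \<open>Change of basis from monomial symmetric polynomials, using e_1^4 = m_4 + 4 m_31
    + 6 m_22 + 12 m_211, e_1^2 e_2 = m_31 + 2 m_22 + 5 m_211 and e_2^2 = m_22 + 2 m_211.\<close>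
  have "mpoly_eval p x = sym_quartic A (B - 4 * A) (C + 2 * A - 2 * B) (D + 4 * A - B - 2 * C)
      ((x $ u)\<^sup>2) ((x $ v)\<^sup>2) ((x $ w)\<^sup>2)" for x
  proof -
    define a b c where "a = (x $ u)\<^sup>2" and "b = (x $ v)\<^sup>2" and "c = (x $ w)\<^sup>2"
    have mono: "mono_eval (mk i j k) x = a ^ i * b ^ j * c ^ k" for i j k
      by (simp add: mk_def mono_eval_add a_def b_def c_def power_mult)
    have "mpoly_eval p x = (\<Sum>(i, j)\<in>I. G i j (4 - i - j) * (a ^ i * b ^ j * c ^ (4 - i - j)))"
    proof -
      have "finite (?mk ` I)" by (simp add: I_def)
      then have "mpoly_eval p x = (\<Sum>m\<in>?mk ` I. Poly_Mapping.lookup p m * mono_eval m x)"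
        using keys by (rule mpoly_eval_superset)
      also have "\<dots> = (\<Sum>(i, j)\<in>I. G i j (4 - i - j) * (a ^ i * b ^ j * c ^ (4 - i - j)))"
        unfolding sum.reindex[OF inj] by (simp add: G_def mono case_prod_unfold o_def)
      finally show ?thesis .
    qed
    also have "\<dots> = (\<Sum>i\<le>4. \<Sum>j\<le>4 - i. G i j (4 - i - j) * (a ^ i * b ^ j * c ^ (4 - i - j)))"
      unfolding I_def by (rule sum.Sigma[symmetric]) auto
    also have "\<dots> = A * (a ^ 4 + b ^ 4 + c ^ 4) + B * (a ^ 3 * b + a * b ^ 3 + b ^ 3 * c + b * c ^ 3 + c ^ 3 * a + c * a ^ 3)
        + C * (a\<^sup>2 * b\<^sup>2 + b\<^sup>2 * c\<^sup>2 + c\<^sup>2 * a\<^sup>2) + D * (a\<^sup>2 * b * c + a * b\<^sup>2 * c + a * b * c\<^sup>2)"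
    proof -
      have perm: "G 0 0 4 = A" "G 0 4 0 = A" "G 4 0 0 = A"
        "G 0 1 3 = B" "G 0 3 1 = B" "G 1 0 3 = B" "G 1 3 0 = B" "G 3 0 1 = B" "G 3 1 0 = B"
        "G 0 2 2 = C" "G 2 0 2 = C" "G 2 2 0 = C" "G 1 1 2 = D" "G 1 2 1 = D" "G 2 1 1 = D"
        unfolding A_def B_def C_def D_def using G by metis+
      show ?thesis unfolding sum_simplex4 by (simp add: perm[unfolded One_nat_def] algebra_simps)
    qed
    also have "\<dots> = sym_quartic A (B - 4 * A) (C + 2 * A - 2 * B) (D + 4 * A - B - 2 * C) a b c"
      unfolding sym_quartic_def by algebra
    finally show ?thesis by (simp only: a_def b_def c_def)
  qed
  then show ?thesis by (rule that)
qed

lemma octic_psd_imp_sos: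
  assumes n: "CARD('n::finite) = 3" and p: "(p :: 'n real_mpoly) \<in> psd_D_forms 8"
  shows "p \<in> sos_D_forms 8"
proof -
  from p have form: "is_form 8 p" and inv: "D_invariant p" and nn: "\<And>x. 0 \<le> mpoly_eval p x"
    by (auto simp: psd_D_forms_def)
  obtain u v w where U: "(UNIV :: 'n set) = {u, v, w}" and ne: "u \<noteq> v" "u \<noteq> w" "v \<noteq> w"
    using n by (auto simp: card_3_iff)
  obtain \<alpha> \<beta> \<gamma> \<delta> where eval: "\<And>x. mpoly_eval p x = sym_quartic \<alpha> \<beta> \<gamma> \<delta> ((x $ u)\<^sup>2) ((x $ v)\<^sup>2) ((x $ w)\<^sup>2)"
    using invariant_octic_eval[OF U ne form inv] by metis
  have "0 \<le> sym_quartic \<alpha> \<beta> \<gamma> \<delta> a b c" if "0 \<le> a" "0 \<le> b" "0 \<le> c" for a b c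
  proof -
    let ?x = "\<chi> i. if i = u then sqrt a else if i = v then sqrt b else sqrt c"
    have "(?x $ u)\<^sup>2 = a" "(?x $ v)\<^sup>2 = b" "(?x $ w)\<^sup>2 = c" using that ne by simp_all
    then show ?thesis using nn[of ?x] unfolding eval by simp
  qed
  then have "octic_sos \<alpha> \<beta> \<gamma> \<delta>" by (rule nonneg_sym_quartic_octic_sos)
  then obtain l r \<mu> \<kappa> s t where nonneg: "0 \<le> l" "0 \<le> r" "0 \<le> \<mu>" and rep: "\<And>a b c.
     sym_quartic \<alpha> \<beta> \<gamma> \<delta> a b c = l * ((a + b + c) * (a * b * c))
       + r * ((a + b + c)\<^sup>2 - \<kappa> * (a * b + b * c + c * a))\<^sup>2
       + ((a - b)\<^sup>2 * (s * (a + b) - t * c)\<^sup>2 + (b - c)\<^sup>2 * (s * (b + c) - t * a)\<^sup>2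
          + (c - a)\<^sup>2 * (s * (c + a) - t * b)\<^sup>2)
       + \<mu> * (a * b * (a - b)\<^sup>2 + b * c * (b - c)\<^sup>2 + c * a * (c - a)\<^sup>2)"
    unfolding octic_sos_def by blast
  define X where "X i = (Poly_Mapping.single (Poly_Mapping.single i 1) 1 :: 'n real_mpoly)" for i
  define S where "S i = X i * X i" for i
  define K where "K c = (Poly_Mapping.single 0 c :: 'n real_mpoly)" for c
  have X: "is_form 1 (X i)" "mpoly_eval (X i) x = x $ i" for i x
    by (simp_all add: X_def is_form_single sum_lookup_single)
  have S: "is_form 2 (S i)" "mpoly_eval (S i) x = (x $ i)\<^sup>2" for i x
    using is_form_mult[OF X(1) X(1)] by (simp_all add: S_def X(2) power2_eq_square numeral_2_eq_2)
  have K: "is_form 0 (K c)" "mpoly_eval (K c) x = c" for c x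
    by (simp_all add: K_def)
  have Kf: "is_form k (K c * q)" if "is_form k q" for k c q
    using is_form_mult[OF K(1) that] by simp
  have SS: "is_form 4 (S i * S j)" for i j using is_form_mult[OF S(1) S(1)] by simp
  \<comment> \<open>Quartic forms whose squares are the four parts of the certificate; the squares
    of \<open>F1\<close> over cyclic shifts add up to e_1 e_3 of the squared variables.\<close>
  define F1 where "F1 i j k = S i * (X j * X k)" for i j k
  define F2 where "F2 = (S u + S v + S w) * (S u + S v + S w) + K (- \<kappa>) * (S u * S v + S v * S w + S w * S u)"
  define F3 where "F3 i j k = (S i + K (- 1) * S j) * (K s * (S i + S j) + K (- t) * S k)" for i j k
  define F4 where "F4 i j = X i * X j * (S i + K (- 1) * S j)" for i j
  have "is_form 4 (F1 i j k)" for i j k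
    using is_form_mult[OF S(1) is_form_mult[OF X(1) X(1)]] by (simp add: F1_def)
  moreover have "is_form 4 F2"
    using is_form_mult[of 2 "S u + S v + S w" 2 "S u + S v + S w"]
    unfolding F2_def by (auto intro!: is_form_add Kf SS S)
  moreover have "is_form 4 (F3 i j k)" for i j k
    using is_form_mult[of 2 "S i + K (- 1) * S j" 2 "K s * (S i + S j) + K (- t) * S k"]
    unfolding F3_def by (auto intro!: is_form_add Kf S)
  moreover have "is_form 4 (F4 i j)" for i j
    using is_form_mult[OF is_form_mult[OF X(1) X(1), unfolded one_add_one], of 2 "S i + K (- 1) * S j"]
    unfolding F4_def by (auto intro!: is_form_add Kf S)
  ultimately have sos: "sos_fun (\<lambda>x. (l * (mpoly_eval (F1 u v w) x)\<^sup>2 + l * (mpoly_eval (F1 v w u) x)\<^sup>2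
        + l * (mpoly_eval (F1 w u v) x)\<^sup>2)
      + r * (mpoly_eval F2 x)\<^sup>2
      + (1 * (mpoly_eval (F3 u v w) x)\<^sup>2 + 1 * (mpoly_eval (F3 v w u) x)\<^sup>2 + 1 * (mpoly_eval (F3 w u v) x)\<^sup>2)
      + (\<mu> * (mpoly_eval (F4 u v) x)\<^sup>2 + \<mu> * (mpoly_eval (F4 v w) x)\<^sup>2 + \<mu> * (mpoly_eval (F4 w u) x)\<^sup>2))"
    using nonneg by (intro sos_fun_add sos_fun_square) auto
  have "mpoly_eval p x = (l * (mpoly_eval (F1 u v w) x)\<^sup>2 + l * (mpoly_eval (F1 v w u) x)\<^sup>2
        + l * (mpoly_eval (F1 w u v) x)\<^sup>2)
      + r * (mpoly_eval F2 x)\<^sup>2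
      + (1 * (mpoly_eval (F3 u v w) x)\<^sup>2 + 1 * (mpoly_eval (F3 v w u) x)\<^sup>2 + 1 * (mpoly_eval (F3 w u v) x)\<^sup>2)
      + (\<mu> * (mpoly_eval (F4 u v) x)\<^sup>2 + \<mu> * (mpoly_eval (F4 v w) x)\<^sup>2 + \<mu> * (mpoly_eval (F4 w u) x)\<^sup>2)" for x
  proof -
    have e: "mpoly_eval (F1 i j k) x = (x $ i)\<^sup>2 * (x $ j * x $ k)"
      "mpoly_eval (F3 i j k) x = ((x $ i)\<^sup>2 - (x $ j)\<^sup>2) * (s * ((x $ i)\<^sup>2 + (x $ j)\<^sup>2) - t * (x $ k)\<^sup>2)"
      "mpoly_eval (F4 i j) x = x $ i * x $ j * ((x $ i)\<^sup>2 - (x $ j)\<^sup>2)" for i j k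
      by (simp_all add: F1_def F3_def F4_def X S K)
    have e2: "mpoly_eval F2 x = ((x $ u)\<^sup>2 + (x $ v)\<^sup>2 + (x $ w)\<^sup>2)\<^sup>2
        - \<kappa> * ((x $ u)\<^sup>2 * (x $ v)\<^sup>2 + (x $ v)\<^sup>2 * (x $ w)\<^sup>2 + (x $ w)\<^sup>2 * (x $ u)\<^sup>2)"
      by (simp add: F2_def S K power2_eq_square[of "_ + _"])
    show ?thesis unfolding eval rep e e2 by (simp only: power_mult_distrib) algebra
  qed
  then have "sos_fun (mpoly_eval p)" using sos by presburger
  with form inv show ?thesis by (intro sos_D_formsI)
qed

theorem theorem4p27:
  fixes d :: nat
  assumes "CARD('n::finite) \<ge> 3" and "d \<ge> 1"
  shows "(sos_D_forms (2 * d) :: 'n real_mpoly set) = psd_D_forms (2 * d) \<longleftrightarrow>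
         2 * d = 2 \<or> 2 * d = 4 \<or> (CARD('n), 2 * d) = (3, 8)"
proof
  assume "(sos_D_forms (2 * d) :: 'n real_mpoly set) = psd_D_forms (2 * d)"
  then have "\<not> (3 \<le> d \<and> (d \<noteq> 4 \<or> CARD('n) \<noteq> 3))"
    using ex_psd_not_sos[where 'n = 'n, of d] assms(1) by blast
  then show "2 * d = 2 \<or> 2 * d = 4 \<or> (CARD('n), 2 * d) = (3, 8)"
    using assms(2) by auto
next
  assume "2 * d = 2 \<or> 2 * d = 4 \<or> (CARD('n), 2 * d) = (3, 8)"
  then have "(psd_D_forms (2 * d) :: 'n real_mpoly set) \<subseteq> sos_D_forms (2 * d)"
    using quadratic_psd_imp_sos[OF assms(1)] quartic_psd_imp_sos[OF assms(1)] octic_psd_imp_sos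
    by (elim disjE) auto
  with sos_D_forms_subset show "(sos_D_forms (2 * d) :: 'n real_mpoly set) = psd_D_forms (2 * d)"
    by blast
qed

end
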